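(* Let $V$ be the poset on $\{A,B,C\}$ with cover relations $A\lessdot B$ and $A\lessdot C$. For all integers $\ell\ge 1$ and $q\ge 3$, the order of $P$-strict promotion $\mathrm{Pro}$ acting on the set $\mathcal{L}_{V\times[\ell]}(R^q)$ of $V$-strict labelings of $V\times[\ell]$ with labels in $[q]$ divides $2q$ (that is, $\mathrm{Pro}^{2q}$ is the identity on $\mathcal{L}_{V\times[\ell]}(R^q)$).
   Context: Write $[m]=\{1,\dots,m\}$. $V$-strict labelings. $\mathcal{L}_{V\times[\ell]}(R^q)$ is the set of functions $f:V\times[\ell]\to\mathbb{Z}$ such that (1) $f(p_1,i)<f(p_2,i)$ whenever $p_1<_V p_2$ and $i\in[\ell]$; (2) $f(p,i_1)\le f(p,i_2)$ whenever $i_1\le i_2$; (3) $f(p,i)\in R^q(p)$, where $R^q(A)=\{1,\dots,q-1\}$ and $R^q(B)=R^q(C)=\{2,\dots,q\}$ (equivalently, all labels lie in $[q]$). For $p\in V$, the fiber $F_p$ is $\{(p,i): i\in[\ell]\}$. Raisable/lowerable. For $f\in\mathcal{L}_{V\times[\ell]}(R^q)$, the label $f(p,i)$ is raisable (resp. lowerable) if there is $g\in\mathcal{L}_{V\times[\ell]}(R^q)$ with $g(p,i)>f(p,i)$ (resp. $g(p,i)<f(p,i)$) and $g(p',i')=f(p',i')$ for all $(p',i')$ with $p'\ne p$ (other labels in the same fiber may change). Bender--Knuth involutions and promotion. For $1\le k\le q-1$, $\tau_k(f)$ is defined as follows: call free all raisable labels $f(p,i)=k$ and all lowerable labels $f(p,i)=k+1$.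 For each $p\in V$, if the fiber $F_p$ contains $a$ free labels $k$ followed by $b$ free labels $k+1$, then $\tau_k$ replaces these $a+b$ labels (in the same positions) by $b$ copies of $k$ followed by $a$ copies of $k+1$; all other labels are unchanged. Promotion is $\mathrm{Pro}=\tau_{q-1}\circ\cdots\circ\tau_2\circ\tau_1$ ($\tau_1$ applied first). *)

theory Defs
  imports "HOL-Algebra.Bij" "HOL-Algebra.Multiplicative_Group"
begin

datatype vee = vA | vB | vC

inductive covered_by :: "vee \<Rightarrow> vee \<Rightarrow> bool" where
  "covered_by vA vB"
| "covered_by vA vC"

instantiation vee :: order
begin

definition less_eq_vee :: "vee \<Rightarrow> vee \<Rightarrow> bool" where
  "p \<le> p' \<longleftrightarrow> covered_by\<^sup>*\<^sup>* p p'"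

definition less_vee :: "vee \<Rightarrow> vee \<Rightarrow> bool" where
  "p < p' \<longleftrightarrow> covered_by\<^sup>+\<^sup>+ p p'"

instance
proof -
  have tr: "covered_by\<^sup>+\<^sup>+ x y \<longleftrightarrow> covered_by x y" for x y
  proof
    assume "covered_by\<^sup>+\<^sup>+ x y"
    then show "covered_by x y"
      by (induction rule: tranclp_induct) (auto elim: covered_by.cases)
  qed auto
  have rt: "covered_by\<^sup>*\<^sup>* x y \<longleftrightarrow> x = y \<or> covered_by x y" for x y
    by (metis Nitpick.rtranclp_unfold tr)
  show "OFCLASS(vee, order_class)"
    by standard
      (auto simp: less_eq_vee_def less_vee_def tr rt elim: covered_by.cases)
qed

end

text \<open>
  Labelings are extensional (\<open>undefined\<close> off their domain), so that equality of functions
  is equality of labelings.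
\<close>

fun label_range :: "nat \<Rightarrow> vee \<Rightarrow> int set" where
  "label_range q vA = {1..int q - 1}"
| "label_range q vB = {2..int q}"
| "label_range q vC = {2..int q}"

definition labelings :: "nat \<Rightarrow> nat \<Rightarrow> (vee \<times> nat \<Rightarrow> int) set" where
  "labelings l q = {f \<in> extensional (UNIV \<times> {1..l}).
     (\<forall>p1 p2. \<forall>i\<in>{1..l}. p1 < p2 \<longrightarrow> f (p1, i) < f (p2, i)) \<and>
     (\<forall>p. \<forall>i1\<in>{1..l}. \<forall>i2\<in>{1..l}. i1 \<le> i2 \<longrightarrow> f (p, i1) \<le> f (p, i2)) \<and>
     (\<forall>p. \<forall>i\<in>{1..l}. f (p, i) \<in> label_range q p)}"

definition raisable :: "nat \<Rightarrow> nat \<Rightarrow> (vee \<times> nat \<Rightarrow> int) \<Rightarrow> vee \<Rightarrow> nat \<Rightarrow> bool" where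
  "raisable l q f p i \<longleftrightarrow>
     (\<exists>g\<in>labelings l q. g (p, i) > f (p, i) \<and>
        (\<forall>p'. \<forall>i'\<in>{1..l}. p' \<noteq> p \<longrightarrow> g (p', i') = f (p', i')))"

definition lowerable :: "nat \<Rightarrow> nat \<Rightarrow> (vee \<times> nat \<Rightarrow> int) \<Rightarrow> vee \<Rightarrow> nat \<Rightarrow> bool" where
  "lowerable l q f p i \<longleftrightarrow>
     (\<exists>g\<in>labelings l q. g (p, i) < f (p, i) \<and>
        (\<forall>p'. \<forall>i'\<in>{1..l}. p' \<noteq> p \<longrightarrow> g (p', i') = f (p', i')))"

definition free_lo :: "nat \<Rightarrow> nat \<Rightarrow> int \<Rightarrow> (vee \<times> nat \<Rightarrow> int) \<Rightarrow> vee \<Rightarrow> nat set" where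
  "free_lo l q k f p = {i \<in> {1..l}. f (p, i) = k \<and> raisable l q f p i}"

definition free_hi :: "nat \<Rightarrow> nat \<Rightarrow> int \<Rightarrow> (vee \<times> nat \<Rightarrow> int) \<Rightarrow> vee \<Rightarrow> nat set" where
  "free_hi l q k f p = {i \<in> {1..l}. f (p, i) = k + 1 \<and> lowerable l q f p i}"

text \<open>
  With \<open>b = card (free_hi l q k f p)\<close>, the first \<open>b\<close> of the free positions in
  the fiber of \<open>p\<close> receive \<open>k\<close> and the remaining ones receive \<open>k + 1\<close>.
\<close>

definition bender_knuth :: "nat \<Rightarrow> nat \<Rightarrow> int \<Rightarrow> (vee \<times> nat \<Rightarrow> int) \<Rightarrow> vee \<times> nat \<Rightarrow> int" where
  "bender_knuth l q k f = (\<lambda>(p, i).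
     let F = free_lo l q k f p \<union> free_hi l q k f p in
     if i \<in> F
     then (if card {j \<in> F. j < i} < card (free_hi l q k f p) then k else k + 1)
     else f (p, i))"

text \<open>\<^const>\<open>fold\<close> applies the head of the list first, so \<open>k = 1\<close> acts first.\<close>

definition promotion :: "nat \<Rightarrow> nat \<Rightarrow> (vee \<times> nat \<Rightarrow> int) \<Rightarrow> vee \<times> nat \<Rightarrow> int" where
  "promotion l q = fold (bender_knuth l q) [1..int q - 1]"

end

(* Join every label A of a labeling to a label B and to a label C by two noncrossing matchings.
   Promotion sends one label A after another to the far end, where it becomes a B or a C, while the
   nearer one of its two partners becomes an A.  After resolving the crossings of the two matchings
   into pairs of trivalent vertices one gets a cubic graph whose edges are properly coloured by A, B
   and C.  Moving an A recolours the graph along a two-coloured path and otherwise only rotates it.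
   The path turns at each vertex in a way that depends only on the graph, so in every full turn the
   path starting at a given boundary position is the same, and each vertex is traversed three times,
   once for each pair of its edges.  Each passage reverses the orientation of the colours at the
   vertex.  Hence a full turn, that is the q-th power of promotion, exchanges the fibers of B and C. *)

theory Submission
  imports Defs "HOL-Combinatorics.Permutations"
begin

text \<open>Promotion toggles labels, many of which are equal, while trips move single letters. The
  two are compared only through the numbers of letters with label at most \<open>z\<close>, which
  obey the same recurrence. Equal labels are spread over distinct positions, and the order chosen
  there makes successive trips from one label stop earlier and earlier, as the recurrence demands.
  The obstacle is to follow a path through a graph whose arcs are renamed at every trip. No graph is
  built and no path is traced. Every vertex stores, for each of its colours, where the last trip
  entering by that edge started, and a local invariant relates these records at neighbouring
  vertices and at the boundary. Along the path of the coming trip the invariant forces one constant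
  record, so a trip is always compared with its predecessor one turn back. The letters after a turn
  are then read off from the trips that hit them.\<close>

section \<open>Two noncrossing matchings and a trip\<close>

text \<open>Token \<open>i\<close> is a letter A at position \<open>a i\<close>, matched with a letter B at \<open>b i\<close> and with a
  letter C at \<open>c i\<close>. The case \<open>b i = c i\<close>, a tie, is the only coincidence of positions.\<close>

locale arc_system =
  fixes I :: "nat set" and N :: int and a b c :: "nat \<Rightarrow> int"
  assumes fin: "finite I"
    and a_less_b: "i \<in> I \<Longrightarrow> a i < b i"
    and a_less_c: "i \<in> I \<Longrightarrow> a i < c i"
    and inj_a: "inj_on a I" and inj_b: "inj_on b I" and inj_c: "inj_on c I"
    and a_neq_b: "\<lbrakk>i \<in> I; j \<in> I\<rbrakk> \<Longrightarrow> a i \<noteq> b j"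
    and a_neq_c: "\<lbrakk>i \<in> I; j \<in> I\<rbrakk> \<Longrightarrow> a i \<noteq> c j"
    and b_eq_c: "\<lbrakk>i \<in> I; j \<in> I; b i = c j\<rbrakk> \<Longrightarrow> i = j"
    and nested_b: "\<lbrakk>i \<in> I; j \<in> I; a i < a j; a j < b i\<rbrakk> \<Longrightarrow> b j < b i"
    and nested_c: "\<lbrakk>i \<in> I; j \<in> I; a i < a j; a j < c i\<rbrakk> \<Longrightarrow> c j < c i"
    and window_b: "\<lbrakk>i \<in> I; j \<in> I\<rbrakk> \<Longrightarrow> b i < a j + N"
    and window_c: "\<lbrakk>i \<in> I; j \<in> I\<rbrakk> \<Longrightarrow> c i < a j + N"
begin

text \<open>A trip that hits a C is a trip that hits a B in the swapped system, so the untied step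
  is treated for \<open>b e < c e\<close> only.\<close>

lemma swap: "arc_system I N a c b"
  using fin a_less_b a_less_c inj_a inj_b inj_c a_neq_b a_neq_c b_eq_c nested_b nested_c
    window_b window_c
  by unfold_locales (auto dest: b_eq_c[OF _ _ sym])

lemma a_eq: "\<lbrakk>i \<in> I; j \<in> I; a i = a j\<rbrakk> \<Longrightarrow> i = j"
  using inj_a by (auto dest: inj_onD)

lemma b_eq: "\<lbrakk>i \<in> I; j \<in> I; b i = b j\<rbrakk> \<Longrightarrow> i = j"
  using inj_b by (auto dest: inj_onD)

lemma c_eq: "\<lbrakk>i \<in> I; j \<in> I; c i = c j\<rbrakk> \<Longrightarrow> i = j"
  using inj_c by (auto dest: inj_onD)

end

definition spanning :: "nat set \<Rightarrow> (nat \<Rightarrow> int) \<Rightarrow> (nat \<Rightarrow> int) \<Rightarrow> int \<Rightarrow> nat set" where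
  "spanning I a c y = {j \<in> I. a j < y \<and> y < c j}"

text \<open>When the letter B at \<open>y\<close> becomes an A, the AC arcs spanning \<open>y\<close> have to be matched anew: their
  right ends are shifted cyclically along \<open>rot\<close>, and the front token \<open>e\<close>, now standing at \<open>y\<close>,
  receives the innermost one.\<close>

definition rot :: "nat set \<Rightarrow> (nat \<Rightarrow> int) \<Rightarrow> (nat \<Rightarrow> int) \<Rightarrow> nat \<Rightarrow> int \<Rightarrow> nat \<Rightarrow> nat" where
  "rot I a c e y j =
     (let U = spanning I a c y in
      if j \<in> U then arg_min_on (\<lambda>k. - a k) (if j = e then U else {k \<in> U. a k < a j}) else j)"

section \<open>One trip acting on the two matchings\<close>

locale arc_step = arc_system +
  fixes e :: nat
  assumes e: "e \<in> I" and front: "i \<in> I \<Longrightarrow> a e \<le> a i" and be_less_ce: "b e < c e"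
begin

abbreviation "U \<equiv> spanning I a c (b e)"
abbreviation "\<sigma> \<equiv> rot I a c e (b e)"
abbreviation "a' \<equiv> a(e := b e)"
text \<open>Positions lie on a circle of length \<open>N\<close> unrolled to a line: the vacated
  front place reappears as a B one period later.\<close>

abbreviation "b' \<equiv> b(e := a e + N)"
abbreviation "c' \<equiv> c \<circ> \<sigma>"

lemma e_in_U: "e \<in> U"
  using e be_less_ce a_less_b by (auto simp: spanning_def)

lemma U_iff: "j \<in> U \<longleftrightarrow> j \<in> I \<and> a j < b e \<and> b e < c j"
  by (auto simp: spanning_def)

lemma U_subset: "U \<subseteq> I" and fin_U: "finite U"
  using fin by (auto simp: spanning_def)

lemma \<sigma>_out: "j \<notin> U \<Longrightarrow> \<sigma> j = j"
  by (simp add: rot_def Let_def)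

lemma front_less: "i \<in> I \<Longrightarrow> i \<noteq> e \<Longrightarrow> a e < a i"
  using front[of i] a_eq[of e i] e by force

text \<open>The front token is the outermost arc of \<open>U\<close>, so every other member has a
  next outer one. This is what gives \<open>arg_min_on\<close> a meaning here.\<close>

lemma \<sigma>_dom:
  assumes "j \<in> U" shows "(if j = e then U else {k \<in> U. a k < a j}) \<noteq> {}"
    "finite (if j = e then U else {k \<in> U. a k < a j})"
proof -
  show "finite (if j = e then U else {k \<in> U. a k < a j})"
    using fin_U by simp
  show "(if j = e then U else {k \<in> U. a k < a j}) \<noteq> {}"
  proof (cases "j = e")
    case True then show ?thesis using e_in_U by auto
  next
    case False
    then have "a e < a j" using assms U_subset front_less by auto
    then show ?thesis using False e_in_U by auto
  qed
qed

lemma \<sigma>_arg: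
  assumes "j \<in> U"
  shows "\<sigma> j \<in> (if j = e then U else {k \<in> U. a k < a j})"
    and "k \<in> (if j = e then U else {k \<in> U. a k < a j}) \<Longrightarrow> a k \<le> a (\<sigma> j)"
proof -
  let ?S = "if j = e then U else {k \<in> U. a k < a j}"
  have eq: "\<sigma> j = arg_min_on (\<lambda>k. - a k) ?S"
    using assms by (simp add: rot_def Let_def)
  show "\<sigma> j \<in> ?S"
    unfolding eq by (rule arg_min_if_finite(1)[OF \<sigma>_dom(2)[OF assms] \<sigma>_dom(1)[OF assms]])
  show "a k \<le> a (\<sigma> j)" if "k \<in> ?S"
    using arg_min_least[OF \<sigma>_dom(2)[OF assms] \<sigma>_dom(1)[OF assms] that, of "\<lambda>k. - a k"]
    unfolding eq by simp
qed

lemma \<sigma>_in: "j \<in> U \<Longrightarrow> \<sigma> j \<in> U"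
  using \<sigma>_arg(1)[of j] by (auto split: if_splits)

lemma \<sigma>_in_iff: "\<sigma> j \<in> U \<longleftrightarrow> j \<in> U"
  using \<sigma>_in[of j] \<sigma>_out[of j] by (cases "j \<in> U") simp_all

lemma \<sigma>_e: "k \<in> U \<Longrightarrow> a k \<le> a (\<sigma> e)"
  using \<sigma>_arg(2)[OF e_in_U] by auto

lemma \<sigma>_less: "j \<in> U \<Longrightarrow> j \<noteq> e \<Longrightarrow> a (\<sigma> j) < a j"
  using \<sigma>_arg(1)[of j] by auto

lemma \<sigma>_max: "j \<in> U \<Longrightarrow> j \<noteq> e \<Longrightarrow> k \<in> U \<Longrightarrow> a k < a j \<Longrightarrow> a k \<le> a (\<sigma> j)"
  using \<sigma>_arg(2)[of j k] by auto

lemma \<sigma>_mono: "i \<in> U \<Longrightarrow> j \<in> U \<Longrightarrow> i \<noteq> e \<Longrightarrow> j \<noteq> e \<Longrightarrow> a i < a j \<Longrightarrow> a (\<sigma> i) < a (\<sigma> j)"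
  using \<sigma>_less[of i] \<sigma>_max[of j i] by auto

lemma \<sigma>_inj_U: "inj_on \<sigma> U"
proof (rule inj_onI)
  fix i j assume ij: "i \<in> U" "j \<in> U" "\<sigma> i = \<sigma> j"
  have *: False if "i' \<in> U" "j' \<in> U" "\<sigma> i' = \<sigma> j'" "i' = e" "j' \<noteq> e" for i' j'
  proof -
    have "a j' \<le> a (\<sigma> e)" using \<sigma>_e that(2) by blast
    moreover have "a (\<sigma> j') < a j'" using \<sigma>_less that(2,5) by blast
    ultimately show False using that(3,4) by simp
  qed
  show "i = j"
  proof (rule ccontr)
    assume "i \<noteq> j"
    then have "a i \<noteq> a j" using a_eq ij U_subset by blast
    moreover have "i \<noteq> e" "j \<noteq> e" using *[OF ij] *[OF ij(2,1) ij(3)[symmetric]] \<open>i \<noteq> j\<close> by blast+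
    moreover have "\<not> a i < a j" "\<not> a j < a i"
      using \<sigma>_mono[OF ij(1,2) \<open>i \<noteq> e\<close> \<open>j \<noteq> e\<close>] \<sigma>_mono[OF ij(2,1) \<open>j \<noteq> e\<close> \<open>i \<noteq> e\<close>] ij(3)
      by force+
    ultimately show False by simp
  qed
qed

lemma \<sigma>_eq: "\<sigma> i = \<sigma> j \<longleftrightarrow> i = j"
proof
  assume eq: "\<sigma> i = \<sigma> j"
  then have "i \<in> U \<longleftrightarrow> j \<in> U" using \<sigma>_in_iff[of i] \<sigma>_in_iff[of j] by simp
  then show "i = j" using eq inj_onD[OF \<sigma>_inj_U eq] \<sigma>_out[of i] \<sigma>_out[of j]
    by (cases "i \<in> U") simp_all
qed simp

lemma \<sigma>_surj_U: "\<sigma> ` U = U"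
  by (rule endo_inj_surj[OF fin_U _ \<sigma>_inj_U]) (use \<sigma>_in in blast)

lemma \<sigma>_I: "\<sigma> j \<in> I \<longleftrightarrow> j \<in> I"
  using \<sigma>_in[of j] \<sigma>_out[of j] U_subset by (cases "j \<in> U") auto

lemma \<sigma>_surj: "\<exists>j. \<sigma> j = k"
proof (cases "k \<in> U")
  case True
  then have "k \<in> \<sigma> ` U" by (simp only: \<sigma>_surj_U)
  then show ?thesis by blast
next
  case False
  then show ?thesis using \<sigma>_out by blast
qed

lemma bij_\<sigma>: "bij_betw \<sigma> I I"
  unfolding bij_betw_def
proof
  show "inj_on \<sigma> I" by (rule inj_onI) (simp add: \<sigma>_eq)
  show "\<sigma> ` I = I"
  proof (intro equalityI subsetI)
    fix k assume "k \<in> I"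
    obtain j where "\<sigma> j = k" using \<sigma>_surj by blast
    then show "k \<in> \<sigma> ` I" using \<sigma>_I[of j] \<open>k \<in> I\<close> by blast
  next
    fix k assume "k \<in> \<sigma> ` I"
    then show "k \<in> I" using \<sigma>_I by blast
  qed
qed

text \<open>All arcs of \<open>U\<close> contain the point \<open>b e\<close>, so noncrossing means
  nested.\<close>

lemma c_decreasing: "i \<in> U \<Longrightarrow> j \<in> U \<Longrightarrow> a i < a j \<Longrightarrow> c j < c i"
  using nested_c[of i j] by (auto simp: U_iff)

lemma c_less_iff:
  assumes "i \<in> U" "j \<in> U"
  shows "c j < c i \<longleftrightarrow> a i < a j"
proof
  assume "c j < c i"
  note ij = assms this
  then have "i \<noteq> j" "\<not> a j < a i" using c_decreasing[of j i] by auto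
  moreover have "a i \<noteq> a j" using a_eq[of i j] ij U_iff \<open>i \<noteq> j\<close> by blast
  ultimately show "a i < a j" by simp
qed (rule c_decreasing[OF assms])

text \<open>Since \<open>e\<close> starts first, \<open>a i < b e\<close> already puts the start of
  \<open>i\<close> under the front AB arc.\<close>

lemma b_inner: "i \<in> I \<Longrightarrow> i \<noteq> e \<Longrightarrow> a i < b e \<Longrightarrow> b i < b e"
  using nested_b[of e i] e front_less by auto

lemma c_neq_be: "i \<in> I \<Longrightarrow> c i \<noteq> b e"
  using b_eq_c[OF e, of i] be_less_ce by (metis less_irrefl)

text \<open>Away from \<open>b e\<close> the AC arcs run as before; at \<open>b e\<close> each arc
  of \<open>U\<close> other than the front one continues as the next outer one. These arcs stay
  nested, and the innermost right end, left over, goes to the arc that now starts at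
  \<open>b e\<close>.\<close>

lemma step: "arc_system I N a' b' c'"
proof
  fix i j assume i: "i \<in> I" and j: "j \<in> I"
  have \<sigma>i: "\<sigma> i \<in> I" and \<sigma>j: "\<sigma> j \<in> I" using i j \<sigma>_I by auto
  show "a' i < b' i" using i e a_less_b window_b by auto
  have Uc: "b e < c (\<sigma> k)" if "k \<in> U" for k using \<sigma>_in[OF that] U_iff by blast
  show "a' i < c' i"
  proof (cases "i \<in> U")
    case True
    then show ?thesis using Uc[of i] by (auto simp: U_iff)
  qed (use i a_less_c \<sigma>_out e_in_U in auto)
  show "a' i \<noteq> b' j"
    using a_neq_b[OF i j] b_eq[OF e j] a_less_b[OF i] window_b[OF i e] window_b[OF e e]
    by (cases "i = e"; cases "j = e"; force)
  show "a' i \<noteq> c' j"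
    using i \<sigma>j a_neq_c c_neq_be[of "\<sigma> j"] by auto
  show "b' i < a' j + N" "c' i < a' j + N"
    using i j window_b[OF i e] window_c[OF \<sigma>i e] front_less[OF j] a_less_b[OF e]
    by (cases "i = e"; cases "j = e"; simp)+
  show "i = j" if eq: "b' i = c' j"
  proof -
    have "i \<noteq> e" using eq window_c[of "\<sigma> j" e] \<sigma>j e by auto
    then have "i = \<sigma> j" using eq b_eq_c[OF i \<sigma>j] by auto
    show ?thesis
    proof (cases "j \<in> U")
      case True
      then have "i \<in> U" using \<sigma>_in \<open>i = \<sigma> j\<close> by auto
      then show ?thesis using b_inner[OF i \<open>i \<noteq> e\<close>] eq \<open>i = \<sigma> j\<close> \<open>i \<noteq> e\<close>
        by (auto simp: U_iff)
    qed (use \<open>i = \<sigma> j\<close> \<sigma>_out in auto)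
  qed
  show "b' j < b' i" if "a' i < a' j" "a' j < b' i"
    using that i j e b_inner[of i] nested_b[of i j] window_b[of j e] by (auto split: if_splits)
  show "c' j < c' i" if l: "a' i < a' j" "a' j < c' i"
  proof (cases "i \<in> U"; cases "j \<in> U")
    assume U: "i \<in> U" "j \<in> U"
    have "i \<noteq> e" using U l by (auto simp: U_iff split: if_splits)
    have "i \<noteq> j" using l by auto
    \<comment> \<open>Right ends decrease along \<open>U\<close>, so it suffices to compare the
      starts of the arcs that take over.\<close>
    have "a (\<sigma> i) < a (\<sigma> j)"
    proof (cases "j = e")
      case True
      then show ?thesis using \<sigma>_e[OF \<sigma>_in[OF U(1)]] \<sigma>_eq[of i j] \<open>i \<noteq> j\<close> a_eq[OF \<sigma>i \<sigma>j] by force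
    next
      case False
      then show ?thesis using \<sigma>_mono[OF U \<open>i \<noteq> e\<close>] l \<open>i \<noteq> e\<close> by auto
    qed
    then show ?thesis using c_decreasing[OF \<sigma>_in[OF U(1)] \<sigma>_in[OF U(2)]] by simp
  next
    assume U: "i \<in> U" "j \<notin> U"
    then have je: "j \<noteq> e" using e_in_U by auto
    have "a (\<sigma> i) < a j"
    proof (cases "i = e")
      case True
      then show ?thesis using l je \<sigma>_in[OF e_in_U] by (auto simp: U_iff)
    next
      case False
      then show ?thesis using l je \<sigma>_less[OF U(1) False] by auto
    qed
    then show ?thesis using nested_c[OF \<sigma>i j] l je \<sigma>_out[OF U(2)] by auto
  next
    assume U: "i \<notin> U" "j \<in> U"
    then have ie: "i \<noteq> e" using e_in_U by auto
    have l': "a i < a' j" "a' j < c i" using l ie \<sigma>_out[OF U(1)] by auto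
    show ?thesis
    proof (cases "j = e")
      case True then show ?thesis using l' U i by (auto simp: U_iff)
    next
      case False
      then have "c j < c i" using nested_c[OF i j] l' by auto
      then show ?thesis using U i l' False by (auto simp: U_iff)
    qed
  next
    assume U: "i \<notin> U" "j \<notin> U"
    then show ?thesis using l nested_c[OF i j] \<sigma>_out e_in_U by (auto split: if_splits)
  qed
next
  show "finite I" by (rule fin)
  show "inj_on a' I"
  proof (rule inj_onI)
    fix i j assume "i \<in> I" "j \<in> I" "a' i = a' j"
    then show "i = j" using a_neq_b[of i e] a_neq_b[of j e] a_eq[of i j] e
      by (auto split: if_splits)
  qed
  show "inj_on b' I"
  proof (rule inj_onI)
    fix i j assume "i \<in> I" "j \<in> I" "b' i = b' j"
    then show "i = j" using window_b[of i e] window_b[of j e] b_eq[of i j] e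
      by (auto split: if_splits)
  qed
  show "inj_on c' I"
  proof (rule inj_onI)
    fix i j assume "i \<in> I" "j \<in> I" "c' i = c' j"
    then show "i = j" using c_eq[of "\<sigma> i" "\<sigma> j"] \<sigma>_I \<sigma>_eq by simp
  qed
qed

end

section \<open>The coloured cubic graph\<close>

text \<open>Resolve every crossing of an AB arc with an AC arc into two trivalent vertices, and let the two
  arcs of a token share an edge at their common start. Promotion recolours this graph along
  two-coloured paths. Only one vertex of every crossing is represented: \<open>(k, j)\<close> is the vertex at
  which the AB arc of \<open>k\<close> and the AC arc of \<open>j\<close> separate, at a crossing or, if \<open>k = j\<close>, at
  their start. On each arc the vertices are ordered by \<open>key\<close>, the end of the crossing arc that lies
  below the given arc.\<close>

definition cross :: "(nat \<Rightarrow> int) \<Rightarrow> (nat \<Rightarrow> int) \<Rightarrow> (nat \<Rightarrow> int) \<Rightarrow> nat \<Rightarrow> nat \<Rightarrow> bool" where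
  "cross a b c k j \<longleftrightarrow> a k < a j \<and> a j < b k \<and> b k < c j \<or> a j < a k \<and> a k < c j \<and> c j < b k"

definition vert ::
  "nat set \<Rightarrow> (nat \<Rightarrow> int) \<Rightarrow> (nat \<Rightarrow> int) \<Rightarrow> (nat \<Rightarrow> int) \<Rightarrow> nat \<Rightarrow> nat \<Rightarrow> bool" where
  "vert I a b c k j \<longleftrightarrow>
     k \<in> I \<and> j \<in> I \<and> b k \<noteq> c k \<and> b j \<noteq> c j \<and> (k = j \<or> cross a b c k j)"

definition key :: "(nat \<Rightarrow> int) \<Rightarrow> (nat \<Rightarrow> int) \<Rightarrow> nat \<Rightarrow> nat \<Rightarrow> int" where
  "key a c k j = (if a j < a k then c j else a j)"

definition adj ::
  "nat set \<Rightarrow> (nat \<Rightarrow> int) \<Rightarrow> (nat \<Rightarrow> int) \<Rightarrow> (nat \<Rightarrow> int) \<Rightarrow> nat \<Rightarrow> nat \<Rightarrow> nat \<Rightarrow> bool" where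
  "adj I a b c k j j' \<longleftrightarrow> vert I a b c k j \<and> vert I a b c k j' \<and> key a c k j < key a c k j' \<and>
     (\<forall>m. vert I a b c k m \<longrightarrow> \<not> (key a c k j < key a c k m \<and> key a c k m < key a c k j'))"

definition final ::
  "nat set \<Rightarrow> (nat \<Rightarrow> int) \<Rightarrow> (nat \<Rightarrow> int) \<Rightarrow> (nat \<Rightarrow> int) \<Rightarrow> nat \<Rightarrow> nat \<Rightarrow> bool" where
  "final I a b c k j \<longleftrightarrow> vert I a b c k j \<and>
     (\<forall>m. vert I a b c k m \<longrightarrow> key a c k m \<le> key a c k j)"

lemma cross_swap: "cross a c b j k \<longleftrightarrow> cross a b c k j"
  by (auto simp: cross_def)

lemma vert_swap: "vert I a c b j k \<longleftrightarrow> vert I a b c k j"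
  by (auto simp: vert_def cross_swap)

text \<open>\<open>adj I a c b j\<close> is adjacency along the AC arc of \<open>j\<close>, a column
  of vertices. This form keeps the AB arc as the first index of every vertex.\<close>

lemma adj_swap: "adj I a c b j k k' \<longleftrightarrow> vert I a b c k j \<and> vert I a b c k' j \<and>
    key a b j k < key a b j k' \<and>
    (\<forall>m. vert I a b c m j \<longrightarrow> \<not> (key a b j k < key a b j m \<and> key a b j m < key a b j k'))"
  by (simp add: adj_def vert_swap)

lemma final_swap: "final I a c b j k \<longleftrightarrow> vert I a b c k j \<and>
    (\<forall>m. vert I a b c m j \<longrightarrow> key a b j m \<le> key a b j k)"
  by (simp add: final_def vert_swap)

text \<open>\<open>hA k j\<close> is the start of the last trip that entered \<open>(k, j)\<close> through its A-coloured edge, and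
  similarly for \<open>hB\<close> and \<open>hC\<close>; \<open>sg v\<close> says that the trip starting at \<open>v\<close> hit a B, and \<open>kr p\<close> is the
  start of the last trip that hit position \<open>p\<close> modulo \<open>N\<close>. Three successive trips through a vertex
  use its three pairs of edges in cyclic order, so these labels determine which trip left through
  which edge. The orientation of \<open>(k, j)\<close> is the truth value of \<open>b k < c j\<close>.\<close>

locale labelled = arc_system +
  fixes lab :: "int \<Rightarrow> int" and sg :: "int \<Rightarrow> bool" and kr :: "int \<Rightarrow> int"
    and hA hB hC :: "nat \<Rightarrow> nat \<Rightarrow> int"
  assumes lab_a: "\<lbrakk>k \<in> I; b k \<noteq> c k\<rbrakk> \<Longrightarrow> hA k k = lab (a k)"
    \<comment> \<open>In present colours the past passages run A to B to C to A if
      \<open>b k < c j\<close>, and the other way round otherwise. The conditional picks the last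
      trip that left by the A edge; those below do the same for the B and the C edge.\<close>
    and kr_a: "\<lbrakk>k \<in> I; b k \<noteq> c k\<rbrakk> \<Longrightarrow> (if b k < c k then hC k k else hB k k) = kr (a k)"
    and lab_b: "final I a b c k j \<Longrightarrow> hB k j = lab (b k)"
    and kr_b: "final I a b c k j \<Longrightarrow> (if b k < c j then hA k j else hC k j) = kr (b k)"
    and lab_c: "final I a c b j k \<Longrightarrow> hC k j = lab (c j)"
    and kr_c: "final I a c b j k \<Longrightarrow> (if b k < c j then hB k j else hA k j) = kr (c j)"
    \<comment> \<open>The links stand for the second vertex of a crossing, where the AB arc coming
      from \<open>(k, j1)\<close> and the AC arc coming from \<open>(k1, j)\<close> merge into the A
      edge of \<open>(k, j)\<close>. Trips leaving one of these three vertices are identified with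
      trips entering the next. The turns at the merging vertex are B to A to C to B here, and the
      reverse in \<open>link_neg\<close>.\<close>
    and link_pos: "\<lbrakk>cross a b c k j; adj I a b c k j1 j; adj I a c b j k1 k; b k < c j\<rbrakk> \<Longrightarrow>
        (if b k < c j1 then hA k j1 else hC k j1) = hA k j \<and>
        (if b k1 < c j then hB k1 j else hA k1 j) = hB k j1 \<and> hC k j = hC k1 j"
    and link_neg: "\<lbrakk>cross a b c k j; adj I a b c k j1 j; adj I a c b j k1 k; c j < b k\<rbrakk> \<Longrightarrow>
        (if b k1 < c j then hB k1 j else hA k1 j) = hA k j \<and>
        (if b k < c j1 then hA k j1 else hC k j1) = hC k1 j \<and> hB k j = hB k j1"
    \<comment> \<open>An edge is coloured A again after three passages, each reversing the
      orientation. So the present orientation is opposite to the one met by the recorded trip, which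
      is the source of the exchange of B and C. A negative record means that there was no such trip
      yet.\<close>
    and sgn_a: "\<lbrakk>vert I a b c k j; 0 \<le> hA k j\<rbrakk> \<Longrightarrow> sg (hA k j) \<longleftrightarrow> c j < b k"
    and sgn_b: "\<lbrakk>vert I a b c k j; 0 \<le> hB k j\<rbrakk> \<Longrightarrow> sg (hB k j)"
    and sgn_c: "\<lbrakk>vert I a b c k j; 0 \<le> hC k j\<rbrakk> \<Longrightarrow> \<not> sg (hC k j)"
begin

lemma vert_neq: "vert I a b c k j \<Longrightarrow> b k \<noteq> c j"
  using b_eq_c by (auto simp: vert_def)

lemma labelled_swap:
  "labelled I N a c b lab (\<lambda>x. \<not> sg x) kr (\<lambda>j k. hA k j) (\<lambda>j k. hC k j) (\<lambda>j k. hB k j)"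
proof -
  interpret S: arc_system I N a c b by (rule swap)
  show ?thesis
  proof
    fix k j assume v: "vert I a c b k j"
    then have v': "vert I a b c j k" by (simp add: vert_swap)
    have ne: "b j \<noteq> c k" using vert_neq[OF v'] .
    show "0 \<le> hA j k \<Longrightarrow> (\<not> sg (hA j k)) = (b j < c k)"
      using sgn_a[OF v'] ne by auto
    show "0 \<le> hC j k \<Longrightarrow> \<not> sg (hC j k)" using sgn_c[OF v'] .
    show "0 \<le> hB j k \<Longrightarrow> \<not> \<not> sg (hB j k)" using sgn_b[OF v'] by simp
  next
    fix k assume k: "k \<in> I" "c k \<noteq> b k"
    show "hA k k = lab (a k)" using lab_a k by auto
    show "(if c k < b k then hB k k else hC k k) = kr (a k)" using kr_a[of k] k by auto
  next
    fix k j assume f: "final I a c b k j"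
    have ne: "b j \<noteq> c k" using f vert_neq by (auto simp: final_def vert_swap)
    show "hC j k = lab (c k)" using lab_c f by blast
    show "(if c k < b j then hA j k else hB j k) = kr (c k)"
      using kr_c[OF f] ne by (auto split: if_splits)
  next
    fix k j assume f: "final I a b c j k"
    have ne: "b j \<noteq> c k" using f vert_neq by (auto simp: final_def)
    show "hB j k = lab (b j)" using lab_b f by blast
    show "(if c k < b j then hC j k else hA j k) = kr (b j)"
      using kr_b[OF f] ne by (auto split: if_splits)
  next
    fix k j j1 k1
    assume h: "cross a c b k j" "adj I a c b k j1 j" "adj I a b c j k1 k"
    have cr: "cross a b c j k" using h by (simp add: cross_swap)
    have ne: "b j1 \<noteq> c k" using h(2) vert_neq by (auto simp: adj_def vert_swap)
    have ne': "b j \<noteq> c k1" using h(3) vert_neq by (auto simp: adj_def)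
    show "c k < b j \<Longrightarrow> (if c k < b j1 then hA j1 k else hB j1 k) = hA j k \<and>
       (if c k1 < b j then hC j k1 else hA j k1) = hC j1 k \<and> hB j k = hB j k1"
      using link_neg[OF cr h(3,2)] ne ne' by (auto split: if_splits)
    show "b j < c k \<Longrightarrow> (if c k1 < b j then hC j k1 else hA j k1) = hA j k \<and>
       (if c k < b j1 then hA j1 k else hB j1 k) = hB j k1 \<and> hC j k = hC j1 k"
      using link_pos[OF cr h(3,2)] ne ne' by (auto split: if_splits)
  qed
qed

end

section \<open>The graph before and after a trip\<close>

context arc_step
begin

abbreviation "V \<equiv> vert I a b c"
abbreviation "V' \<equiv> vert I a' b' c'"

text \<open>The vertex \<open>(k, j)\<close> after the trip is the former vertex \<open>(k, \<tau> k j)\<close>.\<close>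

definition \<tau> :: "nat \<Rightarrow> nat \<Rightarrow> nat" where
  "\<tau> k j = (if k \<noteq> e \<and> a k < b e then j else \<sigma> j)"

lemma ce_less: "i \<in> I \<Longrightarrow> c i < a e + N" "i \<in> I \<Longrightarrow> b i < a e + N"
  using window_b window_c e by auto

lemma V_I: "V k j \<Longrightarrow> k \<in> I" "V k j \<Longrightarrow> j \<in> I" "V' k j \<Longrightarrow> k \<in> I" "V' k j \<Longrightarrow> j \<in> I"
  by (auto simp: vert_def)

lemma U_untied: "j \<in> U \<Longrightarrow> b j \<noteq> c j"
  using be_less_ce b_inner[of j] by (cases "j = e") (auto simp: U_iff)

lemma U_c\<sigma>: "j \<in> U \<Longrightarrow> b e < c (\<sigma> j) \<and> a (\<sigma> j) < b e"
  using \<sigma>_in[of j] by (auto simp: U_iff)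

lemma U_less: "j \<in> U \<Longrightarrow> j \<noteq> e \<Longrightarrow> a e < a j \<and> a j < b e \<and> b j < b e"
  using front_less[of j] b_inner[of j] by (auto simp: U_iff)

lemma a_neq_be: "k \<in> I \<Longrightarrow> a k \<noteq> b e"
  using a_neq_b e by auto

lemma untied_step: "k \<in> I \<Longrightarrow> b' k \<noteq> c' k \<longleftrightarrow> b k \<noteq> c k"
proof (cases "k = e")
  case True
  then show ?thesis using ce_less(1)[of "\<sigma> e"] \<sigma>_I e be_less_ce by auto
next
  case False
  assume "k \<in> I"
  then show ?thesis
    using False U_less[of k] U_c\<sigma>[of k] U_untied[of k] \<sigma>_out[of k] by (cases "k \<in> U") auto
qed

lemma untied_\<sigma>: "b (\<sigma> j) \<noteq> c (\<sigma> j) \<longleftrightarrow> b j \<noteq> c j"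
  using U_untied[of j] U_untied[of "\<sigma> j"] \<sigma>_in[of j] \<sigma>_out[of j] by (cases "j \<in> U") auto

text \<open>As \<open>e\<close> starts first, another AC arc can cross the front AB arc only by
  starting under it and ending beyond \<open>b e\<close>.\<close>

lemma V_e: "V e j \<longleftrightarrow> j \<in> U"
proof
  assume v: "V e j"
  then show "j \<in> U"
    using e_in_U front[of j] by (auto simp: vert_def cross_def U_iff)
next
  assume j: "j \<in> U"
  then show "V e j"
    using U_untied[OF j] U_untied[OF e_in_U] e U_less[OF j] by (auto simp: vert_def cross_def U_iff)
qed

text \<open>The new end \<open>a e + N\<close> lies beyond all C ends, so only AC arcs containing
  the new start \<open>b e\<close> are crossed.\<close>

lemma V'_e: "V' e j \<longleftrightarrow> j \<in> U"
proof
  assume v: "V' e j"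
  then have j: "j \<in> I" by (simp add: vert_def)
  have "c (\<sigma> j) < a e + N" using ce_less \<sigma>_I j by auto
  then have "j = e \<or> a j < b e \<and> b e < c (\<sigma> j)"
    using v by (auto simp: vert_def cross_def split: if_splits)
  then show "j \<in> U" using e_in_U j \<sigma>_out[of j] by (cases "b e < c j") (auto simp: U_iff)
next
  assume j: "j \<in> U"
  then show "V' e j"
    using U_untied[OF j] U_untied[OF e_in_U] e untied_step[OF e] untied_step[of j]
      U_less[OF j] U_c\<sigma>[OF j] ce_less(1)[of "\<sigma> j"] \<sigma>_I[of j]
    by (auto simp: vert_def cross_def U_iff)
qed

text \<open>The AC arc of \<open>e\<close> covers the whole AB arc of such a
  \<open>k\<close>.\<close>

lemma inner_V: "V k j \<Longrightarrow> k \<noteq> e \<Longrightarrow> a k < b e \<Longrightarrow> j \<noteq> e"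
  using front[of k] b_inner[of k] be_less_ce by (auto simp: vert_def cross_def)

text \<open>An AB arc other than that of \<open>e\<close> lies on one side of \<open>b e\<close>. On
  the left it still meets the old AC arc \<open>j\<close>; on the right it meets what this arc
  continues as, the old arc \<open>\<sigma> j\<close>. The crossing numbers change
  accordingly.\<close>

lemma V_step: "V' k j \<longleftrightarrow> V k (\<tau> k j)"
proof (cases "k \<in> I \<and> j \<in> I")
  case False
  then show ?thesis using \<sigma>_I by (auto simp: vert_def \<tau>_def)
next
  case True
  then have k: "k \<in> I" and j: "j \<in> I" by auto
  consider "k = e" | "k \<noteq> e" "a k < b e" | "k \<noteq> e" "a k > b e"
    using a_neq_be[OF k] by force
  then show ?thesis
  proof cases
    case 1
    then show ?thesis by (simp add: V_e V'_e \<tau>_def \<sigma>_in_iff)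
  next
    case 2
    have bk: "b k < b e" using b_inner[OF k 2] .
    have "cross a' b' c' k j \<longleftrightarrow> cross a b c k j"
    proof (cases "j \<in> U")
      case True
      then show ?thesis
        using 2 bk U_c\<sigma>[OF True] front_less[OF k 2(1)] be_less_ce
        by (auto simp: cross_def U_iff)
    next
      case False
      then show ?thesis using 2 \<sigma>_out[of j] e_in_U by (auto simp: cross_def)
    qed
    then show ?thesis using 2 untied_step[OF k] untied_step[OF j]
      by (simp add: vert_def \<tau>_def)
  next
    case 3
    then have kU: "k \<notin> U" by (auto simp: U_iff)
    have "cross a' b' c' k j \<longleftrightarrow> cross a b c k (\<sigma> j)"
    proof (cases "j \<in> U")
      case True
      then show ?thesis
        using 3 U_c\<sigma>[OF True]
        by (auto simp: cross_def U_iff)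
    next
      case False
      then show ?thesis using 3 \<sigma>_out[of j] e_in_U by (auto simp: cross_def)
    qed
    moreover have "k = j \<longleftrightarrow> k = \<sigma> j" using kU \<sigma>_out[of j] \<sigma>_in[of j] by (cases "j \<in> U") auto
    moreover have "\<tau> k j = \<sigma> j" using 3 by (simp add: \<tau>_def)
    ultimately show ?thesis
      using 3 untied_step[OF k] untied_step[OF j] untied_\<sigma>[of j] \<sigma>_I[of j]
      unfolding vert_def by metis
  qed
qed

lemma key_row: "V' k j \<Longrightarrow> k \<noteq> e \<Longrightarrow> key a' c' k j = key a c k (\<tau> k j)"
proof -
  assume v: "V' k j" and k: "k \<noteq> e"
  have kI: "k \<in> I" and jI: "j \<in> I" using v by (auto simp: vert_def)
  have v2: "V k (\<tau> k j)" using v V_step by simp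
  show ?thesis
  proof (cases "a k < b e")
    case True
    then have t: "\<tau> k j = j" using k by (simp add: \<tau>_def)
    have je: "j \<noteq> e" using inner_V v2 k True t by auto
    show ?thesis
    proof (cases "j \<in> U")
      case U: True
      have "\<not> a j < a k"
        using v2 t True k U b_inner[OF kI k True] by (auto simp: vert_def cross_def U_iff)
      then show ?thesis using je k t by (simp add: key_def)
    next
      case False
      then show ?thesis using je k t \<sigma>_out[of j] by (simp add: key_def)
    qed
  next
    case False
    then have t: "\<tau> k j = \<sigma> j" by (simp add: \<tau>_def)
    have ak: "b e < a k" using False a_neq_be[OF kI] by auto
    show ?thesis
      using U_c\<sigma>[of j] \<sigma>_out[of j] e_in_U ak k t
      by (cases "j \<in> U") (auto simp: key_def U_iff)
  qed
qed

lemma key_row_e: "j \<in> U \<Longrightarrow> key a c e j = a j"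
  using front[of j] by (auto simp: key_def U_iff)

lemma key_row_e': "j \<in> U \<Longrightarrow> key a' c' e j = (if j = e then b e else c (\<sigma> j))"
  using U_less[of j] by (auto simp: key_def)

lemma key_col: "V' k j \<Longrightarrow> k \<noteq> e \<Longrightarrow> key a' b' j k = key a b (\<tau> k j) k"
proof -
  assume v: "V' k j" and k: "k \<noteq> e"
  have kI: "k \<in> I" and jI: "j \<in> I" using v by (auto simp: vert_def)
  have v2: "V k (\<tau> k j)" using v V_step by simp
  show ?thesis
  proof (cases "a k < b e")
    case True
    then have t: "\<tau> k j = j" using k by (simp add: \<tau>_def)
    have je: "j \<noteq> e" using inner_V v2 k True t by auto
    then show ?thesis using k t by (simp add: key_def)
  next
    case False
    then have t: "\<tau> k j = \<sigma> j" by (simp add: \<tau>_def)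
    have ak: "b e < a k" using False a_neq_be[OF kI] by auto
    show ?thesis
      using U_c\<sigma>[of j] \<sigma>_out[of j] e_in_U ak k t
      by (cases "j \<in> U") (auto simp: key_def U_iff)
  qed
qed

lemma key_col_e: "j \<in> U \<Longrightarrow> key a b j e = (if j = e then a e else b e)"
  using U_less[of j] by (auto simp: key_def)

lemma key_col_e': "j \<in> U \<Longrightarrow> key a' b' j e = b e"
  using U_less[of j] by (auto simp: key_def)

lemma \<tau>_surj: "\<exists>j. \<tau> k j = m"
  using \<sigma>_surj by (auto simp: \<tau>_def)

lemma adj_row:
  assumes k: "k \<noteq> e" and ad: "adj I a' b' c' k j1 j"
  shows "adj I a b c k (\<tau> k j1) (\<tau> k j)"
  unfolding adj_def
proof (intro conjI allI impI)
  show "V k (\<tau> k j1)" "V k (\<tau> k j)" using ad V_step by (auto simp: adj_def)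
  show "key a c k (\<tau> k j1) < key a c k (\<tau> k j)"
    using ad key_row[OF _ k] by (auto simp: adj_def)
  fix m assume m: "V k m"
  obtain m' where m': "\<tau> k m' = m" using \<tau>_surj by blast
  then have "V' k m'" using m V_step by simp
  then show "\<not> (key a c k (\<tau> k j1) < key a c k m \<and> key a c k m < key a c k (\<tau> k j))"
    using ad key_row[OF _ k] m' unfolding adj_def by metis
qed

lemma final_row:
  assumes k: "k \<noteq> e" and ad: "final I a' b' c' k j"
  shows "final I a b c k (\<tau> k j)"
  unfolding final_def
proof (intro conjI allI impI)
  show "V k (\<tau> k j)" using ad V_step by (auto simp: final_def)
  fix m assume m: "V k m"
  obtain m' where m': "\<tau> k m' = m" using \<tau>_surj by blast
  then have "V' k m'" using m V_step by simp
  then show "key a c k m \<le> key a c k (\<tau> k j)"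
    using ad key_row[OF _ k] m' unfolding final_def by metis
qed

text \<open>The new AB arc of \<open>e\<close> is the old one read backwards, from
  \<open>b e\<close> to the front place one period on, so its vertices come in reverse
  order.\<close>

lemma key_e'_less:
  assumes "i \<in> U" "j \<in> U"
  shows "key a' c' e i < key a' c' e j \<longleftrightarrow> a (\<sigma> j) < a (\<sigma> i)"
proof -
  have i: "\<sigma> i \<in> U" and j: "\<sigma> j \<in> U" using assms \<sigma>_in by auto
  have lt: "a (\<sigma> m) < a (\<sigma> e)" if "m \<in> U" "m \<noteq> e" for m
  proof -
    have "\<sigma> m \<noteq> \<sigma> e" using that \<sigma>_eq by simp
    then have "a (\<sigma> m) \<noteq> a (\<sigma> e)" using a_eq \<sigma>_in[OF that(1)] \<sigma>_in[OF e_in_U] U_iff by blast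
    then show ?thesis using \<sigma>_e[OF \<sigma>_in[OF that(1)]] by simp
  qed
  show ?thesis
    using c_less_iff[OF j i] U_c\<sigma>[OF assms(1)] U_c\<sigma>[OF assms(2)] lt[OF assms(1)] lt[OF assms(2)]
    by (auto simp: key_row_e'[OF assms(1)] key_row_e'[OF assms(2)])
qed

lemma adj_row_e:
  assumes ad: "adj I a' b' c' e j1 j"
  shows "j1 \<in> U" "j \<in> U" "adj I a b c e (\<sigma> j) (\<sigma> j1)"
proof -
  show j: "j1 \<in> U" "j \<in> U" using ad by (auto simp: adj_def V'_e)
  show "adj I a b c e (\<sigma> j) (\<sigma> j1)"
    unfolding adj_def V_e \<sigma>_in_iff
  proof (intro conjI allI impI)
    show "j \<in> U" "j1 \<in> U" using j by auto
    show "key a c e (\<sigma> j) < key a c e (\<sigma> j1)"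
      using ad j key_e'_less[OF j] by (simp add: adj_def key_row_e \<sigma>_in)
    fix m assume m: "m \<in> U"
    then obtain m' where m': "\<sigma> m' = m" "m' \<in> U" using \<sigma>_surj_U by (metis imageE)
    have "\<not> (key a' c' e j1 < key a' c' e m' \<and> key a' c' e m' < key a' c' e j)"
      using ad m' unfolding adj_def V'_e by blast
    then show "\<not> (key a c e (\<sigma> j) < key a c e m \<and> key a c e m < key a c e (\<sigma> j1))"
      using key_e'_less[OF j(1) m'(2)] key_e'_less[OF m'(2) j(2)] m' j
      by (auto simp: key_row_e \<sigma>_in)
  qed
qed

text \<open>Read backwards, the arc ends at its former first vertex, where the two arcs of
  \<open>e\<close> part.\<close>

lemma final_row_e:
  assumes "final I a' b' c' e j"
  shows "j \<in> U" "\<sigma> j = e"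
proof -
  show j: "j \<in> U" using assms by (simp add: final_def V'_e)
  obtain m where m: "\<sigma> m = e" "m \<in> U" using \<sigma>_surj_U e_in_U by (metis imageE)
  have "\<not> key a' c' e j < key a' c' e m" using assms m unfolding final_def V'_e by force
  then have "\<not> a e < a (\<sigma> j)" using key_e'_less[OF j m(2)] m by simp
  then show "\<sigma> j = e" using front_less[of "\<sigma> j"] \<sigma>_in[OF j] U_iff by blast
qed

lemma final_e: "final I a b c e (\<sigma> e)"
  using \<sigma>_e \<sigma>_in[OF e_in_U] by (auto simp: final_def V_e key_row_e)

text \<open>Within a column, the vertices left of \<^term>\<open>b e\<close> come first, then the one on the arc of
  \<^term>\<open>e\<close>, then the ones right of \<^term>\<open>b e\<close>.\<close>

lemma col_key:
  assumes "V k j" "k \<noteq> e"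
  shows "a k < b e \<Longrightarrow> key a b j k < b e" "b e < a k \<Longrightarrow> b e < key a b j k"
  using assms b_inner[of k] a_less_b[of k] by (auto simp: key_def vert_def)

lemma col_key':
  assumes "V' k j" "k \<noteq> e"
  shows "key a' b' j k < b e \<longleftrightarrow> a k < b e" "b e < key a' b' j k \<longleftrightarrow> b e < a k"
proof -
  have v: "V k (\<tau> k j)" using assms V_step by simp
  then have "a k \<noteq> b e" using a_neq_be V_I by blast
  then show "key a' b' j k < b e \<longleftrightarrow> a k < b e" "b e < key a' b' j k \<longleftrightarrow> b e < a k"
    using col_key[OF v assms(2)] key_col[OF assms] by force+
qed

text \<open>For \<open>j\<close> in \<open>U\<close> the new column consists of the old column
  \<open>j\<close> left of \<open>b e\<close>, the vertex on the arc of \<open>e\<close>, and the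
  old column \<open>\<sigma> j\<close> right of \<open>b e\<close>. Neighbours in it are therefore
  neighbours in a single old column. Other columns are unchanged.\<close>

lemma adj_col:
  assumes ad: "adj I a' c' b' j k1 k" and k: "k \<noteq> e"
  shows "adj I a c b (\<tau> k j) k1 k" "k1 \<noteq> e \<Longrightarrow> \<tau> k1 j = \<tau> k j"
    "k1 = e \<Longrightarrow> j \<in> U \<and> \<tau> k j = \<sigma> j"
proof -
  have v: "V' k1 j" "V' k j" and lt: "key a' b' j k1 < key a' b' j k"
    and no: "\<And>m. V' m j \<Longrightarrow> \<not> (key a' b' j k1 < key a' b' j m \<and> key a' b' j m < key a' b' j k)"
    using ad by (auto simp: adj_swap)
  have kI: "k \<in> I" using v V_I by blast
  have w: "V k (\<tau> k j)" using v V_step by blast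
  have kk: "key a' b' j k = key a b (\<tau> k j) k" using key_col[OF v(2) k] .
  show e1: "j \<in> U \<and> \<tau> k j = \<sigma> j" if "k1 = e"
  proof -
    have j: "j \<in> U" using that v V'_e by simp
    have "b e < key a' b' j k" using lt key_col_e'[OF j] that by simp
    then have "b e < a k" using col_key'[OF v(2) k] by simp
    then show ?thesis using j by (simp add: \<tau>_def)
  qed
  show e2: "\<tau> k1 j = \<tau> k j" if "k1 \<noteq> e"
  proof (cases "j \<in> U")
    case False
    then show ?thesis using \<sigma>_out by (simp add: \<tau>_def)
  next
    case True
    have "V' e j" using True V'_e by simp
    then have "\<not> (key a' b' j k1 < b e \<and> b e < key a' b' j k)"
      using no key_col_e'[OF True] by force
    then have "\<not> (a k1 < b e \<and> b e < a k)"
      using col_key'[OF v(1) that] col_key'[OF v(2) k] by simp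
    moreover have "\<not> (a k < b e \<and> b e < a k1)"
      using col_key'[OF v(1) that] col_key'[OF v(2) k] lt by force
    moreover have "a k \<noteq> b e" "a k1 \<noteq> b e" using a_neq_be v V_I by blast+
    ultimately have "a k1 < b e \<longleftrightarrow> a k < b e" by force
    then show ?thesis using that k by (simp add: \<tau>_def)
  qed
  have w1: "V k1 (\<tau> k j)"
    using e1 e2 v(1) V_step V_e \<sigma>_in_iff by (cases "k1 = e") auto
  have lt': "key a b (\<tau> k j) k1 < key a b (\<tau> k j) k"
  proof (cases "k1 = e")
    case True
    then have j: "j \<in> U" and t: "\<tau> k j = \<sigma> j" using e1 by auto
    have "key a b (\<sigma> j) e \<le> b e" using key_col_e[OF \<sigma>_in[OF j]] a_less_b[OF e] by auto
    then show ?thesis using lt key_col_e'[OF j] True kk t by simp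
  next
    case False
    then show ?thesis using lt kk key_col[OF v(1) False] e2 by simp
  qed
  have no': "\<not> (key a b (\<tau> k j) k1 < key a b (\<tau> k j) m \<and> key a b (\<tau> k j) m < key a b (\<tau> k j) k)"
    if m: "V m (\<tau> k j)" for m
  proof
    assume h: "key a b (\<tau> k j) k1 < key a b (\<tau> k j) m \<and> key a b (\<tau> k j) m < key a b (\<tau> k j) k"
    show False
    proof (cases "m = e")
      case True
      have tU: "\<tau> k j \<in> U" using m True V_e by simp
      then have j: "j \<in> U" using \<sigma>_in_iff by (auto simp: \<tau>_def split: if_splits)
      have k1: "k1 \<noteq> e" using h True by auto
      have lo: "key a b (\<tau> k j) e = (if \<tau> k j = e then a e else b e)" using key_col_e[OF tU] .
      show False
      proof (cases "\<tau> k j = e")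
        case True
        then have "key a b (\<tau> k j) k1 < a e" using h \<open>m = e\<close> lo by simp
        moreover have "a e < key a b e k1"
          using w1 True front_less[of k1] k1 a_less_b[of k1] by (auto simp: key_def vert_def)
        ultimately show False using True by simp
      next
        case False
        then have "key a b (\<tau> k j) k1 < b e" "b e < key a b (\<tau> k j) k" using h lo \<open>m = e\<close> by auto
        then have "key a' b' j k1 < b e" "b e < key a' b' j k"
          using kk key_col[OF v(1) k1] e2[OF k1] by auto
        then show False using no[of e] V'_e j key_col_e'[OF j] by simp
      qed
    next
      case False
      show False
      proof (cases "\<tau> m j = \<tau> k j")
        case True
        then have vm: "V' m j" using m V_step by simp
        have km: "key a' b' j m = key a b (\<tau> k j) m" using key_col[OF vm False] True by simp
        have "\<not> key a' b' j k1 < key a' b' j m" using no[OF vm] h kk km by simp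
        then show False
        proof (cases "k1 = e")
          case False
          then show False using h km key_col[OF v(1) False] e2 \<open>\<not> key a' b' j k1 < key a' b' j m\<close>
            by simp
        next
          case k1: True
          then have j: "j \<in> U" and t: "\<tau> k j = \<sigma> j" using e1 by auto
          have "\<not> b e < key a' b' j m"
            using \<open>\<not> key a' b' j k1 < key a' b' j m\<close> k1 key_col_e'[OF j] by simp
          then have am: "a m < b e" using col_key'[OF vm False] a_neq_be V_I[of m] vm by force
          then have tj: "\<tau> m j = j" using False by (simp add: \<tau>_def)
          then have sj: "\<sigma> j = j" using True t by simp
          then have "j = e" using \<sigma>_less[OF j] by force
          then show False using inner_V[of m j] m am False t sj by simp
        qed
      next
        \<comment> \<open>Here \<open>m\<close> and \<open>k\<close> lie on opposite sides of
          \<open>b e\<close>.\<close>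
        case ne: False
        then have j: "j \<in> U" using \<sigma>_out[of j] by (auto simp: \<tau>_def split: if_splits)
        have mI: "m \<in> I" using m V_I by blast
        show False
        proof (cases "a k < b e")
          case True
          then have t: "\<tau> k j = j" using k by (simp add: \<tau>_def)
          have "b e < a m" using ne True t False a_neq_be[OF mI] by (auto simp: \<tau>_def split: if_splits)
          then have "b e < key a b (\<tau> k j) m" using col_key[OF m False] by simp
          moreover have "key a b (\<tau> k j) k < b e" using col_key[OF w k] True by simp
          ultimately show False using h by simp
        next
          case ak: False
          then have t: "\<tau> k j = \<sigma> j" by (simp add: \<tau>_def)
          have am: "a m < b e" using ne t False by (auto simp: \<tau>_def split: if_splits)
          then have "key a b (\<tau> k j) m < b e" using col_key[OF m False] by simp
          then have k1: "key a b (\<tau> k j) k1 < b e" using h by simp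
          have tU: "\<tau> k j \<in> U" using t j \<sigma>_in by simp
          have te: "\<tau> k j \<noteq> e" using inner_V[OF m False am] .
          show False
          proof (cases "k1 = e")
            case True
            then show False using k1 key_col_e[OF tU] te by simp
          next
            case False
            then have "key a' b' j k1 < b e" using k1 key_col[OF v(1)] e2 by simp
            then have "a k1 < b e" using col_key'[OF v(1) False] by simp
            then have "\<tau> k1 j = j" using False by (simp add: \<tau>_def)
            then have "\<sigma> j = j" using e2[OF False] t by simp
            then show False using te t \<sigma>_less[OF j] by force
          qed
        qed
      qed
    qed
  qed
  show "adj I a c b (\<tau> k j) k1 k"
    unfolding adj_swap using w w1 lt' no' by blast
qed

text \<open>Up to the arc of \<open>e\<close> the new column is still the old column
  \<open>j\<close>. The new AC arc of \<open>e\<close> itself starts at \<open>b e\<close>, so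
  nothing precedes there.\<close>

lemma adj_col_e:
  assumes ad: "adj I a' c' b' j k1 e"
  shows "j \<in> U" "j \<noteq> e" "k1 \<noteq> e" "a k1 < b e" "adj I a c b j k1 e"
proof -
  have v: "V' k1 j" "V' e j" and lt: "key a' b' j k1 < key a' b' j e"
    and no: "\<And>m. V' m j \<Longrightarrow> \<not> (key a' b' j k1 < key a' b' j m \<and> key a' b' j m < key a' b' j e)"
    using ad by (auto simp: adj_swap)
  show j: "j \<in> U" using v V'_e by simp
  show k1: "k1 \<noteq> e" using lt by auto
  have key_e: "key a' b' j e = b e" using key_col_e'[OF j] .
  show ak1: "a k1 < b e" using lt key_e col_key'[OF v(1) k1] by simp
  then have t: "\<tau> k1 j = j" using k1 by (simp add: \<tau>_def)
  have w: "V k1 j" using v(1) V_step t by simp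
  show je: "j \<noteq> e" using inner_V[OF w k1 ak1] .
  have ke: "key a b j e = b e" using key_col_e[OF j] je by simp
  have kk1: "key a' b' j k1 = key a b j k1" using key_col[OF v(1) k1] t by simp
  show "adj I a c b j k1 e"
    unfolding adj_swap
  proof (intro conjI allI impI)
    show "V k1 j" "V e j" using w V_e j by auto
    show "key a b j k1 < key a b j e" using lt kk1 ke key_e by simp
    fix m assume m: "V m j"
    show "\<not> (key a b j k1 < key a b j m \<and> key a b j m < key a b j e)"
    proof
      assume h: "key a b j k1 < key a b j m \<and> key a b j m < key a b j e"
      then have me: "m \<noteq> e" by auto
      have "a m < b e" using col_key(2)[OF m me] h ke a_neq_be[of m] V_I(1)[OF m] by force
      then have tm: "\<tau> m j = j" using me by (simp add: \<tau>_def)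
      then have vm: "V' m j" using m V_step by simp
      then show False using no[OF vm] key_col[OF vm me] tm h kk1 ke key_e by simp
    qed
  qed
qed

lemma final_col:
  assumes f: "final I a' c' b' j k"
  shows "final I a c b (\<tau> k j) k"
proof -
  have v: "V' k j" and mx: "\<And>m. V' m j \<Longrightarrow> key a' b' j m \<le> key a' b' j k"
    using f by (auto simp: final_swap)
  have w: "V k (\<tau> k j)" using v V_step by simp
  have "key a b (\<tau> k j) m \<le> key a b (\<tau> k j) k" if m: "V m (\<tau> k j)" for m
  proof (cases "k = e")
    case True
    then have j: "j \<in> U" and t: "\<tau> k j = \<sigma> j" using v V'_e by (auto simp: \<tau>_def)
    show ?thesis
    proof (cases "m = e")
      case False
      show ?thesis
      proof (cases "a m < b e")
        case am: True
        then show ?thesis using inner_V[OF m False am] col_key(1)[OF m False] t True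
            key_col_e[OF \<sigma>_in[OF j]] by simp
      next
        case am: False
        then have "b e < a m" using a_neq_be[OF V_I(1)[OF m]] by simp
        have tm: "\<tau> m j = \<tau> k j" using am t by (simp add: \<tau>_def)
        then have vm: "V' m j" using m V_step by simp
        have "key a' b' j m \<le> b e" using mx[OF vm] True key_col_e'[OF j] by simp
        then show ?thesis using col_key'(2)[OF vm False] \<open>b e < a m\<close> by simp
      qed
    qed (simp add: True)
  next
    case k: False
    have ek: "b e < a k" if "j \<in> U"
    proof -
      have "b e \<le> key a' b' j k" using mx[of e] V'_e that key_col_e'[OF that] by simp
      then show ?thesis using col_key'(1)[OF v k] a_neq_be[OF V_I(3)[OF v]] by simp
    qed
    show ?thesis
    proof (cases "m = e")
      case True
      then have tU: "\<tau> k j \<in> U" using m V_e by simp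
      then have j: "j \<in> U" using \<sigma>_in_iff by (auto simp: \<tau>_def split: if_splits)
      show ?thesis using col_key(2)[OF w k ek[OF j]] key_col_e[OF tU] a_less_b[OF e] True
        by (simp split: if_splits)
    next
      case False
      show ?thesis
      proof (cases "\<tau> m j = \<tau> k j")
        case True
        then have vm: "V' m j" using m V_step by simp
        then show ?thesis using mx[OF vm] key_col[OF vm False] key_col[OF v k] True by simp
      next
        case ne: False
        then have j: "j \<in> U" using \<sigma>_out[of j] by (auto simp: \<tau>_def split: if_splits)
        have "a m < b e" using ne ek[OF j] by (auto simp: \<tau>_def split: if_splits)
        then show ?thesis using col_key(1)[OF m False] col_key(2)[OF w k ek[OF j]] by simp
      qed
    qed
  qed
  then show ?thesis using w by (simp add: final_swap)
qed

lemma adj_e_\<sigma>: "j \<in> U \<Longrightarrow> j \<noteq> e \<Longrightarrow> adj I a b c e (\<sigma> j) j"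
  using \<sigma>_less[of j] \<sigma>_max[of j] \<sigma>_in[of j]
  by (force simp: adj_def V_e key_row_e)

text \<open>The vertex \<open>(j, j)\<close> comes before the arc of \<open>e\<close> in column
  \<open>j\<close>; so the hypothesis of \<open>link_pos\<close> about \<open>k1\<close> can be met
  along the whole path.\<close>

lemma adj_col_ex:
  assumes j: "j \<in> U" "j \<noteq> e"
  shows "\<exists>k1. adj I a c b j k1 e"
proof -
  let ?S = "{k \<in> I. V k j \<and> key a b j k < key a b j e}"
  have "V j j" using U_untied[OF j(1)] j by (auto simp: vert_def U_iff)
  moreover have "key a b j j < key a b j e" using key_col_e[OF j(1)] j by (auto simp: key_def U_iff)
  ultimately have ne: "?S \<noteq> {}" using V_I by blast
  have fin: "finite ?S" using fin by simp
  define k1 where "k1 = arg_min_on (\<lambda>k. - key a b j k) ?S"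
  have "k1 \<in> ?S" unfolding k1_def by (rule arg_min_if_finite(1)[OF fin ne])
  moreover have "key a b j m \<le> key a b j k1" if "m \<in> ?S" for m
    using arg_min_least[OF fin ne that, of "\<lambda>k. - key a b j k"] unfolding k1_def by simp
  ultimately show ?thesis
    unfolding adj_swap using V_e j V_I(1) by (intro exI[of _ k1]) force
qed

end

section \<open>The records after a trip\<close>

locale labelled_step = arc_step + labelled +
  assumes lab_front: "lab (a e + N) = a e" and sgn_front: "sg (a e)"
begin

abbreviation "kr' \<equiv> kr(a e + N := kr (a e), b e := a e)"
text \<open>Along the path A and B change places: the former B edge is the A edge now, and the
  former A edge, now coloured B, has just been entered by the trip from \<open>a e\<close>.\<close>

abbreviation "hA' \<equiv> (\<lambda>k j. if k = e then hB k (\<sigma> j) else hA k (\<tau> k j))"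
abbreviation "hB' \<equiv> (\<lambda>k j. if k = e then a e else hB k (\<tau> k j))"
abbreviation "hC' \<equiv> (\<lambda>k j. hC k (\<tau> k j))"

lemma U_sign: "j \<in> U \<Longrightarrow> b e < c j"
  by (simp add: U_iff)

text \<open>On the path each \<open>link_pos\<close> passes the record on unchanged from the vertex
  \<open>(e, \<sigma> j)\<close> to its successor \<open>(e, j)\<close>. So the previous trip from
  the same boundary place entered every vertex that the coming trip is about to enter.\<close>

lemma chain: "j \<in> U \<Longrightarrow> hA e j = lab (a e)"
proof (induction "nat (a j - a e)" arbitrary: j rule: less_induct)
  case less
  show ?case
  proof (cases "j = e")
    case True
    then show ?thesis using lab_a e be_less_ce by auto
  next
    case False
    obtain k1 where k1: "adj I a c b j k1 e" using adj_col_ex[OF less.prems False] by blast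
    have cr: "cross a b c e j"
    proof -
      have "V e j" using V_e less.prems by simp
      then show ?thesis using False by (simp add: vert_def)
    qed
    have "hA e (\<sigma> j) = hA e j"
      using link_pos[OF cr adj_e_\<sigma>[OF less.prems False] k1 U_sign[OF less.prems]]
        U_sign[OF \<sigma>_in[OF less.prems]] by simp
    moreover have "hA e (\<sigma> j) = lab (a e)"
    proof (rule less.hyps)
      show "\<sigma> j \<in> U" using \<sigma>_in less.prems by simp
      show "nat (a (\<sigma> j) - a e) < nat (a j - a e)"
        using \<sigma>_less[OF less.prems False] front_less[of j] less.prems False U_iff by auto
    qed
    ultimately show ?thesis by simp
  qed
qed

text \<open>The last vertex of the path hands the constant record of \<open>chain\<close> to the
  boundary: the place about to be hit was last hit by the previous trip from the place of
  \<open>a e\<close>.\<close>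

lemma kr_b_front: "kr (b e) = lab (a e)"
  using kr_b[OF final_e] U_sign[OF \<sigma>_in[OF e_in_U]] chain[OF \<sigma>_in[OF e_in_U]] by simp

text \<open>By \<open>sgn_a\<close>, a record at a vertex with \<open>b e < c e\<close> belongs to a
  trip that hit a C, the letter not hit now.\<close>

lemma sgn_lab_front: "0 \<le> lab (a e) \<Longrightarrow> \<not> sg (lab (a e))"
  using sgn_a[of e e] chain[OF e_in_U] V_e e_in_U be_less_ce by auto

lemma sign_row: "V' k j \<Longrightarrow> k \<noteq> e \<Longrightarrow> b' k < c' j \<longleftrightarrow> b k < c (\<tau> k j)"
proof -
  assume v: "V' k j" and k: "k \<noteq> e"
  have kI: "k \<in> I" using v V_I by blast
  show ?thesis
  proof (cases "a k < b e \<and> j \<in> U")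
    case True
    then have "b k < b e" using b_inner kI k by blast
    then show ?thesis using True k U_c\<sigma>[of j] by (auto simp: \<tau>_def U_iff)
  next
    case False
    then show ?thesis using k \<sigma>_out[of j] by (auto simp: \<tau>_def)
  qed
qed

text \<open>All vertices on the path had \<open>b e < c j\<close>. The new end lies beyond every C
  end, so their orientation is reversed.\<close>

lemma sign_e': "j \<in> I \<Longrightarrow> \<not> b' e < c' j"
  using ce_less(1)[of "\<sigma> j"] \<sigma>_I by auto

lemma out_row: "V' k j \<Longrightarrow> k \<noteq> e \<Longrightarrow>
    (if b' k < c' j then hA' k j else hC' k j) = (if b k < c (\<tau> k j) then hA k (\<tau> k j) else hC k (\<tau> k j))"
  using sign_row by simp

text \<open>The path uses no C edge, so the last trip to leave by such an edge stays the same. On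
  the path both the orientation and the record have changed, and the two changes cancel.\<close>

lemma out_col: "V' k j \<Longrightarrow>
    (if b' k < c' j then hB' k j else hA' k j) = (if b k < c (\<tau> k j) then hB k (\<tau> k j) else hA k (\<tau> k j))"
proof -
  assume v: "V' k j"
  show ?thesis
  proof (cases "k = e")
    case True
    then have "j \<in> U" using v V'_e by simp
    then show ?thesis using True sign_e'[of j] U_sign[OF \<sigma>_in[of j]] U_iff by (auto simp: \<tau>_def)
  next
    case False
    then show ?thesis using sign_row[OF v] by simp
  qed
qed

lemma \<tau>_diag: "k \<in> I \<Longrightarrow> k \<noteq> e \<Longrightarrow> \<tau> k k = k"
  using \<sigma>_out[of k] by (auto simp: \<tau>_def U_iff)

lemma labelled_step: "labelled I N a' b' c' lab sg kr' hA' hB' hC'"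
proof -
  interpret S: arc_system I N a' b' c' by (rule step)
  have xN: "a i \<noteq> a e + N" "b i \<noteq> a e + N" "c i \<noteq> a e + N" if "i \<in> I" for i
    using ce_less that a_less_b[OF that] by force+
  show ?thesis
  proof
    fix k assume k: "k \<in> I" "b' k \<noteq> c' k"
    then have nt: "b k \<noteq> c k" using untied_step by simp
    show "hA' k k = lab (a' k)"
      using lab_a[OF k(1) nt] \<tau>_diag[OF k(1)] lab_b[OF final_e] by auto
    show "(if b' k < c' k then hC' k k else hB' k k) = kr' (a' k)"
    proof (cases "k = e")
      case True
      then show ?thesis using sign_e'[OF e] by simp
    next
      case False
      have v: "V' k k" using k by (simp add: vert_def)
      show ?thesis using False sign_row[OF v False] \<tau>_diag[OF k(1) False] kr_a[OF k(1) nt] xN(1)[OF k(1)]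
          a_neq_be[OF k(1)] by (auto split: if_splits)
    qed
  next
    fix k j assume f: "final I a' b' c' k j"
    have v: "V' k j" using f by (simp add: final_def)
    have kI: "k \<in> I" using V_I v by blast
    show "hB' k j = lab (b' k)"
    proof (cases "k = e")
      case True
      then show ?thesis using lab_front by simp
    next
      case False
      then show ?thesis using lab_b[OF final_row[OF False f]] by simp
    qed
    show "(if b' k < c' j then hA' k j else hC' k j) = kr' (b' k)"
    proof (cases "k = e")
      case True
      have j: "j \<in> U" "\<sigma> j = e" using final_row_e f True by auto
      have "hC e e = kr (a e)" using kr_a[OF e] be_less_ce by simp
      then show ?thesis using True j sign_e'[of j] U_iff ce_less(2)[OF e] by (auto simp: \<tau>_def)
    next
      case False
      have "b k \<noteq> b e" using b_eq[OF kI e] False by blast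
      then show ?thesis
        using False out_row[OF v False] kr_b[OF final_row[OF False f]] xN(2)[OF kI] by simp
    qed
  next
    fix k j assume f: "final I a' c' b' j k"
    have v: "V' k j" using f by (simp add: final_swap)
    \<comment> \<open>A last vertex never lies left of \<open>b e\<close> in a column of
      \<open>U\<close>, since the vertex on the arc of \<open>e\<close> would follow. So its old
      column is the one owning the end \<open>c' j\<close>.\<close>
    have t: "c' j = c (\<tau> k j)"
    proof (cases "k \<noteq> e \<and> a k < b e")
      case True
      have "j \<notin> U"
      proof
        assume j: "j \<in> U"
        then have "key a' b' j e \<le> key a' b' j k" using f V'_e by (simp add: final_swap)
        then show False using key_col_e'[OF j] col_key'(1)[OF v] True by simp
      qed
      then show ?thesis using True \<sigma>_out by (simp add: \<tau>_def)
    qed (auto simp: \<tau>_def)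
    have tI: "\<tau> k j \<in> I" using V_step V_I v by blast
    show "hC' k j = lab (c' j)" using lab_c[OF final_col[OF f]] t by simp
    show "(if b' k < c' j then hB' k j else hA' k j) = kr' (c' j)"
    proof -
      have "kr' (c' j) = kr (c (\<tau> k j))" using t xN(3)[OF tI] c_neq_be[OF tI] by simp
      then show ?thesis using trans[OF out_col[OF v] kr_c[OF final_col[OF f]]] by (rule ssubst)
    qed
  next
    fix k j assume v: "V' k j"
    then have w: "V k (\<tau> k j)" using V_step by simp
    have jI: "j \<in> I" using V_I v by blast
    show "0 \<le> hA' k j \<Longrightarrow> sg (hA' k j) = (c' j < b' k)"
    proof (cases "k = e")
      case True
      assume "0 \<le> hA' k j"
      then show ?thesis using True sgn_b w sign_e'[OF jI] S.b_eq_c[OF e jI] xN(3)[of "\<sigma> j"] \<sigma>_I jI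
        by (auto simp: \<tau>_def)
    next
      case False
      have "b k \<noteq> c (\<tau> k j)" using vert_neq[OF w] .
      moreover have "b' k \<noteq> c' j" using S.b_eq_c[OF _ jI, of k] v by (auto simp: vert_def)
      moreover assume "0 \<le> hA' k j"
      ultimately show ?thesis using sgn_a[OF w] False sign_row[OF v False] by auto
    qed
    show "0 \<le> hB' k j \<Longrightarrow> sg (hB' k j)" using sgn_b[OF w] sgn_front by auto
    show "0 \<le> hC' k j \<Longrightarrow> \<not> sg (hC' k j)" using sgn_c[OF w] by auto
  next
    fix k j j1 k1
    assume cr: "cross a' b' c' k j" and ar: "adj I a' b' c' k j1 j" and ac: "adj I a' c' b' j k1 k"
    have v: "V' k j" and v1: "V' k j1" and v2: "V' k1 j"
      using ar ac by (auto simp: adj_def vert_swap)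
    have w: "V k (\<tau> k j)" using v V_step by simp
    have jI: "j \<in> I" and j1I: "j1 \<in> I" using V_I v v1 by blast+
    have main: "(b' k < c' j \<longrightarrow> (if b' k < c' j1 then hA' k j1 else hC' k j1) = hA' k j \<and>
        (if b' k1 < c' j then hB' k1 j else hA' k1 j) = hB' k j1 \<and> hC' k j = hC' k1 j) \<and>
      (c' j < b' k \<longrightarrow> (if b' k1 < c' j then hB' k1 j else hA' k1 j) = hA' k j \<and>
        (if b' k < c' j1 then hA' k j1 else hC' k j1) = hC' k1 j \<and> hB' k j = hB' k j1)"
    proof (cases "k = e")
      case False
      have cr': "cross a b c k (\<tau> k j)"
      proof -
        have "k \<noteq> j" using cr by (auto simp: cross_def)
        moreover have "\<tau> k j = k \<Longrightarrow> k = j"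
          using \<tau>_diag[of k] False V_I[of k j] v \<sigma>_eq[of j k] by (auto simp: \<tau>_def split: if_splits)
        ultimately show ?thesis using w by (auto simp: vert_def)
      qed
      have t1: "\<tau> k1 j = \<tau> k j"
        using adj_col(2,3)[OF ac False] by (cases "k1 = e") (auto simp: \<tau>_def)
      have ar': "adj I a b c k (\<tau> k j1) (\<tau> k j)" using adj_row[OF False ar] .
      have ac': "adj I a c b (\<tau> k j) k1 k" using adj_col(1)[OF ac False] .
      have ne: "b k \<noteq> c (\<tau> k j)" using vert_neq w by blast
      have "b' k \<noteq> c' j" using S.b_eq_c[of k j] V_I[of k j] v cr by (auto simp: cross_def)
      then have sg: "b' k < c' j \<longleftrightarrow> b k < c (\<tau> k j)" "c' j < b' k \<longleftrightarrow> c (\<tau> k j) < b k"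
        using sign_row[OF v False] ne by linarith+
      have hs: "hA' k j = hA k (\<tau> k j)" "hB' k j = hB k (\<tau> k j)" "hB' k j1 = hB k (\<tau> k j1)"
        "hC' k1 j = hC k1 (\<tau> k j)"
        using False t1 by simp_all
      show ?thesis
        unfolding out_col[OF v2] unfolding out_row[OF v1 False] hs sg t1
        using link_pos[OF cr' ar' ac'] link_neg[OF cr' ar' ac'] by blast
    next
      case True
      note U = adj_row_e[OF ar[unfolded True]]
      note C = adj_col_e[OF ac[unfolded True]]
      have se: "\<not> b' e < c' j" "\<not> b' e < c' j1" using sign_e' jI j1I by auto
      have "V e j" using V_e U(2) by simp
      then have cr': "cross a b c e j" using C(2) by (simp add: vert_def)
      have ar': "adj I a b c e (\<sigma> j) j" using adj_e_\<sigma>[OF U(2) C(2)] .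
      \<comment> \<open>On the old arc both \<open>\<sigma> j1\<close> and \<open>j\<close> are the
        successor of \<open>\<sigma> j\<close>.\<close>
      have "a (\<sigma> j1) = a j"
        using U(3) ar' U(1,2) \<sigma>_in[OF U(1)] by (force simp: adj_def V_e key_row_e)
      then have j1: "\<sigma> j1 = j" using a_eq[of "\<sigma> j1" j] \<sigma>_I[of j1] j1I jI by simp
      have t1: "\<tau> k1 j = j" using C(3,4) by (simp add: \<tau>_def)
      \<comment> \<open>The merging vertex between the two is the same as before, with its
        orientation reversed: the old \<open>link_pos\<close> yields the new
        \<open>link_neg\<close>.\<close>
      have lk: "(if b k1 < c j then hB k1 j else hA k1 j) = hB e (\<sigma> j)" "hC e j = hC k1 j"
        using link_pos[OF cr' ar' C(5) U_sign[OF U(2)]] by auto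
      have hs: "hA' e j = hB e (\<sigma> j)" "hB' e j = hB' e j1" "hC' k1 j = hC k1 j" "hC' e j1 = hC e j"
        using t1 j1 by (simp_all add: \<tau>_def)
      show ?thesis
        unfolding True out_col[OF v2] unfolding t1 using lk se hs by simp
    qed
    show "b' k < c' j \<Longrightarrow> (if b' k < c' j1 then hA' k j1 else hC' k j1) = hA' k j \<and>
        (if b' k1 < c' j then hB' k1 j else hA' k1 j) = hB' k j1 \<and> hC' k j = hC' k1 j"
      using main by blast
    show "c' j < b' k \<Longrightarrow> (if b' k1 < c' j then hB' k1 j else hA' k1 j) = hA' k j \<and>
        (if b' k < c' j1 then hA' k j1 else hC' k j1) = hC' k1 j \<and> hB' k j = hB' k j1"
      using main by blast
  qed
qed

end

section \<open>Running the trips\<close>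

type_synonym arcs = "(nat \<Rightarrow> int) \<times> (nat \<Rightarrow> int) \<times> (nat \<Rightarrow> int)"

definition trip :: "nat set \<Rightarrow> int \<Rightarrow> arcs \<Rightarrow> arcs" where
  "trip I N = (\<lambda>(a, b, c).
     let e = arg_min_on a I in
     if b e < c e then (a(e := b e), b(e := a e + N), c \<circ> rot I a c e (b e))
     else if c e < b e then (a(e := c e), b \<circ> rot I a b e (c e), c(e := a e + N))
     else (a(e := b e), b(e := a e + N), c(e := a e + N)))"

section \<open>Trips that end at a tie\<close>

locale tie_step = arc_system +
  fixes e :: nat
  assumes e: "e \<in> I" and front: "i \<in> I \<Longrightarrow> a e \<le> a i" and tie: "b e = c e"
begin

abbreviation "ta \<equiv> a(e := b e)"
abbreviation "tb \<equiv> b(e := a e + N)"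
abbreviation "tc \<equiv> c(e := a e + N)"

lemma front_less: "i \<in> I \<Longrightarrow> i \<noteq> e \<Longrightarrow> a e < a i"
  using front[of i] a_eq[of e i] e by force

lemma step: "arc_system I N ta tb tc"
proof
  show "finite I" by (rule fin)
next
  fix i assume i: "i \<in> I"
  show "ta i < tb i" "ta i < tc i"
    using i e a_less_b a_less_c window_b window_c tie by auto
next
  show "inj_on ta I"
  proof (rule inj_onI)
    fix i j assume "i \<in> I" "j \<in> I" "ta i = ta j"
    then show "i = j" using a_neq_b[of i e] a_neq_b[of j e] a_eq[of i j] e
      by (auto split: if_splits)
  qed
  show "inj_on tb I"
  proof (rule inj_onI)
    fix i j assume "i \<in> I" "j \<in> I" "tb i = tb j"
    then show "i = j" using window_b[of i e] window_b[of j e] b_eq[of i j] e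
      by (auto split: if_splits)
  qed
  show "inj_on tc I"
  proof (rule inj_onI)
    fix i j assume "i \<in> I" "j \<in> I" "tc i = tc j"
    then show "i = j" using window_c[of i e] window_c[of j e] c_eq[of i j] e
      by (auto split: if_splits)
  qed
next
  fix i j assume i: "i \<in> I" and j: "j \<in> I"
  have y: "b e < a e + N" using window_b e by auto
  have ai: "a i < a e + N" using a_less_b[OF i] window_b[OF i e] by simp
  show "ta i \<noteq> tb j"
    using a_neq_b[OF i j] b_eq[OF e j] y ai by (cases "i = e"; cases "j = e"; force)
  show "ta i \<noteq> tc j"
    using a_neq_c[OF i j] c_eq[OF e j] y ai tie by (cases "i = e"; cases "j = e"; force)
  show "i = j" if "tb i = tc j"
    using that b_eq_c[OF i j] window_b[OF i e] window_c[OF j e] by (auto split: if_splits)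
  show "tb i < ta j + N" "tc i < ta j + N"
    using window_b[OF i e] window_c[OF i e] front_less[OF j] a_less_b[OF e]
    by (cases "i = e"; cases "j = e"; simp)+
  show "tb j < tb i" if h: "ta i < ta j" "ta j < tb i"
  proof (cases "i = e \<or> j = e")
    case True
    then show ?thesis
      using h nested_b[OF e i] front_less[OF i] window_b[OF j e] by (auto split: if_splits)
  qed (use h nested_b[OF i j] in auto)
  show "tc j < tc i" if h: "ta i < ta j" "ta j < tc i"
  proof (cases "i = e \<or> j = e")
    case True
    then show ?thesis
      using h nested_c[OF e i] front_less[OF i] window_c[OF j e] tie by (auto split: if_splits)
  qed (use h nested_c[OF i j] in auto)
qed

text \<open>A tied token carries no vertex and stays tied, both of its ends moving to
  \<open>a e + N\<close>; the graph does not notice the trip.\<close>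

lemma vert_tie: "vert I ta tb tc k j \<longleftrightarrow> vert I a b c k j"
  using tie by (cases "k = e"; cases "j = e") (auto simp: vert_def cross_def)

lemma vert_tie_neq: "vert I a b c k j \<Longrightarrow> k \<noteq> e \<and> j \<noteq> e"
  using tie by (auto simp: vert_def)

lemma key_tie: "vert I a b c k j \<Longrightarrow> key ta tc k j = key a c k j"
  "vert I a b c k j \<Longrightarrow> key ta tb j k = key a b j k"
  using vert_tie_neq[of k j] by (auto simp: key_def)

lemma adj_tie: "adj I ta tb tc k j1 j \<longleftrightarrow> adj I a b c k j1 j"
  "adj I ta tc tb j k1 k \<longleftrightarrow> adj I a c b j k1 k"
  unfolding adj_def adj_swap vert_tie
  by (simp_all add: vert_swap vert_tie key_tie cong: conj_cong imp_cong del: fun_upd_apply)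

lemma final_tie: "final I ta tb tc k j \<longleftrightarrow> final I a b c k j"
  "final I ta tc tb j k \<longleftrightarrow> final I a c b j k"
  unfolding final_def vert_tie
  by (simp_all add: vert_swap vert_tie key_tie cong: conj_cong imp_cong del: fun_upd_apply)

end

lemma labelled_tie:
  assumes "tie_step I N a b c e" "labelled I N a b c lab sg kr hA hB hC"
  shows "labelled I N (a(e := b e)) (b(e := a e + N)) (c(e := a e + N)) lab sg kr hA hB hC"
proof -
  interpret tie_step I N a b c e by fact
  interpret L: labelled I N a b c lab sg kr hA hB hC by fact
  interpret S: arc_system I N ta tb tc by (rule step)
  have neq: "k \<noteq> e" "j \<noteq> e" if "vert I a b c k j" for k j
    using vert_tie_neq[OF that] by simp_all
  have cr: "cross a b c k j" if "cross ta tb tc k j" "vert I a b c k j" for k j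
    using that neq[OF that(2)] by (simp add: cross_def)
  show ?thesis
  proof
    fix k assume k: "k \<in> I" "tb k \<noteq> tc k"
    then have "k \<noteq> e" by auto
    then show "hA k k = lab (ta k)" "(if tb k < tc k then hC k k else hB k k) = kr (ta k)"
      using L.lab_a[of k] L.kr_a[of k] k by auto
  next
    fix k j assume "final I ta tb tc k j"
    then have f: "final I a b c k j" by (simp only: final_tie)
    have "vert I a b c k j" using f by (simp add: final_def)
    note n = neq[OF this]
    show "hB k j = lab (tb k)" "(if tb k < tc j then hA k j else hC k j) = kr (tb k)"
      using L.lab_b[OF f] L.kr_b[OF f] n by simp_all
  next
    fix k j assume "final I ta tc tb j k"
    then have f: "final I a c b j k" by (simp only: final_tie)
    have "vert I a b c k j" using f by (simp add: final_swap)
    note n = neq[OF this]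
    show "hC k j = lab (tc j)" "(if tb k < tc j then hB k j else hA k j) = kr (tc j)"
      using L.lab_c[OF f] L.kr_c[OF f] n by simp_all
  next
    fix k j assume "vert I ta tb tc k j"
    then have v: "vert I a b c k j" by (simp only: vert_tie)
    show "0 \<le> hA k j \<Longrightarrow> sg (hA k j) = (tc j < tb k)"
      using L.sgn_a[OF v] neq[OF v] by simp
    show "0 \<le> hB k j \<Longrightarrow> sg (hB k j)" "0 \<le> hC k j \<Longrightarrow> \<not> sg (hC k j)"
      using L.sgn_b[OF v] L.sgn_c[OF v] by auto
  next
    fix k j j1 k1
    assume h: "cross ta tb tc k j" "adj I ta tb tc k j1 j" "adj I ta tc tb j k1 k"
    have r: "adj I a b c k j1 j" and c: "adj I a c b j k1 k"
      using h(2,3) by (simp_all only: adj_tie)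
    have v: "vert I a b c k j" "vert I a b c k j1" "vert I a b c k1 j"
      using r c by (simp_all add: adj_def vert_swap)
    note n = neq[OF v(1)] neq[OF v(2)] neq[OF v(3)]
    note cr' = cr[OF h(1) v(1)]
    show "tb k < tc j \<Longrightarrow> (if tb k < tc j1 then hA k j1 else hC k j1) = hA k j \<and>
        (if tb k1 < tc j then hB k1 j else hA k1 j) = hB k j1 \<and> hC k j = hC k1 j"
      using L.link_pos[OF cr' r c] n by simp
    show "tc j < tb k \<Longrightarrow> (if tb k1 < tc j then hB k1 j else hA k1 j) = hA k j \<and>
        (if tb k < tc j1 then hA k j1 else hC k j1) = hC k1 j \<and> hB k j = hB k j1"
      using L.link_neg[OF cr' r c] n by simp
  qed
qed

section \<open>Iterated trips and occupied positions\<close>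

locale arc_run =
  fixes I :: "nat set" and N :: int and a\<^sub>0 b\<^sub>0 c\<^sub>0 :: "nat \<Rightarrow> int"
  assumes init: "arc_system I N a\<^sub>0 b\<^sub>0 c\<^sub>0" and nonempty: "I \<noteq> {}"
    and init_a: "i \<in> I \<Longrightarrow> 0 \<le> a\<^sub>0 i"
    and init_b: "i \<in> I \<Longrightarrow> b\<^sub>0 i < N" and init_c: "i \<in> I \<Longrightarrow> c\<^sub>0 i < N"
begin

definition st :: "nat \<Rightarrow> arcs" where "st n = (trip I N ^^ n) (a\<^sub>0, b\<^sub>0, c\<^sub>0)"
definition A where "A n = fst (st n)"
definition B where "B n = fst (snd (st n))"
definition C where "C n = snd (snd (st n))"
definition ft :: "nat \<Rightarrow> nat" where "ft n = arg_min_on (A n) I"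
definition src :: "nat \<Rightarrow> int" where "src n = A n (ft n)"
definition tgt :: "nat \<Rightarrow> int" where "tgt n = min (B n (ft n)) (C n (ft n))"
definition hitB :: "nat \<Rightarrow> bool" where "hitB n \<longleftrightarrow> B n (ft n) \<le> C n (ft n)"
definition hitC :: "nat \<Rightarrow> bool" where "hitC n \<longleftrightarrow> C n (ft n) \<le> B n (ft n)"

lemma st_eq: "st n = (A n, B n, C n)"
  by (simp add: A_def B_def C_def)

lemma zero: "A 0 = a\<^sub>0" "B 0 = b\<^sub>0" "C 0 = c\<^sub>0"
  by (simp_all add: A_def B_def C_def st_def)

lemma Suc_B:
  assumes "\<not> hitC n"
  shows "A (Suc n) = (A n)(ft n := B n (ft n))" "B (Suc n) = (B n)(ft n := src n + N)"
    "C (Suc n) = C n \<circ> rot I (A n) (C n) (ft n) (B n (ft n))"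
proof -
  have "st (Suc n) = trip I N (A n, B n, C n)" by (simp add: st_def flip: st_eq)
  then show "A (Suc n) = (A n)(ft n := B n (ft n))" "B (Suc n) = (B n)(ft n := src n + N)"
    "C (Suc n) = C n \<circ> rot I (A n) (C n) (ft n) (B n (ft n))"
    using assms unfolding st_eq[of "Suc n"]
    by (simp_all add: trip_def Let_def hitC_def ft_def src_def)
qed

lemma Suc_C:
  assumes "\<not> hitB n"
  shows "A (Suc n) = (A n)(ft n := C n (ft n))" "C (Suc n) = (C n)(ft n := src n + N)"
    "B (Suc n) = B n \<circ> rot I (A n) (B n) (ft n) (C n (ft n))"
proof -
  have "st (Suc n) = trip I N (A n, B n, C n)" by (simp add: st_def flip: st_eq)
  then show "A (Suc n) = (A n)(ft n := C n (ft n))" "C (Suc n) = (C n)(ft n := src n + N)"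
    "B (Suc n) = B n \<circ> rot I (A n) (B n) (ft n) (C n (ft n))"
    using assms unfolding st_eq[of "Suc n"]
    by (simp_all add: trip_def Let_def hitB_def ft_def src_def)
qed

lemma Suc_tie:
  assumes "hitB n" "hitC n"
  shows "A (Suc n) = (A n)(ft n := B n (ft n))" "B (Suc n) = (B n)(ft n := src n + N)"
    "C (Suc n) = (C n)(ft n := src n + N)"
proof -
  have "st (Suc n) = trip I N (A n, B n, C n)" by (simp add: st_def flip: st_eq)
  then show "A (Suc n) = (A n)(ft n := B n (ft n))" "B (Suc n) = (B n)(ft n := src n + N)"
    "C (Suc n) = (C n)(ft n := src n + N)"
    using assms unfolding st_eq[of "Suc n"]
    by (simp_all add: trip_def Let_def hitB_def hitC_def ft_def src_def)
qed

lemma hit_or: "hitB n \<or> hitC n"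
  by (auto simp: hitB_def hitC_def)

lemma fin_I: "finite I"
  using init by (rule arc_system.fin)

lemma ft: "ft n \<in> I" "i \<in> I \<Longrightarrow> A n (ft n) \<le> A n i"
  unfolding ft_def using arg_min_if_finite(1)[OF fin_I nonempty] arg_min_least[OF fin_I nonempty]
  by blast+

lemma step_B: "arc_system I N (A n) (B n) (C n) \<Longrightarrow> \<not> hitC n \<Longrightarrow> arc_step I N (A n) (B n) (C n) (ft n)"
  by (simp add: arc_step_def arc_step_axioms_def ft hitC_def)

lemma step_C: "arc_system I N (A n) (B n) (C n) \<Longrightarrow> \<not> hitB n \<Longrightarrow> arc_step I N (A n) (C n) (B n) (ft n)"
  by (simp add: arc_step_def arc_step_axioms_def ft hitB_def arc_system.swap)

lemma step_tie: "arc_system I N (A n) (B n) (C n) \<Longrightarrow> hitB n \<Longrightarrow> hitC n \<Longrightarrow>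
    tie_step I N (A n) (B n) (C n) (ft n)"
  by (simp add: tie_step_def tie_step_axioms_def ft hitB_def hitC_def)

lemma sys: "arc_system I N (A n) (B n) (C n)"
proof (induction n)
  case 0
  then show ?case using init by (simp add: zero)
next
  case (Suc n)
  consider "\<not> hitC n" | "\<not> hitB n" | "hitB n" "hitC n" by blast
  then show ?case
  proof cases
    case 1
    interpret arc_step I N "A n" "B n" "C n" "ft n" using step_B Suc 1 .
    show ?thesis unfolding Suc_B[OF 1] src_def by (rule step)
  next
    case 2
    interpret arc_step I N "A n" "C n" "B n" "ft n" using step_C Suc 2 .
    show ?thesis unfolding Suc_C[OF 2] src_def by (rule arc_system.swap[OF step])
  next
    case 3
    interpret tie_step I N "A n" "B n" "C n" "ft n" using step_tie Suc 3 .
    show ?thesis unfolding Suc_tie[OF 3] src_def by (rule step)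
  qed
qed

definition PA where "PA n = A n ` I"
definition PB where "PB n = B n ` I"
definition PC where "PC n = C n ` I"
definition P where "P n = PA n \<union> PB n \<union> PC n"

lemma fun_upd_image: "inj_on f I \<Longrightarrow> e \<in> I \<Longrightarrow> (f(e := v)) ` I = insert v (f ` I - {f e})"
  by (auto simp: inj_on_def)

lemma PA_Suc: "PA (Suc n) = insert (tgt n) (PA n - {src n})"
  and PB_Suc: "PB (Suc n) = (if hitB n then insert (src n + N) (PB n - {tgt n}) else PB n)"
  and PC_Suc: "PC (Suc n) = (if hitC n then insert (src n + N) (PC n - {tgt n}) else PC n)"
proof -
  note upd = fun_upd_image[OF arc_system.inj_a[OF sys] ft(1)] fun_upd_image[OF arc_system.inj_b[OF sys] ft(1)]
    fun_upd_image[OF arc_system.inj_c[OF sys] ft(1)]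
  consider "\<not> hitC n" | "\<not> hitB n" | "hitB n" "hitC n" by blast
  then have "PA (Suc n) = insert (tgt n) (PA n - {src n}) \<and>
    PB (Suc n) = (if hitB n then insert (src n + N) (PB n - {tgt n}) else PB n) \<and>
    PC (Suc n) = (if hitC n then insert (src n + N) (PC n - {tgt n}) else PC n)"
  proof cases
    case 1
    interpret arc_step I N "A n" "B n" "C n" "ft n" using step_B sys 1 .
    have "hitB n" using 1 hit_or by blast
    moreover have "tgt n = B n (ft n)" using 1 by (simp add: tgt_def hitC_def)
    moreover have "(C n \<circ> \<sigma>) ` I = C n ` I"
      unfolding image_comp[symmetric] bij_betw_imp_surj_on[OF bij_\<sigma>] ..
    ultimately show ?thesis
      using 1 unfolding PA_def PB_def PC_def Suc_B[OF 1] upd by (simp only: src_def if_True if_False simp_thms)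
  next
    case 2
    interpret arc_step I N "A n" "C n" "B n" "ft n" using step_C sys 2 .
    have "hitC n" using 2 hit_or by blast
    moreover have "tgt n = C n (ft n)" using 2 by (simp add: tgt_def hitB_def)
    moreover have "(B n \<circ> \<sigma>) ` I = B n ` I"
      unfolding image_comp[symmetric] bij_betw_imp_surj_on[OF bij_\<sigma>] ..
    ultimately show ?thesis
      using 2 unfolding PA_def PB_def PC_def Suc_C[OF 2] upd by (simp only: src_def if_True if_False simp_thms)
  next
    case 3
    then have "tgt n = B n (ft n)" "tgt n = C n (ft n)" by (simp_all add: tgt_def hitB_def hitC_def)
    then show ?thesis
      using 3 unfolding PA_def PB_def PC_def Suc_tie[OF 3] upd by (simp only: src_def if_True simp_thms)
  qed
  then show "PA (Suc n) = insert (tgt n) (PA n - {src n})"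
    "PB (Suc n) = (if hitB n then insert (src n + N) (PB n - {tgt n}) else PB n)"
    "PC (Suc n) = (if hitC n then insert (src n + N) (PC n - {tgt n}) else PC n)"
    by blast+
qed

lemma src_less: "src n < tgt n" "tgt n < src n + N"
  using arc_system.a_less_b[OF sys[of n] ft(1)[of n]] arc_system.a_less_c[OF sys[of n] ft(1)[of n]]
    arc_system.window_b[OF sys[of n] ft(1)[of n] ft(1)[of n]]
  by (auto simp: src_def tgt_def)

lemma src_le: "p \<in> P n \<Longrightarrow> src n \<le> p"
proof -
  have "src n \<le> A n i" "src n \<le> B n i" "src n \<le> C n i" if "i \<in> I" for i
    using arc_system.a_less_b[OF sys that, of n] arc_system.a_less_c[OF sys that, of n] ft(2)[OF that, of n]
    by (auto simp: src_def)
  then show "p \<in> P n \<Longrightarrow> src n \<le> p"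
    by (auto simp: P_def PA_def PB_def PC_def)
qed

lemma src_PA: "src n \<in> PA n"
  using ft by (simp add: src_def PA_def)

lemma disj: "PA n \<inter> PB n = {}" "PA n \<inter> PC n = {}"
  unfolding PA_def PB_def PC_def using arc_system.a_neq_b[OF sys, of _ _ n]
    arc_system.a_neq_c[OF sys, of _ _ n] by blast+

lemma src_notin: "src n \<notin> PB n" "src n \<notin> PC n"
  using src_PA disj by blast+

lemma tgt_mem: "hitB n \<Longrightarrow> tgt n \<in> PB n" "hitC n \<Longrightarrow> tgt n \<in> PC n" "\<not> hitB n \<Longrightarrow> tgt n \<notin> PB n"
  "\<not> hitC n \<Longrightarrow> tgt n \<notin> PC n"
proof -
  show "hitB n \<Longrightarrow> tgt n \<in> PB n" "hitC n \<Longrightarrow> tgt n \<in> PC n"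
    using ft(1)[of n] by (auto simp: tgt_def hitB_def hitC_def PB_def PC_def min_def)
  show "tgt n \<notin> PB n" if h: "\<not> hitB n"
  proof
    assume "tgt n \<in> PB n"
    then obtain i where i: "i \<in> I" "B n i = C n (ft n)" using h by (auto simp: tgt_def hitB_def PB_def)
    then have "i = ft n" using arc_system.b_eq_c[OF sys i(1) ft(1)] by blast
    then show False using i h by (simp add: hitB_def)
  qed
  show "tgt n \<notin> PC n" if h: "\<not> hitC n"
  proof
    assume "tgt n \<in> PC n"
    then obtain i where i: "i \<in> I" "B n (ft n) = C n i" using h by (auto simp: tgt_def hitC_def PC_def)
    then have "ft n = i" using arc_system.b_eq_c[OF sys ft(1) i(1)] by blast
    then show False using i h by (simp add: hitC_def)
  qed
qed

text \<open>The target was occupied before, so a trip only changes letters, apart from the front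
  place being renamed one period on.\<close>

lemma P_Suc: "P (Suc n) = insert (src n + N) (P n - {src n})"
proof -
  have "tgt n \<in> P n - {src n}"
    using tgt_mem[of n] hit_or[of n] src_less[of n] by (auto simp: P_def)
  moreover have "P (Suc n) = insert (src n + N) (insert (tgt n) (P n - {src n}))"
    using hit_or[of n] src_notin[of n] tgt_mem(3,4)[of n] by (auto simp: P_def PA_Suc PB_Suc PC_Suc)
  ultimately show ?thesis by (simp add: insert_absorb)
qed

lemma N_pos: "0 < N"
  using src_less[of 0] by simp

lemma src_mono_Suc: "src n < src (Suc n)"
proof -
  have "src (Suc n) \<in> P (Suc n)" using src_PA by (simp add: P_def)
  then show ?thesis using src_le[of "src (Suc n)" n] N_pos by (auto simp: P_Suc)
qed

lemma src_mono: "strict_mono src"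
  using src_mono_Suc by (simp add: strict_mono_Suc_iff)

lemma src_eq: "src m = src n \<longleftrightarrow> m = n" and src_less_iff: "src m < src n \<longleftrightarrow> m < n"
  and src_le_iff: "src m \<le> src n \<longleftrightarrow> m \<le> n"
  using src_mono by (simp_all add: strict_mono_eq strict_mono_less strict_mono_less_eq)

lemma src_ge: "int n \<le> src n"
proof (induction n)
  case 0
  then show ?case using init_a ft(1)[of 0] by (simp add: src_def zero)
next
  case (Suc n)
  then show ?case using src_mono_Suc[of n] by simp
qed

lemma src_nonneg: "0 \<le> src n"
  using src_ge[of n] by simp

lemma P_persist: "p \<in> P m \<Longrightarrow> m \<le> n \<Longrightarrow> src n \<le> p \<Longrightarrow> p \<in> P n"
proof (induction n)
  case (Suc n)
  show ?case
  proof (cases "m = Suc n")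
    case False
    then have "p \<in> P n" using Suc src_mono_Suc[of n] by force
    moreover have "src n \<noteq> p" using Suc.prems src_mono_Suc[of n] by force
    ultimately show ?thesis by (simp add: P_Suc)
  qed (use Suc in simp)
qed simp

text \<open>An occupied place stays occupied until it is passed, and the starts, strictly increasing
  integers, cannot skip it because the front is the least occupied place.\<close>

lemma P_passes:
  assumes "p \<in> P m"
  obtains n where "m \<le> n" "src n = p"
proof -
  have ex: "\<exists>n. p \<le> src n \<and> m \<le> n"
    using src_ge[of "nat p + m"] by (intro exI[of _ "nat p + m"]) (auto split: if_splits)
  define n where "n = (LEAST n. p \<le> src n \<and> m \<le> n)"
  have n: "p \<le> src n" "m \<le> n" using LeastI_ex[OF ex] by (auto simp: n_def)
  show thesis
  proof (cases "src n = p")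
    case False
    then have lt: "p < src n" using n by simp
    then have "m \<noteq> n" using src_le[OF assms] by auto
    then obtain k where k: "n = Suc k" "m \<le> k" using n(2) by (cases n) auto
    have "src k < p" using not_less_Least[of k "\<lambda>n. p \<le> src n \<and> m \<le> n"] k n_def by auto
    then have "p \<in> P n" using P_persist[OF assms k(2)] k by (simp add: P_Suc)
    then show ?thesis using src_le[of p n] lt by simp
  qed (use n that in blast)
qed

text \<open>The front position always carries an A, so a letter other than A is hit before it gets there.\<close>

lemma hit_iff:
  assumes Suc_Q: "\<And>n. Q (Suc n) = (if h n then insert (src n + N) (Q n - {tgt n}) else Q n)"
    and Q_P: "\<And>n. Q n \<subseteq> P n" and Q_src: "\<And>n. src n \<notin> Q n" and Q_tgt: "\<And>n. h n \<Longrightarrow> tgt n \<in> Q n"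
    and less: "p < src m + N"
  shows "p \<in> Q m \<longleftrightarrow> (\<exists>n\<ge>m. src n < p \<and> tgt n = p \<and> h n)"
proof
  assume p: "p \<in> Q m"
  obtain n0 where n0: "m \<le> n0" "src n0 = p" using P_passes[of p m] p Q_P by blast
  have "\<exists>n\<ge>m. n < n0 \<and> p \<in> Q n \<and> p \<notin> Q (Suc n)"
  proof (rule ccontr)
    assume "\<not> ?thesis"
    then have no: "m \<le> k \<Longrightarrow> k < n0 \<Longrightarrow> p \<in> Q k \<Longrightarrow> p \<in> Q (Suc k)" for k by blast
    have "m \<le> k \<Longrightarrow> k \<le> n0 \<Longrightarrow> p \<in> Q k" for k
    proof (induction k)
      case (Suc k)
      show ?case
      proof (cases "m = Suc k")
        case False
        then have "m \<le> k" "k < n0" using Suc.prems by auto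
        then show ?thesis using no Suc.IH by simp
      qed (use p in simp)
    qed (use p in simp)
    then have "p \<in> Q n0" using n0 by simp
    then show False using Q_src n0 by blast
  qed
  then obtain n where n: "m \<le> n" "n < n0" "p \<in> Q n" "p \<notin> Q (Suc n)" by blast
  then have "h n" "tgt n = p" by (auto simp: Suc_Q split: if_splits)
  then show "\<exists>n\<ge>m. src n < p \<and> tgt n = p \<and> h n" using n src_less[of n] by blast
next
  assume "\<exists>n\<ge>m. src n < p \<and> tgt n = p \<and> h n"
  then obtain n where n: "m \<le> n" "tgt n = p" "h n" by blast
  have "p \<in> Q (m + k) \<Longrightarrow> p \<in> Q m" for k
  proof (induction k)
    case (Suc k)
    \<comment> \<open>Trips after \<open>m\<close> deposit letters at \<open>src m + N\<close> or
      beyond, so the letter at \<open>p\<close> was there already.\<close>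
    have "p \<noteq> src (m + k) + N" using less src_le_iff[of m "m + k"] by simp
    then show ?case using Suc by (auto simp: Suc_Q split: if_splits)
  qed simp
  then show "p \<in> Q m" using n Q_tgt[of n] le_Suc_ex[OF n(1)] by blast
qed

lemma PB_iff: "p < src m + N \<Longrightarrow> p \<in> PB m \<longleftrightarrow> (\<exists>n\<ge>m. src n < p \<and> tgt n = p \<and> hitB n)"
  by (rule hit_iff) (auto simp: PB_Suc P_def src_notin tgt_mem)

lemma PC_iff: "p < src m + N \<Longrightarrow> p \<in> PC m \<longleftrightarrow> (\<exists>n\<ge>m. src n < p \<and> tgt n = p \<and> hitC n)"
  by (rule hit_iff) (auto simp: PC_Suc P_def src_notin tgt_mem)

end

text \<open>An A was last hit where it stands; a B or C was last hit as an A one period earlier,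
  before it passed through the front. The history \<open>H\<close> is a parameter because it grows
  during the run.\<close>

definition hist_inv ::
  "nat set \<Rightarrow> int \<Rightarrow> (int \<Rightarrow> int \<Rightarrow> bool) \<Rightarrow> (nat \<Rightarrow> int) \<Rightarrow> (nat \<Rightarrow> int) \<Rightarrow> (nat \<Rightarrow> int) \<Rightarrow>
    (int \<Rightarrow> int) \<Rightarrow> bool" where
  "hist_inv I N H a b c kr \<longleftrightarrow> (\<forall>i\<in>I. b i \<noteq> c i \<longrightarrow>
     (0 \<le> kr (a i) \<longrightarrow> H (kr (a i)) (a i)) \<and>
     (0 \<le> kr (b i) \<longrightarrow> H (kr (b i)) (b i - N)) \<and>
     (0 \<le> kr (c i) \<longrightarrow> H (kr (c i)) (c i - N)))"

lemma hist_inv_swap: "hist_inv I N H a b c kr \<Longrightarrow> hist_inv I N H a c b kr"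
  unfolding hist_inv_def by metis

context arc_step
begin

lemma hist_inv_step:
  assumes h: "hist_inv I N H a b c kr" and mono: "\<And>v p. H v p \<Longrightarrow> H' v p" and new: "H' (a e) (b e)"
  shows "hist_inv I N H' a' b' c' (kr(a e + N := kr (a e), b e := a e))"
  unfolding hist_inv_def
proof (intro ballI impI)
  fix i assume i: "i \<in> I" "b' i \<noteq> c' i"
  have nt: "b i \<noteq> c i" using i untied_step by blast
  have \<sigma>i: "\<sigma> i \<in> I" using i \<sigma>_I by blast
  have nt\<sigma>: "b (\<sigma> i) \<noteq> c (\<sigma> i)" using nt untied_\<sigma> by simp
  have y: "b e < a e + N" using ce_less e by blast
  have h1: "0 \<le> kr (a j) \<longrightarrow> H' (kr (a j)) (a j)" "0 \<le> kr (b j) \<longrightarrow> H' (kr (b j)) (b j - N)"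
    "0 \<le> kr (c j) \<longrightarrow> H' (kr (c j)) (c j - N)" if "j \<in> I" "b j \<noteq> c j" for j
    using h that mono unfolding hist_inv_def by blast+
  let ?kr = "kr(a e + N := kr (a e), b e := a e)"
  have "0 \<le> ?kr (a' i) \<longrightarrow> H' (?kr (a' i)) (a' i)"
    using new h1(1)[OF i(1) nt] a_neq_be[OF i(1)] ce_less(2)[OF i(1)] a_less_b[OF i(1)] by auto
  moreover have "0 \<le> ?kr (b' i) \<longrightarrow> H' (?kr (b' i)) (b' i - N)"
  proof (cases "i = e")
    case True
    have "b e \<noteq> c e" using be_less_ce by simp
    then show ?thesis using True y h1(1)[OF e] by simp
  next
    case False
    have "b i \<noteq> b e" using b_eq[OF i(1) e] False by blast
    then show ?thesis using False h1(2)[OF i(1) nt] ce_less(2)[OF i(1)] by simp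
  qed
  moreover have "0 \<le> ?kr (c' i) \<longrightarrow> H' (?kr (c' i)) (c' i - N)"
    using h1(3)[OF \<sigma>i nt\<sigma>] ce_less(1)[OF \<sigma>i] c_neq_be[OF \<sigma>i] by simp
  ultimately show "(0 \<le> ?kr (a' i) \<longrightarrow> H' (?kr (a' i)) (a' i)) \<and>
     (0 \<le> ?kr (b' i) \<longrightarrow> H' (?kr (b' i)) (b' i - N)) \<and>
     (0 \<le> ?kr (c' i) \<longrightarrow> H' (?kr (c' i)) (c' i - N))" by blast
qed

lemma tied_step: "i \<in> I \<Longrightarrow> b' i = c' i \<Longrightarrow> b i = c i \<and> a' i = a i \<and> b' i = b i"
proof -
  assume i: "i \<in> I" "b' i = c' i"
  then have t: "b i = c i" using untied_step by blast
  moreover have "i \<noteq> e" using t be_less_ce by auto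
  ultimately show ?thesis by simp
qed

end

section \<open>Periodicity of the trips\<close>

context arc_run
begin

text \<open>The previous trip from the place of \<open>p\<close> started at \<open>p - N\<close>.
  Starts are nonnegative, so \<open>-1\<close> can stand for none.\<close>

definition lab where "lab p = max (p - N) (- 1)"
definition sgB where "sgB v \<longleftrightarrow> (\<exists>m. src m = v \<and> \<not> hitC m)"
definition hist where "hist n v p \<longleftrightarrow> (\<exists>m<n. \<not> (hitB m \<and> hitC m) \<and> src m = v \<and> tgt m = p)"

lemma sgB_src: "sgB (src n) \<longleftrightarrow> \<not> hitC n"
  by (auto simp: sgB_def src_eq)

lemma labelled_stepI:
  "\<not> hitC n \<Longrightarrow> labelled I N (A n) (B n) (C n) lab sgB kr hA hB hC \<Longrightarrow>
    labelled_step I N (A n) (B n) (C n) (ft n) lab sgB kr hA hB hC"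
  using step_B[OF sys] sgB_src[of n] src_nonneg[of n]
  by (simp add: labelled_step_def labelled_step_axioms_def lab_def src_def)

lemma labelled_stepI':
  "\<not> hitB n \<Longrightarrow> labelled I N (A n) (B n) (C n) lab sgB kr hA hB hC \<Longrightarrow>
    labelled_step I N (A n) (C n) (B n) (ft n) lab (\<lambda>v. \<not> sgB v) kr
      (\<lambda>j k. hA k j) (\<lambda>j k. hC k j) (\<lambda>j k. hB k j)"
  using step_C[OF sys] sgB_src[of n] src_nonneg[of n] hit_or[of n]
    labelled.labelled_swap[of I N "A n" "B n" "C n" lab sgB kr hA hB hC]
  by (simp add: labelled_step_def labelled_step_axioms_def lab_def src_def)

lemma hist_mono: "hist n v p \<Longrightarrow> hist (Suc n) v p"
  by (auto simp: hist_def intro: less_SucI)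

lemma labelled_ex:
  "\<exists>kr hA hB hC. labelled I N (A n) (B n) (C n) lab sgB kr hA hB hC \<and>
     hist_inv I N (hist n) (A n) (B n) (C n) kr"
proof (induction n)
  case 0
  \<comment> \<open>All initial positions lie below \<open>N\<close>, so every record may start as
    \<open>-1\<close>.\<close>
  have l: "lab (a\<^sub>0 i) = - 1" "lab (b\<^sub>0 i) = - 1" "lab (c\<^sub>0 i) = - 1" if "i \<in> I" for i
    using init_b[OF that] init_c[OF that] arc_system.a_less_b[OF init that] by (simp_all add: lab_def)
  have "labelled I N a\<^sub>0 b\<^sub>0 c\<^sub>0 lab sgB (\<lambda>_. - 1) (\<lambda>_ _. - 1) (\<lambda>_ _. - 1) (\<lambda>_ _. - 1)"
    using init by (auto simp: labelled_def labelled_axioms_def l final_def vert_def)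
  moreover have "hist_inv I N (hist 0) a\<^sub>0 b\<^sub>0 c\<^sub>0 (\<lambda>_. - 1)" by (simp add: hist_inv_def)
  ultimately show ?case unfolding zero by blast
next
  case (Suc n)
  then obtain kr hA hB hC where L: "labelled I N (A n) (B n) (C n) lab sgB kr hA hB hC"
    and H: "hist_inv I N (hist n) (A n) (B n) (C n) kr" by blast
  have new: "\<not> (hitB n \<and> hitC n) \<Longrightarrow> hist (Suc n) (src n) (tgt n)"
    by (auto simp: hist_def)
  consider "\<not> hitC n" | "\<not> hitB n" | "hitB n" "hitC n" by blast
  then show ?case
  proof cases
    case 1
    interpret labelled_step I N "A n" "B n" "C n" "ft n" lab sgB kr hA hB hC
      using labelled_stepI[OF 1 L] .
    have t: "tgt n = B n (ft n)" using 1 by (simp add: tgt_def hitC_def)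
    have "hist_inv I N (hist (Suc n)) a' b' c' kr'"
      using hist_inv_step[OF H hist_mono] new 1 t by (simp add: src_def)
    then show ?thesis using labelled_step unfolding Suc_B[OF 1] src_def by blast
  next
    case 2
    interpret labelled_step I N "A n" "C n" "B n" "ft n" lab "\<lambda>v. \<not> sgB v" kr
      "\<lambda>j k. hA k j" "\<lambda>j k. hC k j" "\<lambda>j k. hB k j"
      using labelled_stepI'[OF 2 L] .
    have t: "tgt n = C n (ft n)" using 2 by (simp add: tgt_def hitB_def)
    have "hist_inv I N (hist (Suc n)) a' b' c' kr'"
      using hist_inv_step[OF hist_inv_swap[OF H] hist_mono] new 2 t by (simp add: src_def)
    then have "hist_inv I N (hist (Suc n)) a' c' b' kr'" by (rule hist_inv_swap)
    then show ?thesis using labelled.labelled_swap[OF labelled_step] unfolding Suc_C[OF 2] src_def not_not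
      by blast
  next
    case 3
    have ts: "tie_step I N (A n) (B n) (C n) (ft n)" using step_tie[OF sys 3] .
    have "hist_inv I N (hist (Suc n)) (A (Suc n)) (B (Suc n)) (C (Suc n)) kr"
      using H hist_mono unfolding hist_inv_def Suc_tie[OF 3] by (auto simp: fun_upd_apply)
    then show ?thesis using labelled_tie[OF ts L] unfolding Suc_tie[OF 3] src_def by blast
  qed
qed

definition tied where "tied v p \<longleftrightarrow> (\<exists>m. hitB m \<and> hitC m \<and> src m = v \<and> tgt m = p)"

text \<open>A tied token shuttles between two places modulo \<open>N\<close>: its last trip ended at
  its present A and started one period before its present end; the trip before ran the other
  way.\<close>

lemma tied_inv:
  "i \<in> I \<Longrightarrow> B n i = C n i \<Longrightarrow>
    (N \<le> B n i \<longrightarrow> tied (B n i - N) (A n i)) \<and> (N \<le> A n i \<longrightarrow> tied (A n i - N) (B n i - N))"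
proof (induction n arbitrary: i)
  case 0
  then show ?case using init_b[of i] arc_system.a_less_b[OF init, of i] by (simp add: zero)
next
  case (Suc n)
  consider "\<not> hitC n" | "\<not> hitB n" | "hitB n" "hitC n" by blast
  then show ?case
  proof cases
    case 1
    interpret arc_step I N "A n" "B n" "C n" "ft n" using step_B sys 1 .
    show ?thesis
      using tied_step[OF Suc.prems(1)] Suc.prems(2) Suc.IH[OF Suc.prems(1)]
      unfolding Suc_B[OF 1] src_def by simp
  next
    case 2
    interpret arc_step I N "A n" "C n" "B n" "ft n" using step_C sys 2 .
    show ?thesis
      using tied_step[OF Suc.prems(1)] Suc.prems(2) Suc.IH[OF Suc.prems(1)]
      unfolding Suc_C[OF 2] src_def by simp
  next
    case 3
    show ?thesis
    proof (cases "i = ft n")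
      case True
      have eq: "B n i = C n i" "tgt n = B n i" using 3 True by (simp_all add: hitB_def hitC_def tgt_def)
      have "tied (src n) (tgt n)" using 3 by (auto simp: tied_def)
      then show ?thesis
        using Suc.IH[OF Suc.prems(1) eq(1)] True eq by (simp add: Suc_tie[OF 3] src_def)
    next
      case False
      then show ?thesis using Suc.IH[OF Suc.prems(1)] Suc.prems(2) by (simp add: Suc_tie[OF 3])
    qed
  qed
qed

text \<open>\<open>kr_b_front\<close> names the start of the last trip that hit the target place,
  and the history turns this into an actual trip one period back. By \<open>sgn_lab_front\<close> it
  hit the opposite letter. Ties are covered by \<open>tied_inv\<close>.\<close>

lemma period:
  assumes "N \<le> src n"
  shows "\<exists>m. src m = src n - N \<and> tgt m = tgt n - N \<and> hitB m = hitC n \<and> hitC m = hitB n"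
proof -
  obtain kr hA hB hC where L: "labelled I N (A n) (B n) (C n) lab sgB kr hA hB hC"
    and H: "hist_inv I N (hist n) (A n) (B n) (C n) kr" using labelled_ex by blast
  have lab: "lab (src n) = src n - N" "0 \<le> lab (src n)" using assms by (simp_all add: lab_def)
  consider "\<not> hitC n" | "\<not> hitB n" | "hitB n" "hitC n" by blast
  then show ?thesis
  proof cases
    case 1
    interpret labelled_step I N "A n" "B n" "C n" "ft n" lab sgB kr hA hB hC
      using labelled_stepI[OF 1 L] .
    have t: "tgt n = B n (ft n)" using 1 by (simp add: tgt_def hitC_def)
    have kr: "kr (tgt n) = src n - N" using kr_b_front lab unfolding t src_def by simp
    have "hist n (src n - N) (tgt n - N)"
      using H ft(1)[of n] kr assms be_less_ce unfolding hist_inv_def t by force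
    then obtain m where m: "\<not> (hitB m \<and> hitC m)" "src m = src n - N" "tgt m = tgt n - N"
      unfolding hist_def by blast
    have "\<not> sgB (src m)" using sgn_lab_front lab m(2) by (simp flip: src_def)
    then have "hitC m" using sgB_src by blast
    then show ?thesis using m 1 hit_or by blast
  next
    case 2
    interpret labelled_step I N "A n" "C n" "B n" "ft n" lab "\<lambda>v. \<not> sgB v" kr
      "\<lambda>j k. hA k j" "\<lambda>j k. hC k j" "\<lambda>j k. hB k j"
      using labelled_stepI'[OF 2 L] .
    have t: "tgt n = C n (ft n)" using 2 by (simp add: tgt_def hitB_def)
    have kr: "kr (tgt n) = src n - N" using kr_b_front lab unfolding t src_def by simp
    have "hist n (src n - N) (tgt n - N)"
      using H ft(1)[of n] kr assms be_less_ce unfolding hist_inv_def t by force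
    then obtain m where m: "\<not> (hitB m \<and> hitC m)" "src m = src n - N" "tgt m = tgt n - N"
      unfolding hist_def by blast
    have "sgB (src m)" using sgn_lab_front lab m(2) by (simp flip: src_def)
    then have "\<not> hitC m" using sgB_src by blast
    then show ?thesis using m 2 hit_or by blast
  next
    case 3
    then have t: "B n (ft n) = C n (ft n)" "tgt n = B n (ft n)"
      by (simp_all add: hitB_def hitC_def tgt_def)
    have "tied (src n - N) (tgt n - N)"
      using tied_inv[OF ft(1) t(1)] assms t(2) by (simp add: src_def)
    then show ?thesis using 3 by (auto simp: tied_def)
  qed
qed

text \<open>The place left by trip \<open>m\<close> has to come to the front again;
  \<open>period\<close> applied to the trip starting then leads back to \<open>m\<close>.\<close>

lemma period_shift:
  obtains n where "m < n" "src n = src m + N" "tgt n = tgt m + N" "hitB n = hitC m" "hitC n = hitB m"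
proof -
  have "src m + N \<in> P (Suc m)" by (simp add: P_Suc)
  then obtain n where n: "Suc m \<le> n" "src n = src m + N" by (rule P_passes)
  have "N \<le> src n" using n(2) src_nonneg[of m] by simp
  then obtain k where k: "src k = src n - N" "tgt k = tgt n - N" "hitB k = hitC n" "hitC k = hitB n"
    using period by blast
  have "k = m" using k(1) n(2) src_eq[of k m] by simp
  then show thesis using that[of n] n k by auto
qed

section \<open>The letters after a full turn\<close>

lemma P_sub: "P k \<subseteq> P 0 \<union> {src m + N |m. m < k}"
proof (induction k)
  case (Suc k)
  then show ?case by (fastforce simp: P_Suc less_Suc_eq)
qed simp

lemma P0_less: "p \<in> P 0 \<Longrightarrow> p < N"
  using init_b init_c arc_system.a_less_b[OF init]
  by (auto simp: P_def PA_def PB_def PC_def zero intro: less_trans)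

context
  fixes n :: nat
  assumes turn: "N \<le> src n" "\<And>k. k < n \<Longrightarrow> src k < N"
begin

lemma P_turn: "P n = (\<lambda>p. p + N) ` P 0"
proof (intro equalityI subsetI)
  fix p assume p: "p \<in> P n"
  then have "\<not> p \<in> P 0" using src_le[OF p] turn(1) P0_less by force
  then obtain m where m: "m < n" "p = src m + N" using P_sub p by blast
  have "src m \<in> P m" using src_PA by (simp add: P_def)
  moreover have "src m \<noteq> src k + N" for k using turn(2)[OF m(1)] src_nonneg[of k] by simp
  ultimately have "src m \<in> P 0" using P_sub[of m] by blast
  then show "p \<in> (\<lambda>p. p + N) ` P 0" using m by blast
next
  fix q assume "q \<in> (\<lambda>p. p + N) ` P 0"
  then obtain p where p: "p \<in> P 0" "q = p + N" by blast
  obtain m where m: "src m = p" using P_passes[OF p(1)] by blast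
  have mn: "m < n" using P0_less[OF p(1)] turn(1) m src_less_iff[of m n] by simp
  have mem: "src m + N \<in> P (Suc m)" by (simp add: P_Suc)
  obtain k where k: "src k = src m + N" using P_passes[OF mem] by blast
  have "\<not> k < n" using turn(2)[of k] k src_nonneg[of m] by auto
  then have "src n \<le> src m + N" using src_le_iff[of n k] k by simp
  then show "q \<in> P n" using P_persist[OF mem] mn m p by simp
qed

text \<open>By \<open>PB_iff\<close> and \<open>PC_iff\<close> a letter is determined by the later
  trip that hits it, and these trips recur one period on with B and C exchanged.\<close>

lemma hits_turn:
  assumes "p \<in> P 0"
  shows "p + N \<in> PB n \<longleftrightarrow> p \<in> PC 0" "p + N \<in> PC n \<longleftrightarrow> p \<in> PB 0"
proof -
  have pN: "p < N" "p < src 0 + N" "p + N < src n + N"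
    using P0_less[OF assms] src_nonneg[of 0] turn(1) by auto
  have *: "(\<exists>k\<ge>n. src k < p + N \<and> tgt k = p + N \<and> h k) \<longleftrightarrow> (\<exists>m\<ge>0. src m < p \<and> tgt m = p \<and> h' m)"
    if hh: "\<And>k m. src m = src k - N \<Longrightarrow> tgt m = tgt k - N \<Longrightarrow> hitB m = hitC k \<Longrightarrow>
        hitC m = hitB k \<Longrightarrow> h k = h' m" for h h'
  proof
    assume "\<exists>k\<ge>n. src k < p + N \<and> tgt k = p + N \<and> h k"
    then obtain k where k: "n \<le> k" "src k < p + N" "tgt k = p + N" "h k" by blast
    then have "N \<le> src k" using turn(1) src_le_iff[of n k] by simp
    then obtain m where m: "src m = src k - N" "tgt m = tgt k - N" "hitB m = hitC k" "hitC m = hitB k"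
      using period by blast
    have "h' m" using hh[OF m] k(4) by simp
    then show "\<exists>m\<ge>0. src m < p \<and> tgt m = p \<and> h' m" using m k by (intro exI[of _ m]) simp
  next
    assume "\<exists>m\<ge>0. src m < p \<and> tgt m = p \<and> h' m"
    then obtain m where m: "src m < p" "tgt m = p" "h' m" by blast
    obtain k where k: "src k = src m + N" "tgt k = tgt m + N" "hitB k = hitC m" "hitC k = hitB m"
      using period_shift[of m] by metis
    have "\<not> k < n" using turn(2)[of k] k(1) src_nonneg[of m] by auto
    moreover have "h k" using hh[of m k] k m(3) by simp
    ultimately show "\<exists>k\<ge>n. src k < p + N \<and> tgt k = p + N \<and> h k"
      using k m by (intro exI[of _ k]) simp
  qed
  show "p + N \<in> PB n \<longleftrightarrow> p \<in> PC 0"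
    unfolding PB_iff[OF pN(3)] PC_iff[OF pN(2)] by (rule *) simp
  show "p + N \<in> PC n \<longleftrightarrow> p \<in> PB 0"
    unfolding PC_iff[OF pN(3)] PB_iff[OF pN(2)] by (rule *) simp
qed

lemma full_turn:
  "PA n = (\<lambda>p. p + N) ` PA 0" "PB n = (\<lambda>p. p + N) ` PC 0" "PC n = (\<lambda>p. p + N) ` PB 0"
proof -
  have sub: "PA k \<subseteq> P k" "PB k \<subseteq> P k" "PC k \<subseteq> P k" for k by (auto simp: P_def)
  show B: "PB n = (\<lambda>p. p + N) ` PC 0"
  proof (intro equalityI subsetI)
    fix q assume q: "q \<in> PB n"
    then obtain p where p: "p \<in> P 0" "q = p + N" using sub P_turn by blast
    then show "q \<in> (\<lambda>p. p + N) ` PC 0" using hits_turn(1)[OF p(1)] q by blast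
  next
    fix q assume "q \<in> (\<lambda>p. p + N) ` PC 0"
    then obtain p where "p \<in> PC 0" "q = p + N" by blast
    then show "q \<in> PB n" using hits_turn(1)[of p] sub(3) by blast
  qed
  show C: "PC n = (\<lambda>p. p + N) ` PB 0"
  proof (intro equalityI subsetI)
    fix q assume q: "q \<in> PC n"
    then obtain p where p: "p \<in> P 0" "q = p + N" using sub P_turn by blast
    then show "q \<in> (\<lambda>p. p + N) ` PB 0" using hits_turn(2)[OF p(1)] q by blast
  next
    fix q assume "q \<in> (\<lambda>p. p + N) ` PB 0"
    then obtain p where "p \<in> PB 0" "q = p + N" by blast
    then show "q \<in> PC n" using hits_turn(2)[of p] sub(2) by blast
  qed
  have PA: "PA k = P k - (PB k \<union> PC k)" for k
    using disj by (auto simp: P_def)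
  have inj: "inj (\<lambda>p. p + N)" by (simp add: inj_def)
  show "PA n = (\<lambda>p. p + N) ` PA 0"
    unfolding PA P_turn B C image_set_diff[OF inj] image_Un by blast
qed

end

end

section \<open>Clusters of positions with a common label\<close>

text \<open>\<open>cl p\<close> is the label of position \<open>p\<close>. By \<open>bc_nested\<close> and \<open>cl_back\<close> arcs ending in the same cluster do
  not cross, so a trip reaches both of its candidates in the same cluster only at a tie.\<close>

locale clustered = arc_system +
  fixes cl :: "int \<Rightarrow> int" and q :: int
  assumes cl_mono: "p \<le> p' \<Longrightarrow> cl p \<le> cl p'" and cl_shift: "cl (p + N) = cl p + q"
    and b_before_a: "\<lbrakk>i \<in> I; j \<in> I; cl (b i) = cl (a j)\<rbrakk> \<Longrightarrow> b i < a j"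
    and c_before_a: "\<lbrakk>i \<in> I; j \<in> I; cl (c i) = cl (a j)\<rbrakk> \<Longrightarrow> c i < a j"
    and bc_nested: "\<lbrakk>i \<in> I; j \<in> I; b i \<noteq> c i; b j \<noteq> c j; cl (b i) = cl (c j)\<rbrakk> \<Longrightarrow>
      i \<noteq> j \<and> (b i < c j \<longleftrightarrow> a j < a i)"
    and cl_window_b: "i \<in> I \<Longrightarrow> cl (b i) < cl (a i) + q"
    and cl_window_c: "i \<in> I \<Longrightarrow> cl (c i) < cl (a i) + q"
    \<comment> \<open>In a run such an end was left by an earlier trip from the cluster of
      \<open>a k\<close>, and \<open>a j\<close> is where that trip arrived. Later trips from the
      same cluster stop before it.\<close>
    and cl_back: "\<lbrakk>k \<in> I; j \<in> I; cl (b j) = cl (a k) + q \<or> cl (c j) = cl (a k) + q\<rbrakk> \<Longrightarrow>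
      min (b k) (c k) < a j"
begin

lemma clustered_swap: "clustered I N a c b cl q"
proof -
  interpret S: arc_system I N a c b by (rule swap)
  show ?thesis
  proof
    show "p \<le> p' \<Longrightarrow> cl p \<le> cl p'" "cl (p + N) = cl p + q" for p p'
      using cl_mono cl_shift by simp_all
  next
    fix i assume ij: "i \<in> I"
    show "cl (c i) < cl (a i) + q" "cl (b i) < cl (a i) + q"
      using ij cl_window_b cl_window_c by simp_all
  next
    fix i j assume ij: "i \<in> I" "j \<in> I"
    show "cl (c i) = cl (a j) \<Longrightarrow> c i < a j" "cl (b i) = cl (a j) \<Longrightarrow> b i < a j"
      using c_before_a[OF ij] b_before_a[OF ij] by simp_all
    show "i \<noteq> j \<and> (c i < b j) = (a j < a i)" if h: "c i \<noteq> b i" "c j \<noteq> b j" "cl (c i) = cl (b j)"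
    proof -
      have *: "j \<noteq> i \<and> (b j < c i \<longleftrightarrow> a i < a j)"
        using bc_nested[OF ij(2,1) h(2)[symmetric] h(1)[symmetric] h(3)[symmetric]] .
      moreover have "b j \<noteq> c i" using b_eq_c[OF ij(2,1)] * by auto
      moreover have "a i \<noteq> a j" using a_eq[OF ij] * by auto
      ultimately show ?thesis by auto
    qed
    show "cl (c j) = cl (a i) + q \<or> cl (b j) = cl (a i) + q \<Longrightarrow> min (c i) (b i) < a j"
      using cl_back[of i j] ij by (simp add: min.commute disj_commute)
  qed
qed

lemma cl_lessD: "cl p < cl p' \<Longrightarrow> p < p'"
  using cl_mono[of p' p] by linarith

lemma cl_a_less_b: "i \<in> I \<Longrightarrow> cl (a i) < cl (b i)"
  using cl_mono[of "a i" "b i"] a_less_b[of i] b_before_a[of i i] by linarith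

lemma cl_a_less_c: "i \<in> I \<Longrightarrow> cl (a i) < cl (c i)"
  using cl_mono[of "a i" "c i"] a_less_c[of i] c_before_a[of i i] by linarith

lemma cl_le_window: "i \<in> I \<Longrightarrow> j \<in> I \<Longrightarrow> cl (b i) \<le> cl (a j) + q"
  "i \<in> I \<Longrightarrow> j \<in> I \<Longrightarrow> cl (c i) \<le> cl (a j) + q"
  using cl_mono[of "b i" "a j + N"] cl_mono[of "c i" "a j + N"] window_b[of i j] window_c[of i j]
  by (simp_all add: cl_shift)

end

section \<open>Clusters under one trip\<close>

locale clustered_step = arc_step + clustered
begin

lemma be_cl: "cl (a e) < cl (b e)" "cl (b e) < cl (a e) + q"
  using cl_a_less_b cl_window_b e by simp_all

lemma front_cl: "i \<in> I \<Longrightarrow> cl (a e) \<le> cl (a i)"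
  using cl_mono front by simp

text \<open>If the C lay beyond \<open>b e\<close> in the same cluster, \<open>bc_nested\<close>
  would make its arc start before the front; a tie there would lie under the front AB arc.\<close>

lemma c_cluster_less:
  assumes k: "k \<in> I" and cl: "cl (c k) = cl (b e)"
  shows "c k < b e"
proof (rule ccontr)
  assume "\<not> c k < b e"
  then have gt: "b e < c k" using c_neq_be[OF k] by simp
  show False
  proof (cases "b k = c k")
    case True
    then have ke: "k \<noteq> e" using be_less_ce by (metis less_irrefl)
    then have "\<not> a k < b e" using b_inner[OF k ke] gt True by linarith
    then have "cl (b e) \<le> cl (a k)" using cl_mono by simp
    then show False using cl_a_less_c[OF k] cl by simp
  next
    case False
    have "b e \<noteq> c e" using be_less_ce by simp
    then have "a k < a e" using bc_nested[OF e k _ False cl[symmetric]] gt by simp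
    then show False using front[OF k] by simp
  qed
qed

lemma cl_back_e: "j \<in> I \<Longrightarrow> cl (b j) = cl (a e) + q \<or> cl (c j) = cl (a e) + q \<Longrightarrow> b e < a j"
  using cl_back[OF e] be_less_ce by (simp add: min_def)

text \<open>The bound on \<open>p\<close> forces \<open>k\<close> into the front cluster. The moved
  token has left it, and any other starts under the front AB arc.\<close>

lemma cl_front_eq:
  assumes k: "k \<in> I" and p: "cl p = cl (a' k) + q" "p \<le> a e + N"
  shows "k \<noteq> e" "b k < b e"
proof -
  have "cl p \<le> cl (a e) + q" using cl_mono[OF p(2)] by (simp add: cl_shift)
  then have le: "cl (a' k) \<le> cl (a e)" using p(1) by simp
  then show ke: "k \<noteq> e" using be_cl by (metis fun_upd_same not_le)
  then have "cl (a k) < cl (b e)" using le be_cl by simp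
  then show "b k < b e" using b_inner[OF k ke] cl_lessD by blast
qed

lemma clustered_step: "clustered I N a' b' c' cl q"
proof -
  interpret S: arc_system I N a' b' c' by (rule step)
  show ?thesis
  proof
    show "p \<le> p' \<Longrightarrow> cl p \<le> cl p'" "cl (p + N) = cl p + q" for p p'
      using cl_mono cl_shift by simp_all
  next
    fix i assume i: "i \<in> I"
    have \<sigma>i: "\<sigma> i \<in> I" using i \<sigma>_I by simp
    show "cl (b' i) < cl (a' i) + q"
      using cl_window_b[OF i] be_cl by (simp add: cl_shift)
    have "a (\<sigma> i) \<le> a' i"
    proof (cases "i \<in> U")
      case True
      then show ?thesis using \<sigma>_less[OF True] U_c\<sigma>[OF True] by (cases "i = e") simp_all
    next
      case False
      then have "i \<noteq> e" using e_in_U by auto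
      then show ?thesis using \<sigma>_out[OF False] by simp
    qed
    then have "cl (a (\<sigma> i)) \<le> cl (a' i)" by (rule cl_mono)
    then show "cl (c' i) < cl (a' i) + q"
      using cl_window_c[OF \<sigma>i] by simp
  next
    fix i j assume i: "i \<in> I" and j: "j \<in> I"
    have \<sigma>i: "\<sigma> i \<in> I" and \<sigma>j: "\<sigma> j \<in> I" using i j \<sigma>_I by simp_all
    show "b' i < a' j" if h: "cl (b' i) = cl (a' j)"
    proof (cases "i = e")
      case True
      have "cl (a' j) < cl (a e) + q"
        using cl_a_less_b[OF j] cl_le_window(1)[OF j e] be_cl by (cases "j = e") simp_all
      then show ?thesis using h True by (simp add: cl_shift)
    next
      case ie: False
      show ?thesis
      proof (cases "j = e")
        case True
        have "a i < b e"
        proof (rule ccontr)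
          assume "\<not> a i < b e"
          then have "cl (b e) \<le> cl (a i)" using cl_mono by simp
          then show False using cl_a_less_b[OF i] h ie True by simp
        qed
        then show ?thesis using b_inner[OF i ie] ie True by simp
      qed (use h ie b_before_a[OF i j] in simp)
    qed
    show "c' i < a' j" if h: "cl (c' i) = cl (a' j)"
      using h c_before_a[OF \<sigma>i j] c_cluster_less[OF \<sigma>i] by (cases "j = e") simp_all
    show "i \<noteq> j \<and> (b' i < c' j) = (a' j < a' i)"
      if h: "b' i \<noteq> c' i" "b' j \<noteq> c' j" "cl (b' i) = cl (c' j)"
    proof (cases "i = e")
      case True
      then have "cl (c (\<sigma> j)) = cl (a e) + q" using h(3) by (simp add: cl_shift)
      then have lt: "b e < a (\<sigma> j)" using cl_back_e[OF \<sigma>j] by simp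
      then have "\<sigma> j \<notin> U" by (simp add: U_iff)
      then have jU: "j \<notin> U" using \<sigma>_in[of j] by argo
      then have sj: "\<sigma> j = j" by (rule \<sigma>_out)
      have "j \<noteq> e" using jU e_in_U by auto
      then show ?thesis using True lt sj ce_less(1)[OF j] by simp
    next
      case ie: False
      have u: "b i \<noteq> c i" "b (\<sigma> j) \<noteq> c (\<sigma> j)"
        using h untied_step i j untied_\<sigma> by simp_all
      have cl: "cl (b i) = cl (c (\<sigma> j))" using h(3) ie by simp
      have n: "i \<noteq> \<sigma> j \<and> (b i < c (\<sigma> j) \<longleftrightarrow> a (\<sigma> j) < a i)"
        by (rule bc_nested[OF i \<sigma>j u cl])
      show ?thesis
      proof (cases "j \<in> U")
        case False
        then have "j \<noteq> e" using e_in_U by auto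
        then show ?thesis using n \<sigma>_out[OF False] ie by simp
      next
        case True
        have gt: "b e < c (\<sigma> j)" "a (\<sigma> j) < b e" using U_c\<sigma>[OF True] by simp_all
        \<comment> \<open>Otherwise \<open>b i\<close> lies before \<open>b e\<close>, which
          squeezes \<open>c (\<sigma> j)\<close> into the cluster of \<open>b e\<close>, beyond
          \<open>b e\<close>.\<close>
        have "\<not> a i < b e"
        proof
          assume "a i < b e"
          then have "b i < b e" using b_inner[OF i ie] by simp
          then have "cl (b i) \<le> cl (b e)" "cl (b e) \<le> cl (c (\<sigma> j))" using cl_mono gt by simp_all
          then have "cl (c (\<sigma> j)) = cl (b e)" using cl by simp
          then show False using c_cluster_less[OF \<sigma>j] gt by simp
        qed
        then have ai: "b e < a i" using a_neq_be[OF i] by simp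
        have "i \<noteq> j" using True ai by (auto simp: U_iff)
        moreover have "a' j < a i" using True ai by (simp add: U_iff)
        ultimately show ?thesis using n ai gt ie by simp
      qed
    qed
    show "min (b' i) (c' i) < a' j"
      if h: "cl (b' j) = cl (a' i) + q \<or> cl (c' j) = cl (a' i) + q"
    proof -
      have bound: "b' j \<le> a e + N" "c' j \<le> a e + N"
        using ce_less(2)[OF j] ce_less(1)[OF \<sigma>j] by simp_all
      have "i \<noteq> e \<and> b i < b e"
        using h
      proof
        assume "cl (b' j) = cl (a' i) + q"
        then show ?thesis using cl_front_eq[OF i _ bound(1)] by blast
      next
        assume "cl (c' j) = cl (a' i) + q"
        then show ?thesis using cl_front_eq[OF i _ bound(2)] by blast
      qed
      then have ie: "i \<noteq> e" and bi: "b i < b e" by simp_all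
      have "cl (a' i) = cl (a e)"
      proof -
        have "cl (b' j) \<le> cl (a e) + q" "cl (c' j) \<le> cl (a e) + q"
          using cl_mono[OF bound(1)] cl_mono[OF bound(2)] by (simp_all add: cl_shift)
        then have "cl (a' i) \<le> cl (a e)" using h by linarith
        then show ?thesis using front_cl[OF i] ie by simp
      qed
      then have h': "cl (b' j) = cl (a e) + q \<or> cl (c (\<sigma> j)) = cl (a e) + q" using h by simp
      have "b e \<le> a' j"
      proof (cases "j = e")
        case False
        show ?thesis
        proof (cases "cl (c (\<sigma> j)) = cl (a e) + q")
          case True
          then have lt: "b e < a (\<sigma> j)" using cl_back_e[OF \<sigma>j] by simp
          then have "\<sigma> j \<notin> U" by (simp add: U_iff)
          then have "j \<notin> U" using \<sigma>_in[of j] by argo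
          then have "\<sigma> j = j" by (rule \<sigma>_out)
          then show ?thesis using lt False by simp
        next
          case nc: False
          then have "cl (b j) = cl (a e) + q" using h' False by simp
          then show ?thesis using cl_back_e[OF j] False by simp
        qed
      qed simp
      then show ?thesis using bi ie by simp
    qed
  qed
qed

end

locale clustered_tie = tie_step + clustered
begin

lemma be_cl: "cl (a e) < cl (b e)" "cl (b e) < cl (a e) + q"
  using cl_a_less_b cl_window_b e by simp_all

lemma inner: "i \<in> I \<Longrightarrow> i \<noteq> e \<Longrightarrow> a i < b e \<Longrightarrow> b i < b e \<and> c i < b e"
  using nested_b[OF e, of i] nested_c[OF e, of i] front_less[of i] tie by simp

lemma clustered_tie_step: "clustered I N ta tb tc cl q"
proof -
  interpret S: arc_system I N ta tb tc by (rule step)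
  have in_cl: "a i < b e" if "i \<in> I" "cl (b i) = cl (b e) \<or> cl (c i) = cl (b e)" for i
  proof (rule ccontr)
    assume "\<not> a i < b e"
    then have "cl (b e) \<le> cl (a i)" using cl_mono by simp
    then show False using cl_a_less_b[OF that(1)] cl_a_less_c[OF that(1)] that(2) by auto
  qed
  show ?thesis
  proof
    show "p \<le> p' \<Longrightarrow> cl p \<le> cl p'" "cl (p + N) = cl p + q" for p p'
      using cl_mono cl_shift by simp_all
  next
    fix i assume i: "i \<in> I"
    show "cl (tb i) < cl (ta i) + q" "cl (tc i) < cl (ta i) + q"
      using cl_window_b[OF i] cl_window_c[OF i] be_cl by (simp_all add: cl_shift)
  next
    fix i j assume i: "i \<in> I" and j: "j \<in> I"
    have top: "cl (ta j) < cl (a e) + q"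
      using cl_a_less_b[OF j] cl_le_window(1)[OF j e] be_cl by (cases "j = e") simp_all
    show "tb i < ta j" if h: "cl (tb i) = cl (ta j)"
      using h top b_before_a[OF i j] inner[OF i] in_cl[OF i]
      by (cases "i = e"; cases "j = e") (auto simp: cl_shift)
    show "tc i < ta j" if h: "cl (tc i) = cl (ta j)"
      using h top c_before_a[OF i j] inner[OF i] in_cl[OF i]
      by (cases "i = e"; cases "j = e") (auto simp: cl_shift)
    show "i \<noteq> j \<and> (tb i < tc j) = (ta j < ta i)"
      if h: "tb i \<noteq> tc i" "tb j \<noteq> tc j" "cl (tb i) = cl (tc j)"
    proof -
      have "i \<noteq> e" "j \<noteq> e" using h by auto
      then show ?thesis using bc_nested[OF i j] h by simp
    qed
    show "min (tb i) (tc i) < ta j"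
      if h: "cl (tb j) = cl (ta i) + q \<or> cl (tc j) = cl (ta i) + q"
    proof -
      have "cl (tb j) \<le> cl (a e) + q" "cl (tc j) \<le> cl (a e) + q"
        using cl_le_window[OF j e] by (auto simp: cl_shift)
      then have le: "cl (ta i) \<le> cl (a e)" using h by auto
      then have ie: "i \<noteq> e" using be_cl by auto
      have eq: "cl (a i) = cl (a e)" using le ie cl_mono[OF front[OF i]] by simp
      then have "a i < b e" using be_cl cl_lessD by simp
      then have bi: "b i < b e" using inner[OF i ie] by simp
      show ?thesis
      proof (cases "j = e")
        case False
        then have "min (b e) (c e) < a j" using cl_back[OF e j] h eq ie by simp
        then show ?thesis using bi ie False tie by simp
      qed (use bi ie in simp)
    qed
  qed
qed

end

section \<open>Counts that locate the end of a trip\<close>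

locale clustered_front = clustered +
  fixes e :: nat
  assumes e: "e \<in> I" and front: "i \<in> I \<Longrightarrow> a e \<le> a i"
begin

definition cnt :: "(nat \<Rightarrow> int) \<Rightarrow> int \<Rightarrow> int" where
  "cnt f z = int (card {i \<in> I. cl (f i) \<le> z})"

lemma cnt_upd: "cnt (f(e := v)) z =
    cnt f z - (if cl (f e) \<le> z then 1 else 0) + (if cl v \<le> z then 1 else 0)"
proof -
  let ?S = "{i \<in> I. i \<noteq> e \<and> cl (f i) \<le> z}"
  have fS: "finite ?S" "e \<notin> ?S" using fin by auto
  have c1: "{i \<in> I. cl (f i) \<le> z} = (if cl (f e) \<le> z then insert e ?S else ?S)"
    using e by auto
  have c2: "{i \<in> I. cl ((f(e := v)) i) \<le> z} = (if cl v \<le> z then insert e ?S else ?S)"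
    using e by auto
  show ?thesis unfolding cnt_def c1 c2 using fS by simp
qed

lemma cnt_b_le: "cnt b z \<le> cnt a (z - 1)"
proof -
  have "{i \<in> I. cl (b i) \<le> z} \<subseteq> {i \<in> I. cl (a i) \<le> z - 1}"
    using cl_a_less_b by force
  then show ?thesis using fin by (simp add: cnt_def card_mono)
qed

text \<open>The front token is counted on the right but not on the left. Together with
  \<open>cnt_b_eq\<close> this makes \<open>cl (b e)\<close> the first label after the front one at
  which the counts meet.\<close>

lemma cnt_b_less:
  assumes "cl (a e) < z" "z < cl (b e)"
  shows "cnt b z < cnt a (z - 1)"
proof -
  have "{i \<in> I. cl (b i) \<le> z} \<subset> {i \<in> I. cl (a i) \<le> z - 1}"
  proof
    show "{i \<in> I. cl (b i) \<le> z} \<subseteq> {i \<in> I. cl (a i) \<le> z - 1}"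
      using cl_a_less_b by force
    have "e \<in> {i \<in> I. cl (a i) \<le> z - 1}" "e \<notin> {i \<in> I. cl (b i) \<le> z}" using assms e by auto
    then show "{i \<in> I. cl (b i) \<le> z} \<noteq> {i \<in> I. cl (a i) \<le> z - 1}" by metis
  qed
  then show ?thesis using fin by (simp add: cnt_def psubset_card_mono)
qed

text \<open>Every other A of smaller label starts under the front AB arc, so its partner comes
  before \<open>b e\<close>.\<close>

lemma cnt_b_eq: "cnt b (cl (b e)) = cnt a (cl (b e) - 1)"
proof -
  have "cl (b i) \<le> cl (b e)" if i: "i \<in> I" "cl (a i) \<le> cl (b e) - 1" for i
  proof (cases "i = e")
    case False
    have "a i < b e" using cl_lessD[of "a i" "b e"] i by simp
    moreover have "a e < a i" using front[OF i(1)] a_eq[OF e i(1)] False by force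
    ultimately have "b i < b e" using nested_b[OF e i(1)] by simp
    then show ?thesis using cl_mono by simp
  qed simp
  moreover have "cl (a i) \<le> cl (b e) - 1" if "i \<in> I" "cl (b i) \<le> cl (b e)" for i
    using cl_a_less_b[OF that(1)] that(2) by simp
  ultimately have "{i \<in> I. cl (b i) \<le> cl (b e)} = {i \<in> I. cl (a i) \<le> cl (b e) - 1}" by blast
  then show ?thesis by (simp add: cnt_def)
qed

end

locale clustered_run = arc_run +
  fixes cl :: "int \<Rightarrow> int" and q :: int
  assumes cinit: "clustered I N a\<^sub>0 b\<^sub>0 c\<^sub>0 cl q"
begin

lemma cl_props: "p \<le> p' \<Longrightarrow> cl p \<le> cl p'" "cl (p + N) = cl p + q"
  using clustered.cl_mono[OF cinit] clustered.cl_shift[OF cinit] by simp_all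

lemma clus: "clustered I N (A n) (B n) (C n) cl q"
proof (induction n)
  case 0
  then show ?case using cinit by (simp add: zero)
next
  case (Suc n)
  consider "\<not> hitC n" | "\<not> hitB n" | "hitB n" "hitC n" by blast
  then show ?case
  proof cases
    case 1
    interpret clustered_step I N "A n" "B n" "C n" "ft n" cl q
      using step_B[OF sys 1] Suc by (simp add: clustered_step_def)
    show ?thesis unfolding Suc_B[OF 1] src_def by (rule clustered_step)
  next
    case 2
    interpret clustered_step I N "A n" "C n" "B n" "ft n" cl q
      using step_C[OF sys 2] clustered.clustered_swap[OF Suc] by (simp add: clustered_step_def)
    show ?thesis unfolding Suc_C[OF 2] src_def by (rule clustered.clustered_swap[OF clustered_step])
  next
    case 3
    interpret clustered_tie I N "A n" "B n" "C n" "ft n" cl q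
      using step_tie[OF sys 3] Suc by (simp add: clustered_tie_def)
    show ?thesis unfolding Suc_tie[OF 3] src_def by (rule clustered_tie_step)
  qed
qed

definition cnt where "cnt f z = int (card {i \<in> I. cl (f i) \<le> z})"

lemma clus_front: "clustered_front I N (A n) (B n) (C n) cl q (ft n)"
  "clustered_front I N (A n) (C n) (B n) cl q (ft n)"
  using clus clustered.clustered_swap[OF clus] ft
  by (simp_all add: clustered_front_def clustered_front_axioms_def)

lemma cnt_front: "clustered_front.cnt I cl = cnt"
  by (rule ext)+ (simp add: cnt_def clustered_front.cnt_def[OF clus_front(1)])

text \<open>\<open>bc_nested\<close> with both indices equal puts untied ends of one token into
  different clusters, so comparing ends amounts to comparing labels.\<close>

lemma hit_cl: "hitB n \<longleftrightarrow> cl (B n (ft n)) = cl (tgt n)" "hitC n \<longleftrightarrow> cl (C n (ft n)) = cl (tgt n)"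
proof -
  have ne: "B n (ft n) = C n (ft n)" if "cl (B n (ft n)) = cl (C n (ft n))"
    using clustered.bc_nested[OF clus[of n] ft(1)[of n] ft(1)[of n]] that by auto
  have "hitB n \<longleftrightarrow> cl (B n (ft n)) \<le> cl (C n (ft n))" "hitC n \<longleftrightarrow> cl (C n (ft n)) \<le> cl (B n (ft n))"
    using ne cl_props(1)[of "B n (ft n)" "C n (ft n)"] cl_props(1)[of "C n (ft n)" "B n (ft n)"]
    unfolding hitB_def hitC_def by (metis order_antisym linear)+
  moreover have "tgt n = B n (ft n) \<and> cl (B n (ft n)) \<le> cl (C n (ft n)) \<or>
      tgt n = C n (ft n) \<and> cl (C n (ft n)) \<le> cl (B n (ft n))"
    using cl_props(1) by (auto simp: tgt_def min_def)
  ultimately show "hitB n \<longleftrightarrow> cl (B n (ft n)) = cl (tgt n)" "hitC n \<longleftrightarrow> cl (C n (ft n)) = cl (tgt n)"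
    by auto
qed

lemma tgt_cl: "cl (src n) < cl (tgt n)" "cl (tgt n) < cl (src n) + q"
  "cl (tgt n) \<le> cl (B n (ft n))" "cl (tgt n) \<le> cl (C n (ft n))"
  using clustered.cl_a_less_b[OF clus[of n] ft(1)[of n]] clustered.cl_a_less_c[OF clus[of n] ft(1)[of n]]
    clustered.cl_window_b[OF clus[of n] ft(1)[of n]] clustered.cl_window_c[OF clus[of n] ft(1)[of n]]
    cl_props(1)[of "B n (ft n)" "C n (ft n)"] cl_props(1)[of "C n (ft n)" "B n (ft n)"]
  by (auto simp: src_def tgt_def min_def)

lemma cnt_less:
  "cl (src n) < z \<Longrightarrow> z < cl (tgt n) \<Longrightarrow> cnt (B n) z < cnt (A n) (z - 1)"
  "cl (src n) < z \<Longrightarrow> z < cl (tgt n) \<Longrightarrow> cnt (C n) z < cnt (A n) (z - 1)"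
  using clustered_front.cnt_b_less[OF clus_front(1)[of n], of z]
    clustered_front.cnt_b_less[OF clus_front(2)[of n], of z] tgt_cl(3,4)[of n]
  by (simp_all add: cnt_front src_def)

lemma cnt_le: "cnt (B n) z \<le> cnt (A n) (z - 1)" "cnt (C n) z \<le> cnt (A n) (z - 1)"
  using clustered_front.cnt_b_le[OF clus_front(1)[of n], of z]
    clustered_front.cnt_b_le[OF clus_front(2)[of n], of z]
  by (simp_all add: cnt_front)

lemma cnt_tgt:
  "hitB n \<longleftrightarrow> cnt (B n) (cl (tgt n)) = cnt (A n) (cl (tgt n) - 1)"
  "hitC n \<longleftrightarrow> cnt (C n) (cl (tgt n)) = cnt (A n) (cl (tgt n) - 1)"
proof -
  show "hitB n \<longleftrightarrow> cnt (B n) (cl (tgt n)) = cnt (A n) (cl (tgt n) - 1)"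
  proof (cases "hitB n")
    case True
    then show ?thesis using clustered_front.cnt_b_eq[OF clus_front(1)[of n]] hit_cl(1)[of n] by (simp add: cnt_front)
  next
    case False
    then have "cl (tgt n) < cl (B n (ft n))" using hit_cl(1)[of n] tgt_cl(3)[of n] by simp
    then show ?thesis
      using False clustered_front.cnt_b_less[OF clus_front(1)[of n], of "cl (tgt n)"] tgt_cl(1)[of n]
      by (simp add: cnt_front src_def)
  qed
  show "hitC n \<longleftrightarrow> cnt (C n) (cl (tgt n)) = cnt (A n) (cl (tgt n) - 1)"
  proof (cases "hitC n")
    case True
    then show ?thesis using clustered_front.cnt_b_eq[OF clus_front(2)[of n]] hit_cl(2)[of n] by (simp add: cnt_front)
  next
    case False
    then have "cl (tgt n) < cl (C n (ft n))" using hit_cl(2)[of n] tgt_cl(4)[of n] by simp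
    then show ?thesis
      using False clustered_front.cnt_b_less[OF clus_front(2)[of n], of "cl (tgt n)"] tgt_cl(1)[of n]
      by (simp add: cnt_front src_def)
  qed
qed

lemma cnt_bij: "bij_betw h I I \<Longrightarrow> cnt (f \<circ> h) z = cnt f z"
proof -
  assume h: "bij_betw h I I"
  have "bij_betw h {i \<in> I. cl ((f \<circ> h) i) \<le> z} {i \<in> I. cl (f i) \<le> z}"
    unfolding bij_betw_def
  proof
    show "inj_on h {i \<in> I. cl ((f \<circ> h) i) \<le> z}"
      using h by (auto simp: bij_betw_def intro: inj_on_subset)
    show "h ` {i \<in> I. cl ((f \<circ> h) i) \<le> z} = {i \<in> I. cl (f i) \<le> z}"
      using bij_betw_imp_surj_on[OF h] by auto
  qed
  then show ?thesis unfolding cnt_def by (simp add: bij_betw_same_card)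
qed

lemma cnt_Suc:
  "cnt (A (Suc n)) z = cnt (A n) z - (if cl (src n) \<le> z \<and> z < cl (tgt n) then 1 else 0)"
  "cnt (B (Suc n)) z = cnt (B n) z - (if hitB n \<and> cl (tgt n) \<le> z \<and> z < cl (src n) + q then 1 else 0)"
  "cnt (C (Suc n)) z = cnt (C n) z - (if hitC n \<and> cl (tgt n) \<le> z \<and> z < cl (src n) + q then 1 else 0)"
proof -
  note upd = clustered_front.cnt_upd[OF clus_front(1)[of n], unfolded cnt_front]
  have X: "cl (A n (ft n) + N) = cl (src n) + q" "A n (ft n) = src n" by (simp_all add: src_def cl_props)
  consider "\<not> hitC n" | "\<not> hitB n" | "hitB n" "hitC n" by blast
  then have "cnt (A (Suc n)) z = cnt (A n) z - (if cl (src n) \<le> z \<and> z < cl (tgt n) then 1 else 0) \<and>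
    cnt (B (Suc n)) z = cnt (B n) z - (if hitB n \<and> cl (tgt n) \<le> z \<and> z < cl (src n) + q then 1 else 0) \<and>
    cnt (C (Suc n)) z = cnt (C n) z - (if hitC n \<and> cl (tgt n) \<le> z \<and> z < cl (src n) + q then 1 else 0)"
  proof cases
    case 1
    interpret arc_step I N "A n" "B n" "C n" "ft n" using step_B sys 1 .
    have t: "B n (ft n) = tgt n" "hitB n" using 1 hit_or[of n] by (simp_all add: tgt_def hitC_def)
    show ?thesis
      unfolding Suc_B[OF 1] cnt_bij[OF bij_\<sigma>]
      unfolding upd cl_props(2) X(2) t(1)
      using 1 t tgt_cl[of n] by auto
  next
    case 2
    interpret arc_step I N "A n" "C n" "B n" "ft n" using step_C sys 2 .
    have t: "C n (ft n) = tgt n" "hitC n" using 2 hit_or[of n] by (simp_all add: tgt_def hitB_def)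
    show ?thesis
      unfolding Suc_C[OF 2] cnt_bij[OF bij_\<sigma>]
      unfolding upd cl_props(2) X(2) t(1)
      using 2 t tgt_cl[of n] by auto
  next
    case 3
    have t: "B n (ft n) = tgt n" "C n (ft n) = tgt n"
      using 3 by (simp_all add: tgt_def hitB_def hitC_def)
    show ?thesis
      unfolding Suc_tie[OF 3] upd cl_props(2) X(2) t
      using 3 tgt_cl[of n] by auto
  qed
  then show "cnt (A (Suc n)) z = cnt (A n) z - (if cl (src n) \<le> z \<and> z < cl (tgt n) then 1 else 0)"
    "cnt (B (Suc n)) z = cnt (B n) z - (if hitB n \<and> cl (tgt n) \<le> z \<and> z < cl (src n) + q then 1 else 0)"
    "cnt (C (Suc n)) z = cnt (C n) z - (if hitC n \<and> cl (tgt n) \<le> z \<and> z < cl (src n) + q then 1 else 0)"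
    by blast+
qed

end

section \<open>One promotion as a phase of trips\<close>

context clustered_run
begin

text \<open>The recurrence \<open>toggle_rel\<close> in terms of clusters. Labels are read relative
  to the front, which advances by one during a phase; hence label \<open>k\<close> is cluster
  \<open>z\<close> in the new state and \<open>z - 1\<close> in the old one.\<close>

definition phase_eq where
  "phase_eq n m z \<longleftrightarrow>
     cnt (A m) z + cnt (A n) (z - 1) =
       cnt (A n) z + max (cnt (A m) (z - 1)) (max (cnt (B n) z) (cnt (C n) z)) \<and>
     cnt (B m) z + cnt (B n) (z - 1) = cnt (B m) (z - 1) + min (cnt (B n) z) (cnt (A m) (z - 1)) \<and>
     cnt (C m) z + cnt (C n) (z - 1) = cnt (C m) (z - 1) + min (cnt (C n) z) (cnt (A m) (z - 1)) \<and>
     cnt (B m) z \<le> cnt (B n) z \<and> cnt (C m) z \<le> cnt (C n) z"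

text \<open>While the tokens of the front cluster \<open>X\<close> are moved one after the other, no trip reaches
  further than its predecessor; \<open>\<zeta>\<close> is the cluster reached by the last one.\<close>

lemma phase_aux:
  assumes "\<And>m. m < j \<Longrightarrow> cl (src (n + m)) = X"
  shows "(\<exists>\<zeta>. X < \<zeta> \<and> \<zeta> \<le> X + q \<and>
      (\<forall>z. X \<le> z \<and> z < \<zeta> \<longrightarrow> cnt (A (n + j)) z = cnt (A n) z - int j \<and>
         cnt (B (n + j)) z = cnt (B n) z \<and> cnt (C (n + j)) z = cnt (C n) z) \<and>
      (j = 0 \<longrightarrow> \<zeta> = X + q) \<and> (0 < j \<longrightarrow> \<zeta> < X + q \<and> (cnt (A (n + j)) (\<zeta> - 1) = cnt (B (n + j)) \<zeta> \<or>
         cnt (A (n + j)) (\<zeta> - 1) = cnt (C (n + j)) \<zeta>))) \<and>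
    (\<forall>z. X < z \<and> z < X + q \<longrightarrow> phase_eq n (n + j) z)"
  using assms
proof (induction j)
  case 0
  have "0 < q" using tgt_cl(1,2)[of 0] by linarith
  moreover have "phase_eq n n z" for z
    using cnt_le[of n z] by (simp add: phase_eq_def max_def min_def)
  \<comment> \<open>Before the first trip nothing bounds the reach, so \<open>\<zeta>\<close> is a
    whole period away.\<close>
  ultimately show ?case by (intro conjI exI[of _ "X + q"]) auto
next
  case (Suc j)
  let ?m = "n + j"
  let ?s = "cl (tgt ?m)"
  obtain \<zeta> where \<zeta>: "X < \<zeta>" "\<zeta> \<le> X + q"
    and below: "\<And>z. X \<le> z \<Longrightarrow> z < \<zeta> \<Longrightarrow> cnt (A ?m) z = cnt (A n) z - int j \<and>
         cnt (B ?m) z = cnt (B n) z \<and> cnt (C ?m) z = cnt (C n) z"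
    and at0: "j = 0 \<Longrightarrow> \<zeta> = X + q" and at: "0 < j \<Longrightarrow> \<zeta> < X + q \<and> (cnt (A ?m) (\<zeta> - 1) = cnt (B ?m) \<zeta> \<or>
         cnt (A ?m) (\<zeta> - 1) = cnt (C ?m) \<zeta>)"
    and eq: "\<And>z. X < z \<Longrightarrow> z < X + q \<Longrightarrow> phase_eq n ?m z"
    using Suc.IH[OF Suc.prems] by auto
  have X: "cl (src ?m) = X" using Suc.prems[of j] by simp
  have s: "X < ?s" "?s < X + q" using tgt_cl(1,2)[of ?m] X by simp_all
  have less: "cnt (B ?m) z < cnt (A ?m) (z - 1)" "cnt (C ?m) z < cnt (A ?m) (z - 1)"
    if "X < z" "z < ?s" for z
    using cnt_less[of ?m z] that X by simp_all
  \<comment> \<open>The counts met at \<open>\<zeta>\<close> after the previous trip, whereas they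
    are strictly ordered at every label that a trip passes over.\<close>
  have s\<zeta>: "?s \<le> \<zeta>"
  proof (cases "j = 0")
    case True
    then show ?thesis using at0 s by simp
  next
    case False
    then show ?thesis using at less[OF \<zeta>(1)] by force
  qed
  have bel: "cnt (A ?m) z = cnt (A n) z - int j" "cnt (B ?m) z = cnt (B n) z"
    "cnt (C ?m) z = cnt (C n) z" if "X \<le> z" "z < ?s" for z
    using below[of z] that s\<zeta> by auto
  have sucA: "cnt (A (n + Suc j)) z = cnt (A ?m) z - (if X \<le> z \<and> z < ?s then 1 else 0)"
    and sucB: "cnt (B (n + Suc j)) z = cnt (B ?m) z - (if hitB ?m \<and> ?s \<le> z then 1 else 0)"
    and sucC: "cnt (C (n + Suc j)) z = cnt (C ?m) z - (if hitC ?m \<and> ?s \<le> z then 1 else 0)"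
    if "z < X + q" for z
    using cnt_Suc[where n = ?m and z = z] X that by auto
  have hB: "hitB ?m \<longleftrightarrow> cnt (B ?m) ?s = cnt (A ?m) (?s - 1)"
    and hC: "hitC ?m \<longleftrightarrow> cnt (C ?m) ?s = cnt (A ?m) (?s - 1)"
    using cnt_tgt[of ?m] by auto
  have le: "cnt (B ?m) z \<le> cnt (A ?m) (z - 1)" "cnt (C ?m) z \<le> cnt (A ?m) (z - 1)" for z
    using cnt_le by auto
  \<comment> \<open>The counts of the hit letter meet at the target, and the trip lowers both sides
    by one, so they still meet.\<close>
  have new_at: "cnt (A (n + Suc j)) (?s - 1) = cnt (B (n + Suc j)) ?s \<or>
      cnt (A (n + Suc j)) (?s - 1) = cnt (C (n + Suc j)) ?s"
    using hit_or[of ?m] hB hC sucA[of "?s - 1"] sucB[of ?s] sucC[of ?s] s by auto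
  have new_eq: "phase_eq n (n + Suc j) z" if z: "X < z" "z < X + q" for z
  proof -
    note E = eq[OF z, unfolded phase_eq_def]
    have z1: "z - 1 < X + q" "X \<le> z - 1" using z by simp_all
    note S = sucA[OF z(2)] sucB[OF z(2)] sucC[OF z(2)] sucA[OF z1(1)] sucB[OF z1(1)] sucC[OF z1(1)]
    consider "z < ?s" | "z = ?s" | "?s < z" by linarith
    then show ?thesis
    proof cases
      case 1
      have z2: "X \<le> z" "z - 1 < ?s" using 1 z by simp_all
      show ?thesis
        unfolding phase_eq_def
        using S 1 z z1 bel[OF z2(1) 1] bel[OF z1(2) z2(2)] less[OF z(1) 1] by auto
    next
      case 2
      have z2: "z - 1 < ?s" using 2 by simp
      have b1: "cnt (A (n + Suc j)) z = cnt (A ?m) z"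
        "cnt (B (n + Suc j)) z = cnt (B ?m) z - (if hitB ?m then 1 else 0)"
        "cnt (C (n + Suc j)) z = cnt (C ?m) z - (if hitC ?m then 1 else 0)"
        "cnt (A (n + Suc j)) (z - 1) = cnt (A ?m) (z - 1) - 1"
        "cnt (B (n + Suc j)) (z - 1) = cnt (B ?m) (z - 1)"
        "cnt (C (n + Suc j)) (z - 1) = cnt (C ?m) (z - 1)"
        using S 2 z1 by simp_all
      have h: "hitB ?m \<longleftrightarrow> cnt (B ?m) z = cnt (A ?m) (z - 1)"
        "hitC ?m \<longleftrightarrow> cnt (C ?m) z = cnt (A ?m) (z - 1)"
        using hB hC 2 by simp_all
      show ?thesis
        unfolding phase_eq_def b1
        using E h hit_or[of ?m] le[of z] bel(2,3)[OF z1(2) z2] by (auto simp: max_def min_def)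
    next
      case 3
      show ?thesis
        unfolding phase_eq_def using S 3 z1 E by auto
    qed
  qed
  have "\<forall>z. X \<le> z \<and> z < ?s \<longrightarrow> cnt (A (n + Suc j)) z = cnt (A n) z - int (Suc j) \<and>
         cnt (B (n + Suc j)) z = cnt (B n) z \<and> cnt (C (n + Suc j)) z = cnt (C n) z"
    using bel sucA sucB sucC s by auto
  then show ?case using s new_at new_eq by (intro conjI exI[of _ ?s]) auto
qed

end

section \<open>Bender--Knuth involutions as toggles of counts\<close>

lemma less_vee_iff: "p < p' \<longleftrightarrow> p = vA \<and> p' \<noteq> (vA :: vee)"
proof -
  have "covered_by\<^sup>+\<^sup>+ p p' \<longleftrightarrow> covered_by p p'"
  proof
    assume "covered_by\<^sup>+\<^sup>+ p p'"
    then show "covered_by p p'"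
      by (induction rule: tranclp_induct) (auto elim: covered_by.cases)
  qed auto
  moreover have "covered_by p p' \<longleftrightarrow> p = vA \<and> p' \<noteq> vA"
    by (cases p; cases p') (auto intro: covered_by.intros elim: covered_by.cases)
  ultimately show ?thesis by (simp add: less_vee_def)
qed

text \<open>A weakly increasing fiber is determined by these counts, and a Bender-Knuth involution
  changes only the count at \<open>k\<close>.\<close>

definition num :: "nat \<Rightarrow> (vee \<times> nat \<Rightarrow> int) \<Rightarrow> vee \<Rightarrow> int \<Rightarrow> nat" where
  "num l f p k = card {i \<in> {1..l}. f (p, i) \<le> k}"

lemma labelings_iff: "f \<in> labelings l q \<longleftrightarrow> f \<in> extensional (UNIV \<times> {1..l}) \<and>
    (\<forall>i\<in>{1..l}. f (vA, i) < f (vB, i) \<and> f (vA, i) < f (vC, i)) \<and>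
    (\<forall>p. \<forall>i\<in>{1..l}. \<forall>j\<in>{1..l}. i \<le> j \<longrightarrow> f (p, i) \<le> f (p, j)) \<and>
    (\<forall>i\<in>{1..l}. 1 \<le> f (vA, i) \<and> f (vA, i) \<le> int q - 1 \<and> 2 \<le> f (vB, i) \<and> f (vB, i) \<le> int q \<and>
       2 \<le> f (vC, i) \<and> f (vC, i) \<le> int q)"
proof -
  have e1: "(\<forall>p1 p2. \<forall>i\<in>{1..l}. p1 < p2 \<longrightarrow> f (p1, i) < f (p2, i)) \<longleftrightarrow>
      (\<forall>i\<in>{1..l}. f (vA, i) < f (vB, i) \<and> f (vA, i) < f (vC, i))" (is "?L \<longleftrightarrow> ?R")
  proof
    assume ?L
    then show ?R by (simp add: less_vee_iff)
  next
    assume R: ?R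
    show ?L
    proof (intro allI ballI impI)
      fix p1 p2 :: vee and i assume "i \<in> {1..l}" "p1 < p2"
      then show "f (p1, i) < f (p2, i)" using R by (cases p2) (simp_all add: less_vee_iff)
    qed
  qed
  have e2: "(\<forall>p. \<forall>i\<in>{1..l}. f (p, i) \<in> label_range q p) \<longleftrightarrow>
      (\<forall>i\<in>{1..l}. 1 \<le> f (vA, i) \<and> f (vA, i) \<le> int q - 1 \<and> 2 \<le> f (vB, i) \<and> f (vB, i) \<le> int q \<and>
       2 \<le> f (vC, i) \<and> f (vC, i) \<le> int q)" (is "?L \<longleftrightarrow> ?R")
  proof
    assume L: ?L
    show ?R
    proof
      fix i assume i: "i \<in> {1..l}"
      show "1 \<le> f (vA, i) \<and> f (vA, i) \<le> int q - 1 \<and> 2 \<le> f (vB, i) \<and> f (vB, i) \<le> int q \<and>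
       2 \<le> f (vC, i) \<and> f (vC, i) \<le> int q"
        using L[rule_format, OF i, of vA] L[rule_format, OF i, of vB] L[rule_format, OF i, of vC] by simp
    qed
  next
    assume R: ?R
    show ?L
    proof (intro allI ballI)
      fix p i assume i: "i \<in> {1..l}"
      show "f (p, i) \<in> label_range q p" using R[rule_format, OF i] by (cases p) simp_all
    qed
  qed
  show ?thesis unfolding labelings_def mem_Collect_eq e1 e2 by (rule refl)
qed

lemma card_initial:
  assumes "n \<le> l" "\<And>i. i \<in> {1..l} \<Longrightarrow> P i \<longleftrightarrow> i \<le> n"
  shows "card {i \<in> {1..l}. P i} = n"
proof -
  have "{i \<in> {1..l}. P i} = {1..n}" using assms by auto
  then show ?thesis by simp
qed

lemma num_iff:
  assumes mono: "\<And>i j. i \<in> {1..l} \<Longrightarrow> j \<in> {1..l} \<Longrightarrow> i \<le> j \<Longrightarrow> f (p, i) \<le> f (p, j)"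
    and i: "i \<in> {1..l}"
  shows "f (p, i) \<le> k \<longleftrightarrow> i \<le> num l f p k"
proof
  assume h: "f (p, i) \<le> k"
  have "{1..i} \<subseteq> {j \<in> {1..l}. f (p, j) \<le> k}"
  proof
    fix j assume "j \<in> {1..i}"
    then have j: "j \<in> {1..l}" "j \<le> i" using i by auto
    then show "j \<in> {j \<in> {1..l}. f (p, j) \<le> k}" using mono[OF j(1) i j(2)] h by simp
  qed
  then have "card {1..i} \<le> num l f p k" unfolding num_def by (rule card_mono[rotated]) simp
  then show "i \<le> num l f p k" by simp
next
  assume h: "i \<le> num l f p k"
  show "f (p, i) \<le> k"
  proof (rule ccontr)
    assume n: "\<not> f (p, i) \<le> k"
    have "{j \<in> {1..l}. f (p, j) \<le> k} \<subseteq> {1..<i}"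
    proof
      fix j assume j: "j \<in> {j \<in> {1..l}. f (p, j) \<le> k}"
      then show "j \<in> {1..<i}" using mono[OF i, of j] n by (cases "i \<le> j") auto
    qed
    then have "num l f p k \<le> card {1..<i}" unfolding num_def by (rule card_mono[rotated]) simp
    then have "num l f p k \<le> i - 1" by simp
    moreover have "1 \<le> i" using i by simp
    ultimately show False using h by linarith
  qed
qed

lemma num_le: "num l f p k \<le> l"
proof -
  have "num l f p k \<le> card {1..l}" unfolding num_def by (rule card_mono) auto
  then show ?thesis by simp
qed

locale labeling =
  fixes l q :: nat and f :: "vee \<times> nat \<Rightarrow> int"
  assumes f: "f \<in> labelings l q"
begin

lemma ext: "i \<notin> {1..l} \<Longrightarrow> f (p, i) = undefined"
  using f by (auto simp: labelings_iff extensional_def)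

lemma AB: "i \<in> {1..l} \<Longrightarrow> f (vA, i) < f (vB, i)" and AC: "i \<in> {1..l} \<Longrightarrow> f (vA, i) < f (vC, i)"
  using f by (auto simp: labelings_iff)

lemma mono: "i \<in> {1..l} \<Longrightarrow> j \<in> {1..l} \<Longrightarrow> i \<le> j \<Longrightarrow> f (p, i) \<le> f (p, j)"
  using f by (auto simp: labelings_iff)

lemma range: "i \<in> {1..l} \<Longrightarrow> 1 \<le> f (vA, i)" "i \<in> {1..l} \<Longrightarrow> f (vA, i) \<le> int q - 1"
  "p \<noteq> vA \<Longrightarrow> i \<in> {1..l} \<Longrightarrow> 2 \<le> f (p, i)" "i \<in> {1..l} \<Longrightarrow> f (p, i) \<le> int q"
proof -
  have r: "\<forall>i\<in>{1..l}. 1 \<le> f (vA, i) \<and> f (vA, i) \<le> int q - 1 \<and> 2 \<le> f (vB, i) \<and> f (vB, i) \<le> int q \<and>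
       2 \<le> f (vC, i) \<and> f (vC, i) \<le> int q"
    using f unfolding labelings_iff by (elim conjE)
  note ri = r[rule_format]
  show "i \<in> {1..l} \<Longrightarrow> 1 \<le> f (vA, i)" "i \<in> {1..l} \<Longrightarrow> f (vA, i) \<le> int q - 1"
    using ri[of i] by simp_all
  show "p \<noteq> vA \<Longrightarrow> i \<in> {1..l} \<Longrightarrow> 2 \<le> f (p, i)" using ri[of i] by (cases p) simp_all
  show "i \<in> {1..l} \<Longrightarrow> f (p, i) \<le> int q" using ri[of i] by (cases p) simp_all
qed

lemma A_less: "p \<noteq> vA \<Longrightarrow> i \<in> {1..l} \<Longrightarrow> f (vA, i) < f (p, i)"
  using AB AC by (cases p) auto

lemma num: "i \<in> {1..l} \<Longrightarrow> f (p, i) \<le> k \<longleftrightarrow> i \<le> num l f p k"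
  by (rule num_iff[where f = f and p = p, OF mono])

lemma num_mono: "k \<le> k' \<Longrightarrow> num l f p k \<le> num l f p k'"
  unfolding num_def by (rule card_mono) auto

lemma num_less: "p \<noteq> vA \<Longrightarrow> num l f p (k + 1) \<le> num l f vA k"
  unfolding num_def by (rule card_mono) (use A_less in force)+

lemma num_0: "k \<le> 0 \<Longrightarrow> num l f p k = 0" "p \<noteq> vA \<Longrightarrow> k \<le> 1 \<Longrightarrow> num l f p k = 0"
proof -
  have "2 \<le> f (p, i) \<or> p = vA \<and> 1 \<le> f (p, i)" if "i \<in> {1..l}" for i
    using range(1)[OF that] range(3)[OF _ that, of p] by (cases p) auto
  then have *: "{i \<in> {1..l}. f (p, i) \<le> k} = {}" if "k \<le> 0 \<or> p \<noteq> vA \<and> k \<le> 1"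
    using that by force
  show "k \<le> 0 \<Longrightarrow> num l f p k = 0" "p \<noteq> vA \<Longrightarrow> k \<le> 1 \<Longrightarrow> num l f p k = 0"
    unfolding num_def using * by simp_all
qed

lemma num_top: "int q \<le> k \<Longrightarrow> num l f p k = l" "int q - 1 \<le> k \<Longrightarrow> num l f vA k = l"
proof -
  show "num l f p k = l" if "int q \<le> k"
    unfolding num_def
  proof (rule card_initial)
    fix i assume "i \<in> {1..l}"
    then show "f (p, i) \<le> k \<longleftrightarrow> i \<le> l" using range(4)[of i p] that by simp
  qed simp
  show "num l f vA k = l" if "int q - 1 \<le> k"
    unfolding num_def
  proof (rule card_initial)
    fix i assume "i \<in> {1..l}"
    then show "f (vA, i) \<le> k \<longleftrightarrow> i \<le> l" using range(2)[of i] that by simp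
  qed simp
qed

lemma fiber_iff: "i \<in> {1..l} \<Longrightarrow> f (p, i) = k \<longleftrightarrow> num l f p (k - 1) < i \<and> i \<le> num l f p k"
  using num[of i p k] num[of i p "k - 1"] by auto

end

section \<open>A single Bender-Knuth involution\<close>

locale toggle = labeling +
  fixes k :: int
  assumes k: "1 \<le> k" "k \<le> int q - 1"
begin

text \<open>Raising all labels \<open>k\<close> from \<open>i\<close> on keeps the fiber sorted. For
  \<open>vA\<close> the labels of B and C only grow beyond \<open>i\<close>, so the condition at
  \<open>i\<close> is enough.\<close>

lemma raise_mem:
  assumes i: "i \<in> {1..l}" and eq: "f (p, i) = k"
    and pA: "p = vA \<Longrightarrow> k + 2 \<le> f (vB, i) \<and> k + 2 \<le> f (vC, i)"
  shows "(\<lambda>(p', j). if p' = p \<and> j \<in> {1..l} \<and> i \<le> j \<and> f (p', j) = k then k + 1 else f (p', j)) \<in> labelings l q"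
    (is "?g \<in> _")
  unfolding labelings_iff
proof (intro conjI ballI allI impI)
  show "?g \<in> extensional (UNIV \<times> {1..l})" using ext by (auto simp: extensional_def)
next
  fix j assume j: "j \<in> {1..l}"
  have B: "k + 1 < f (vB, j) \<and> k + 1 < f (vC, j)" if "p = vA" "i \<le> j"
    using mono[OF i j that(2), of vB] mono[OF i j that(2), of vC] pA[OF that(1)] by simp
  show "?g (vA, j) < ?g (vB, j)" "?g (vA, j) < ?g (vC, j)"
    using B AB[OF j] AC[OF j] by auto
  show "1 \<le> ?g (vA, j)" "?g (vA, j) \<le> int q - 1" "2 \<le> ?g (vB, j)" "?g (vB, j) \<le> int q"
    "2 \<le> ?g (vC, j)" "?g (vC, j) \<le> int q"
    using range(1,2)[OF j] range(3)[of vB, OF _ j] range(3)[of vC, OF _ j] range(4)[OF j, of vB]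
      range(4)[OF j, of vC] k B
    by auto
next
  fix p' j j' assume j: "j \<in> {1..l}" "j' \<in> {1..l}" "j \<le> j'"
  show "?g (p', j) \<le> ?g (p', j')" using mono[OF j, of p'] j by auto
qed

lemma lower_mem:
  assumes i: "i \<in> {1..l}" and eq: "f (p, i) = k + 1" and pA: "p \<noteq> vA \<Longrightarrow> f (vA, i) < k"
  shows "(\<lambda>(p', j). if p' = p \<and> j \<in> {1..l} \<and> j \<le> i \<and> f (p', j) = k + 1 then k else f (p', j)) \<in> labelings l q"
    (is "?g \<in> _")
  unfolding labelings_iff
proof (intro conjI ballI allI impI)
  show "?g \<in> extensional (UNIV \<times> {1..l})" using ext by (auto simp: extensional_def)
next
  fix j assume j: "j \<in> {1..l}"
  have B: "f (vA, j) < k" if "p \<noteq> vA" "j \<le> i"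
    using mono[OF j i that(2), of vA] pA[OF that(1)] by simp
  show "?g (vA, j) < ?g (vB, j)" "?g (vA, j) < ?g (vC, j)"
    using B AB[OF j] AC[OF j] by auto
  show "1 \<le> ?g (vA, j)" "?g (vA, j) \<le> int q - 1" "2 \<le> ?g (vB, j)" "?g (vB, j) \<le> int q"
    "2 \<le> ?g (vC, j)" "?g (vC, j) \<le> int q"
    using range(1,2)[OF j] range(3)[of vB, OF _ j] range(3)[of vC, OF _ j] range(4)[OF j, of vB]
      range(4)[OF j, of vC] k B
    by auto
next
  fix p' j j' assume j: "j \<in> {1..l}" "j' \<in> {1..l}" "j \<le> j'"
  show "?g (p', j) \<le> ?g (p', j')" using mono[OF j, of p'] j by auto
qed

lemma raisable_iff:
  assumes i: "i \<in> {1..l}" and eq: "f (p, i) = k"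
  shows "raisable l q f p i \<longleftrightarrow> (p = vA \<longrightarrow> k + 2 \<le> f (vB, i) \<and> k + 2 \<le> f (vC, i))"
proof
  assume "raisable l q f p i"
  then obtain g where g: "g \<in> labelings l q" "f (p, i) < g (p, i)"
    "\<And>p' i'. i' \<in> {1..l} \<Longrightarrow> p' \<noteq> p \<Longrightarrow> g (p', i') = f (p', i')" by (auto simp: raisable_def)
  interpret G: labeling l q g using g(1) by unfold_locales
  show "p = vA \<longrightarrow> k + 2 \<le> f (vB, i) \<and> k + 2 \<le> f (vC, i)"
    using G.AB[OF i] G.AC[OF i] g(2) g(3)[OF i, of vB] g(3)[OF i, of vC] eq by auto
next
  assume h: "p = vA \<longrightarrow> k + 2 \<le> f (vB, i) \<and> k + 2 \<le> f (vC, i)"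
  show "raisable l q f p i"
    unfolding raisable_def using raise_mem[OF i eq] h i eq by (intro bexI[rotated]) auto
qed

lemma lowerable_iff:
  assumes i: "i \<in> {1..l}" and eq: "f (p, i) = k + 1"
  shows "lowerable l q f p i \<longleftrightarrow> (p \<noteq> vA \<longrightarrow> f (vA, i) < k)"
proof
  assume "lowerable l q f p i"
  then obtain g where g: "g \<in> labelings l q" "g (p, i) < f (p, i)"
    "\<And>p' i'. i' \<in> {1..l} \<Longrightarrow> p' \<noteq> p \<Longrightarrow> g (p', i') = f (p', i')" by (auto simp: lowerable_def)
  interpret G: labeling l q g using g(1) by unfold_locales
  show "p \<noteq> vA \<longrightarrow> f (vA, i) < k"
    using G.A_less[OF _ i, of p] g(2) g(3)[OF i, of vA] eq by auto
next
  assume h: "p \<noteq> vA \<longrightarrow> f (vA, i) < k"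
  show "lowerable l q f p i"
    unfolding lowerable_def using lower_mem[OF i eq] h i eq by (intro bexI[rotated]) auto
qed

abbreviation "n \<equiv> num l f"

text \<open>Free labels \<open>k\<close> fill the positions after \<open>lo p\<close> up to
  \<open>n p k\<close>, free labels \<open>k + 1\<close> those from there up to \<open>hi p\<close>.
  The maximum leaves out the A's lying below a B or C labelled \<open>k + 1\<close>, the minimum in
  \<open>hi\<close> the B's and C's lying above an A labelled \<open>k\<close>.\<close>

definition lo where "lo p = (if p = vA then max (n vA (k - 1)) (max (n vB (k + 1)) (n vC (k + 1))) else n p (k - 1))"
definition hi where "hi p = (if p = vA then n vA (k + 1) else min (n p (k + 1)) (n vA (k - 1)))"

lemma lo_le: "lo p \<le> n p k"
  using num_less[of vB k] num_less[of vC k] num_mono[of "k - 1" k p] by (cases "p = vA") (simp_all add: lo_def)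

lemma hi_ge: "n p k \<le> hi p"
  using num_less[of p "k - 1"] num_mono[of k "k + 1" p] by (cases "p = vA") (simp_all add: hi_def)

lemma hi_le: "hi p \<le> n p (k + 1)" and lo_ge: "n p (k - 1) \<le> lo p"
  by (simp_all add: hi_def lo_def)

lemma free_lo: "free_lo l q k f p = {lo p<..n p k}"
proof (rule Set.set_eqI)
  fix i
  show "i \<in> free_lo l q k f p \<longleftrightarrow> i \<in> {lo p<..n p k}"
  proof (cases "i \<in> {1..l}")
    case True
    have *: "k + 2 \<le> f (p', i) \<longleftrightarrow> n p' (k + 1) < i" for p'
      using num[OF True, of p' "k + 1"] by linarith
    have "i \<in> free_lo l q k f p \<longleftrightarrow> f (p, i) = k \<and> raisable l q f p i"
      using True by (simp add: free_lo_def)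
    also have "\<dots> \<longleftrightarrow> f (p, i) = k \<and> (p = vA \<longrightarrow> n vB (k + 1) < i \<and> n vC (k + 1) < i)"
      using raisable_iff[OF True, of p] unfolding * by blast
    also have "\<dots> \<longleftrightarrow> i \<in> {lo p<..n p k}"
      unfolding fiber_iff[OF True] lo_def by (cases "p = vA") (simp_all, linarith)
    finally show ?thesis .
  next
    case False
    then show ?thesis using num_le[of l f p k] by (auto simp: free_lo_def)
  qed
qed

lemma free_hi: "free_hi l q k f p = {n p k<..hi p}"
proof (rule Set.set_eqI)
  fix i
  show "i \<in> free_hi l q k f p \<longleftrightarrow> i \<in> {n p k<..hi p}"
  proof (cases "i \<in> {1..l}")
    case True
    have *: "f (vA, i) < k \<longleftrightarrow> i \<le> n vA (k - 1)"
      using num[OF True, of vA "k - 1"] by linarith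
    have "i \<in> free_hi l q k f p \<longleftrightarrow> f (p, i) = k + 1 \<and> lowerable l q f p i"
      using True by (simp add: free_hi_def)
    also have "\<dots> \<longleftrightarrow> f (p, i) = k + 1 \<and> (p \<noteq> vA \<longrightarrow> i \<le> n vA (k - 1))"
      using lowerable_iff[OF True, of p] unfolding * by blast
    also have "\<dots> \<longleftrightarrow> i \<in> {n p k<..hi p}"
      unfolding fiber_iff[OF True] hi_def by (cases "p = vA") auto
    finally show ?thesis .
  next
    case False
    then show ?thesis using hi_le[of p] num_le[of l f p "k + 1"] by (auto simp: free_hi_def)
  qed
qed

abbreviation "g \<equiv> bender_knuth l q k f"
text \<open>Exchanging the two numbers of free labels reflects the cut \<open>n p k\<close> in the
  interval from \<open>lo p\<close> to \<open>hi p\<close>, as in a piecewise-linear toggle.\<close>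

definition mid where "mid p = lo p + hi p - n p k"

lemma mid: "lo p \<le> mid p" "mid p \<le> hi p"
  using lo_le[of p] hi_ge[of p] by (simp_all add: mid_def)

lemma bk_eq: "g (p, i) = (if lo p < i \<and> i \<le> hi p then if i \<le> mid p then k else k + 1 else f (p, i))"
proof -
  have F: "free_lo l q k f p \<union> free_hi l q k f p = {lo p<..hi p}"
    unfolding free_lo free_hi using lo_le[of p] hi_ge[of p] by auto
  have h: "card (free_hi l q k f p) = hi p - n p k" unfolding free_hi by simp
  have g: "g (p, i) = (if i \<in> {lo p<..hi p} then
      if card {j \<in> {lo p<..hi p}. j < i} < hi p - n p k then k else k + 1 else f (p, i))"
    unfolding bender_knuth_def Let_def prod.case F h ..
  show ?thesis
  proof (cases "lo p < i \<and> i \<le> hi p")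
    case True
    then have "{j \<in> {lo p<..hi p}. j < i} = {lo p<..<i}" by auto
    then have c: "card {j \<in> {lo p<..hi p}. j < i} = i - Suc (lo p)" by simp
    have "i - Suc (lo p) < hi p - n p k \<longleftrightarrow> i \<le> mid p"
      using True lo_le[of p] hi_ge[of p] unfolding mid_def by linarith
    then show ?thesis unfolding g c using True by simp
  next
    case False
    then show ?thesis unfolding g by auto
  qed
qed

definition n' where "n' p j = (if j = k then mid p else n p j)"

lemma bk_le_iff: "i \<in> {1..l} \<Longrightarrow> g (p, i) \<le> j \<longleftrightarrow> i \<le> n' p j"
proof -
  assume i: "i \<in> {1..l}"
  note f = num[OF i, of p j]
  have n': "n' p j = (if j = k then mid p else n p j)" by (rule n'_def)
  have low: "j < k \<Longrightarrow> n p j \<le> lo p" using num_mono[of j "k - 1" p] lo_ge[of p] by simp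
  have high: "k < j \<Longrightarrow> hi p \<le> n p j" using num_mono[of "k + 1" j p] hi_le[of p] by simp
  have ord: "lo p \<le> mid p" "mid p \<le> hi p" "lo p \<le> n p k" "n p k \<le> hi p"
    by (rule mid lo_le hi_ge)+
  show ?thesis
  proof (cases "lo p < i \<and> i \<le> hi p")
    case True
    then have g: "g (p, i) = (if i \<le> mid p then k else k + 1)" by (simp only: bk_eq if_True simp_thms)
    consider "j < k" | "j = k" | "k < j" by linarith
    then show ?thesis
    proof cases
      case 1
      then have "\<not> i \<le> n p j" "\<not> g (p, i) \<le> j" using low True unfolding g by auto
      then show ?thesis using 1 n' by simp
    next
      case 2
      then show ?thesis using n' unfolding g by simp
    next
      case 3
      then have "i \<le> n p j" "g (p, i) \<le> j" using high True unfolding g by auto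
      then show ?thesis using 3 n' by simp
    qed
  next
    case False
    then have g: "g (p, i) = f (p, i)" by (simp only: bk_eq if_False)
    have "i \<le> n p k \<longleftrightarrow> i \<le> mid p" using False ord by linarith
    then show ?thesis using f n' unfolding g by (cases "j = k") simp_all
  qed
qed

lemma n'_le: "n' p j \<le> l"
  using num_le[of l f p j] num_le[of l f p "k + 1"] mid(2)[of p] hi_le[of p]
  unfolding n'_def by simp

lemma num_bk: "num l g p j = n' p j"
  unfolding num_def using n'_le bk_le_iff by (rule card_initial)

lemma n'_less:
  assumes p: "p \<noteq> vA"
  shows "n' p (j + 1) \<le> n' vA j"
proof -
  consider "j = k" | "j = k - 1" | "j \<noteq> k" "j + 1 \<noteq> k" by linarith
  then show ?thesis
  proof cases
    case 1
    have "n p (k + 1) \<le> lo vA" using p by (cases p) (simp_all add: lo_def)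
    then show ?thesis using 1 mid(1)[of vA] by (simp add: n'_def)
  next
    case 2
    have "hi p \<le> n vA (k - 1)" using p by (simp add: hi_def)
    then show ?thesis using 2 mid(2)[of p] by (simp add: n'_def)
  next
    case 3
    then show ?thesis using num_less[OF p, of j] by (simp add: n'_def)
  qed
qed

lemma bk_mem: "g \<in> labelings l q"
  unfolding labelings_iff
proof (intro conjI ballI allI impI)
  have "g (p, i) = undefined" if "i \<notin> {1..l}" for p i
  proof -
    have "hi p \<le> l" using hi_le[of p] num_le[of l f p "k + 1"] by simp
    then show ?thesis using that ext[OF that] by (auto simp: bk_eq)
  qed
  then show "g \<in> extensional (UNIV \<times> {1..l})" by (auto simp: extensional_def)
next
  fix i assume i: "i \<in> {1..l}"
  have "g (vA, i) < g (p, i)" if "p \<noteq> vA" for p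
  proof -
    have "i \<le> n' p (g (p, i))" using bk_le_iff[OF i, of p "g (p, i)"] by simp
    then have "i \<le> n' vA (g (p, i) - 1)" using n'_less[OF that, of "g (p, i) - 1"] by simp
    then show ?thesis using bk_le_iff[OF i, of vA "g (p, i) - 1"] by simp
  qed
  then show "g (vA, i) < g (vB, i)" "g (vA, i) < g (vC, i)" by simp_all
  have z: "n' vA 0 = 0" using num_0(1)[of 0 vA] k by (simp add: n'_def)
  show "1 \<le> g (vA, i)" using bk_le_iff[OF i, of vA 0] z i by simp
  have B: "2 \<le> g (p, i)" if "p \<noteq> vA" for p
  proof -
    have "n' p 1 = 0" using n'_less[OF that, of 0] z by simp
    then show ?thesis using bk_le_iff[OF i, of p 1] i by simp
  qed
  show "2 \<le> g (vB, i)" "2 \<le> g (vC, i)" using B by simp_all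
  have t: "n' p (int q) = l" for p using num_top(1)[of "int q" p] k by (simp add: n'_def)
  have "n' vA (int q - 1) = l" using n'_less[of vB "int q - 1"] t[of vB] n'_le[of vA "int q - 1"] by simp
  then show "g (vA, i) \<le> int q - 1" using bk_le_iff[OF i, of vA "int q - 1"] i by simp
  show "g (vB, i) \<le> int q" "g (vC, i) \<le> int q" using bk_le_iff[OF i] t i by simp_all
next
  fix p i j assume ij: "i \<in> {1..l}" "j \<in> {1..l}" "i \<le> j"
  have "j \<le> n' p (g (p, j))" using bk_le_iff[OF ij(2), of p "g (p, j)"] by simp
  then show "g (p, i) \<le> g (p, j)" using bk_le_iff[OF ij(1), of p "g (p, j)"] ij(3) by simp
qed

end

text \<open>When label \<open>k\<close> is toggled, \<open>k - 1\<close> has its new count and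
  \<open>k + 1\<close> still its old one. Sums replace differences because \<open>num\<close> is a
  natural number.\<close>

definition toggle_rel where
  "toggle_rel l f g k \<longleftrightarrow>
     num l g vA k + num l f vA k = num l f vA (k + 1) +
       max (num l g vA (k - 1)) (max (num l f vB (k + 1)) (num l f vC (k + 1))) \<and>
     (\<forall>p. p \<noteq> vA \<longrightarrow> num l g p k + num l f p k = num l g p (k - 1) +
       min (num l f p (k + 1)) (num l g vA (k - 1)))"

text \<open>A toggle at \<open>k\<close> leaves all other counts alone, so relations established for
  smaller labels persist.\<close>

lemma promotion_aux:
  assumes "f \<in> labelings l q" "int m \<le> int q - 1"
  defines "g \<equiv> fold (bender_knuth l q) [1..int m] f"
  shows "g \<in> labelings l q \<and> (\<forall>p j. int m < j \<longrightarrow> num l g p j = num l f p j) \<and>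
    (\<forall>k. 1 \<le> k \<and> k \<le> int m \<longrightarrow> toggle_rel l f g k)"
  using assms(2) unfolding g_def
proof (induction m)
  case 0
  then show ?case using assms(1) by auto
next
  case (Suc m)
  let ?g = "fold (bender_knuth l q) [1..int m] f" and ?k = "int (Suc m)"
  have IH: "?g \<in> labelings l q" "\<And>p j. int m < j \<Longrightarrow> num l ?g p j = num l f p j"
    "\<And>k. 1 \<le> k \<Longrightarrow> k \<le> int m \<Longrightarrow> toggle_rel l f ?g k"
    using Suc by auto
  have "[1..?k] = [1..int m] @ [?k]" using upto_rec2[of 1 ?k] by simp
  then have eq: "fold (bender_knuth l q) [1..?k] f = bender_knuth l q ?k ?g" by simp
  interpret T: toggle l q ?g ?k using IH(1) Suc.prems by unfold_locales auto
  have num: "num l (bender_knuth l q ?k ?g) p j = (if j = ?k then T.mid p else num l ?g p j)" for p j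
    unfolding T.num_bk T.n'_def ..
  have "toggle_rel l f (bender_knuth l q ?k ?g) k" if k: "1 \<le> k" "k \<le> ?k" for k
  proof (cases "k = ?k")
    case True
    have o: "num l ?g p ?k = num l f p ?k" "num l ?g p (?k + 1) = num l f p (?k + 1)" for p
      using IH(2) by auto
    have m: "T.mid p + num l f p ?k = T.lo p + T.hi p" for p
      using T.lo_le[of p] T.hi_ge[of p] unfolding T.mid_def o by linarith
    have "\<forall>p. p \<noteq> vA \<longrightarrow> T.mid p + num l f p ?k =
        num l ?g p (?k - 1) + min (num l f p (?k + 1)) (num l ?g vA (?k - 1))"
      using m unfolding T.lo_def T.hi_def o by simp
    moreover have "T.mid vA + num l f vA ?k = num l f vA (?k + 1) +
       max (num l ?g vA (?k - 1)) (max (num l f vB (?k + 1)) (num l f vC (?k + 1)))"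
      using m[of vA] unfolding T.lo_def T.hi_def o by simp
    moreover have "?k - 1 \<noteq> ?k" by simp
    ultimately show ?thesis
      unfolding True toggle_rel_def num by (simp only: if_True if_False simp_thms)
  next
    case False
    then have "k \<le> int m" using k by simp
    then show ?thesis using IH(3)[OF k(1)] False unfolding toggle_rel_def num by simp
  qed
  moreover have "num l (bender_knuth l q ?k ?g) p j = num l f p j" if "?k < j" for p j
    unfolding num using IH(2)[of j p] that by simp
  ultimately show ?case unfolding eq using T.bk_mem by blast
qed

lemma promotion_num:
  assumes "f \<in> labelings l q" "q \<ge> 1"
  shows "promotion l q f \<in> labelings l q"
    "1 \<le> k \<Longrightarrow> k \<le> int q - 1 \<Longrightarrow> toggle_rel l f (promotion l q f) k"
  using promotion_aux[OF assms(1), of "q - 1"] assms(2) by (simp_all add: promotion_def of_nat_diff)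

lemma labelings_eqI:
  assumes "f \<in> labelings l q" "g \<in> labelings l q" "\<And>p k. num l f p k = num l g p k"
  shows "f = g"
proof
  interpret F: labeling l q f using assms(1) by unfold_locales
  interpret G: labeling l q g using assms(2) by unfold_locales
  fix x :: "vee \<times> nat"
  obtain p i where x: "x = (p, i)" by (cases x)
  show "f x = g x"
  proof (cases "i \<in> {1..l}")
    case True
    have "f (p, i) \<le> g (p, i)" using F.num[OF True] G.num[OF True] assms(3) by (metis order_refl)
    moreover have "g (p, i) \<le> f (p, i)" using F.num[OF True] G.num[OF True] assms(3) by (metis order_refl)
    ultimately show ?thesis using x by simp
  next
    case False
    then show ?thesis using F.ext G.ext x by simp
  qed
qed

section \<open>Labelings represented by a run\<close>

context clustered_run
begin

text \<open>The labels of the starts never decrease, so the trips from \<open>first T\<close> up to,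
  but excluding, \<open>first (T + 1)\<close> are those from cluster \<open>T + 1\<close>; together
  they make one promotion.\<close>

definition first :: "int \<Rightarrow> nat" where "first T = (LEAST n. T < cl (src n))"

lemma q_pos: "0 < q"
  using tgt_cl(1,2)[of 0] by linarith

lemma cl_add_mult: "cl (p + int k * N) = cl p + int k * q"
proof (induction k)
  case (Suc k)
  have "p + int (Suc k) * N = (p + int k * N) + N" by (simp add: algebra_simps)
  then show ?case using Suc cl_props(2)[of "p + int k * N"] by (simp add: algebra_simps)
qed simp

lemma first: "T < cl (src (first T))" "m < first T \<Longrightarrow> cl (src m) \<le> T"
proof -
  define k where "k = nat (T - cl 0 + 1)"
  have "T < cl 0 + int k" by (simp add: k_def)
  also have "\<dots> \<le> cl 0 + int k * q" using q_pos by (simp add: mult_le_cancel_left1)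
  also have "\<dots> = cl (int k * N)" using cl_add_mult[of 0 k] by simp
  also have "\<dots> \<le> cl (src (nat (int k * N)))"
    using src_ge[of "nat (int k * N)"] N_pos by (intro cl_props(1)) simp
  finally have "\<exists>n. T < cl (src n)" by blast
  then show "T < cl (src (first T))" unfolding first_def by (rule LeastI_ex)
  show "cl (src m) \<le> T" if "m < first T"
    using not_less_Least[of m "\<lambda>n. T < cl (src n)"] that unfolding first_def by simp
qed

lemma first_mono: "first T \<le> first (T + 1)"
proof (rule ccontr)
  assume "\<not> ?thesis"
  then have "cl (src (first (T + 1))) \<le> T" by (intro first(2)) simp
  then show False using first(1)[of "T + 1"] by simp
qed

lemma src_cl_mono: "m \<le> n \<Longrightarrow> cl (src m) \<le> cl (src n)"
  using src_le_iff[of m n] cl_props(1) by simp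

lemma phase:
  assumes z: "T + 1 < z" "z < T + 1 + q"
  shows "phase_eq (first T) (first (T + 1)) z"
proof -
  define j where "j = first (T + 1) - first T"
  have j: "first (T + 1) = first T + j" using first_mono[of T] by (simp add: j_def)
  have X: "cl (src (first T + m)) = T + 1" if "m < j" for m
  proof -
    have "cl (src (first T + m)) \<le> T + 1" using that j by (intro first(2)) simp
    moreover have "T < cl (src (first T + m))"
      using first(1)[of T] src_cl_mono[of "first T" "first T + m"] by simp
    ultimately show ?thesis by simp
  qed
  show ?thesis using conjunct2[OF phase_aux[OF X]] z unfolding j by blast
qed

lemma cnt_0:
  assumes "z < cl (src n)"
  shows "cnt (A n) z = 0" "cnt (B n) z = 0" "cnt (C n) z = 0"
proof -
  have "cl (src n) \<le> cl p" if "p \<in> P n" for p using src_le[OF that] by (rule cl_props(1))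
  then have "{i \<in> I. cl (A n i) \<le> z} = {}" "{i \<in> I. cl (B n i) \<le> z} = {}" "{i \<in> I. cl (C n i) \<le> z} = {}"
    using assms by (force simp: P_def PA_def PB_def PC_def)+
  then show "cnt (A n) z = 0" "cnt (B n) z = 0" "cnt (C n) z = 0"
    unfolding cnt_def by (simp_all only: card.empty of_nat_0)
qed

lemma cnt_full:
  assumes "\<And>p. p \<in> P n \<Longrightarrow> cl p \<le> z"
  shows "cnt (A n) z = int (card I)" "cnt (B n) z = int (card I)" "cnt (C n) z = int (card I)"
proof -
  have "{i \<in> I. cl (A n i) \<le> z} = I" "{i \<in> I. cl (B n i) \<le> z} = I" "{i \<in> I. cl (C n i) \<le> z} = I"
    using assms by (auto simp: P_def PA_def PB_def PC_def)
  then show "cnt (A n) z = int (card I)" "cnt (B n) z = int (card I)" "cnt (C n) z = int (card I)"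
    unfolding cnt_def by simp_all
qed

lemma P_first:
  assumes "\<And>p. p \<in> P 0 \<Longrightarrow> cl p \<le> q" "0 \<le> T" "p \<in> P (first T)"
  shows "cl p \<le> T + q"
proof -
  have "p \<in> P 0 \<or> (\<exists>m<first T. p = src m + N)" using P_sub[of "first T"] assms(3) by blast
  then show ?thesis
  proof
    assume "p \<in> P 0"
    then show ?thesis using assms(1,2) by fastforce
  next
    assume "\<exists>m<first T. p = src m + N"
    then obtain m where m: "m < first T" "p = src m + N" by blast
    have "cl (src m) \<le> T" using m(1) by (rule first(2))
    then show ?thesis using m(2) cl_props(2)[of "src m"] by simp
  qed
qed

lemma cnt_inj: "inj_on f I \<Longrightarrow> cnt f z = int (card {p \<in> f ` I. cl p \<le> z})"
proof -
  assume f: "inj_on f I"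
  have "{p \<in> f ` I. cl p \<le> z} = f ` {i \<in> I. cl (f i) \<le> z}" by auto
  moreover have "inj_on f {i \<in> I. cl (f i) \<le> z}" using f by (rule inj_on_subset) auto
  ultimately show ?thesis by (simp add: cnt_def card_image)
qed

lemma cnt_turn:
  assumes "\<And>p. q < cl p \<longleftrightarrow> N \<le> p"
  shows "cnt (A (first q)) (q + z) = cnt (A 0) z" "cnt (B (first q)) (q + z) = cnt (C 0) z"
    "cnt (C (first q)) (q + z) = cnt (B 0) z"
proof -
  have turn: "N \<le> src (first q)" "\<And>k. k < first q \<Longrightarrow> src k < N"
    using first(1)[of q] first(2)[of _ q] assms by (auto simp: not_less[symmetric])
  have F: "PA (first q) = (\<lambda>p. p + N) ` PA 0" "PB (first q) = (\<lambda>p. p + N) ` PC 0"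
    "PC (first q) = (\<lambda>p. p + N) ` PB 0"
    using turn by (auto intro!: full_turn)
  have sh: "int (card {p \<in> (\<lambda>p. p + N) ` S. cl p \<le> q + z}) = int (card {p \<in> S. cl p \<le> z})" for S
  proof -
    have "{p \<in> (\<lambda>p. p + N) ` S. cl p \<le> q + z} = (\<lambda>p. p + N) ` {p \<in> S. cl p \<le> z}"
      by (auto simp: cl_props(2))
    then show ?thesis by (simp add: card_image)
  qed
  have ci: "cnt (A n) z = int (card {p \<in> PA n. cl p \<le> z})" "cnt (B n) z = int (card {p \<in> PB n. cl p \<le> z})"
    "cnt (C n) z = int (card {p \<in> PC n. cl p \<le> z})" for n z
    unfolding PA_def PB_def PC_def using cnt_inj[OF arc_system.inj_a[OF sys]]
      cnt_inj[OF arc_system.inj_b[OF sys]] cnt_inj[OF arc_system.inj_c[OF sys]] by blast+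
  show "cnt (A (first q)) (q + z) = cnt (A 0) z" unfolding ci F(1) by (rule sh)
  show "cnt (B (first q)) (q + z) = cnt (C 0) z" unfolding ci F(2) by (rule sh)
  show "cnt (C (first q)) (q + z) = cnt (B 0) z" unfolding ci F(3) by (rule sh)
qed

text \<open>After \<open>T\<close> promotions the front has advanced by \<open>T\<close>, so label
  \<open>k\<close> is found in cluster \<open>T + k\<close>.\<close>

definition represents where
  "represents l T f \<longleftrightarrow> (\<forall>k. 0 \<le> k \<and> k \<le> q \<longrightarrow>
     int (num l f vA k) = cnt (A (first T)) (T + k) \<and>
     int (num l f vB k) = cnt (B (first T)) (T + k) \<and>
     int (num l f vC k) = cnt (C (first T)) (T + k))"

text \<open>\<open>toggle_rel\<close> and \<open>phase_eq\<close> are one recurrence with one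
  starting value: the counts at \<open>k = 0\<close> vanish, since all letters of cluster
  \<open>T + 1\<close> or less have been passed.\<close>

lemma represents_promotion:
  assumes f: "f \<in> labelings l (nat q)" and r: "represents l T f"
    and P0: "\<And>p. p \<in> P 0 \<Longrightarrow> cl p \<le> q" and T: "0 \<le> T" and I: "card I = l"
  shows "represents l (T + 1) (promotion l (nat q) f)"
proof -
  let ?g = "promotion l (nat q) f" and ?n = "first T" and ?m = "first (T + 1)"
  have q: "int (nat q) = q" "1 \<le> nat q" using q_pos by auto
  have g: "?g \<in> labelings l (nat q)" using promotion_num(1)[OF f q(2)] .
  interpret G: labeling l "nat q" ?g using g by unfold_locales
  have main: "int k \<le> q - 1 \<longrightarrow>
     int (num l ?g vA (int k)) = cnt (A ?m) (T + 1 + int k) \<and>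
     int (num l ?g vB (int k)) = cnt (B ?m) (T + 1 + int k) \<and>
     int (num l ?g vC (int k)) = cnt (C ?m) (T + 1 + int k)" for k
  proof (induction k)
    case 0
    have "T + 1 < cl (src ?m)" by (rule first(1))
    then have "cnt (A ?m) (T + 1) = 0 \<and> cnt (B ?m) (T + 1) = 0 \<and> cnt (C ?m) (T + 1) = 0"
      using cnt_0 by blast
    then show ?case using G.num_0(1)[of 0] by simp
  next
    case (Suc k)
    show ?case
    proof
      assume k: "int (Suc k) \<le> q - 1"
      let ?k = "int (Suc k)" and ?z = "T + 1 + int (Suc k)"
      have IH: "int (num l ?g vA (?k - 1)) = cnt (A ?m) (?z - 1)"
        "int (num l ?g vB (?k - 1)) = cnt (B ?m) (?z - 1)"
        "int (num l ?g vC (?k - 1)) = cnt (C ?m) (?z - 1)"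
      proof -
        have zk: "?z - 1 = T + 1 + int k" "?k - 1 = int k" by simp_all
        show "int (num l ?g vA (?k - 1)) = cnt (A ?m) (?z - 1)"
          "int (num l ?g vB (?k - 1)) = cnt (B ?m) (?z - 1)"
          "int (num l ?g vC (?k - 1)) = cnt (C ?m) (?z - 1)"
          unfolding zk using Suc k by simp_all
      qed
      have r1: "int (num l f vA ?k) = cnt (A ?n) (?z - 1)"
        "int (num l f vB ?k) = cnt (B ?n) (?z - 1)"
        "int (num l f vC ?k) = cnt (C ?n) (?z - 1)"
        using r[unfolded represents_def, rule_format, of ?k] k by (simp_all add: algebra_simps)
      have r2: "int (num l f vA (?k + 1)) = cnt (A ?n) ?z"
        "int (num l f vB (?k + 1)) = cnt (B ?n) ?z"
        "int (num l f vC (?k + 1)) = cnt (C ?n) ?z"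
        using r[unfolded represents_def, rule_format, of "?k + 1"] k by (simp_all add: algebra_simps)
      have tg: "toggle_rel l f ?g ?k"
        using promotion_num(2)[OF f q(2), of ?k] k q(1) by simp
      have ph: "phase_eq ?n ?m ?z" using phase[of T ?z] k by simp
      have "int (num l ?g vA ?k) + int (num l f vA ?k) = int (num l f vA (?k + 1)) +
         max (int (num l ?g vA (?k - 1))) (max (int (num l f vB (?k + 1))) (int (num l f vC (?k + 1))))"
        "int (num l ?g p ?k) + int (num l f p ?k) = int (num l ?g p (?k - 1)) +
         min (int (num l f p (?k + 1))) (int (num l ?g vA (?k - 1)))" if "p \<noteq> vA" for p
        using tg that unfolding toggle_rel_def of_nat_max[symmetric] of_nat_min[symmetric] of_nat_add[symmetric]
        by simp_all
      from this(1)[of vB] this(2)[of vB] this(2)[of vC]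
      show "int (num l ?g vA ?k) = cnt (A ?m) ?z \<and> int (num l ?g vB ?k) = cnt (B ?m) ?z \<and>
          int (num l ?g vC ?k) = cnt (C ?m) ?z"
        using ph unfolding phase_eq_def IH r1 r2 by simp
    qed
  qed
  \<comment> \<open>No toggle acts at \<open>q\<close>; there every letter is counted on both
    sides.\<close>
  have top: "int (num l ?g vA q) = cnt (A ?m) (T + 1 + q) \<and>
     int (num l ?g vB q) = cnt (B ?m) (T + 1 + q) \<and> int (num l ?g vC q) = cnt (C ?m) (T + 1 + q)"
    using G.num_top(1)[of q] cnt_full[of ?m "T + 1 + q"] P_first[OF P0, of "T + 1"] T I q(1) by simp
  show ?thesis
    unfolding represents_def
  proof (intro allI impI)
    fix k assume k: "0 \<le> k \<and> k \<le> q"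
    show "int (num l ?g vA k) = cnt (A ?m) (T + 1 + k) \<and>
     int (num l ?g vB k) = cnt (B ?m) (T + 1 + k) \<and> int (num l ?g vC k) = cnt (C ?m) (T + 1 + k)"
      using main[of "nat k"] top k by (cases "k = q") simp_all
  qed
qed

lemma represents_iterate:
  assumes f: "f \<in> labelings l (nat q)" and r: "represents l 0 f"
    and P0: "\<And>p. p \<in> P 0 \<Longrightarrow> cl p \<le> q" and I: "card I = l"
  shows "(promotion l (nat q) ^^ n) f \<in> labelings l (nat q) \<and> represents l (int n) ((promotion l (nat q) ^^ n) f)"
proof (induction n)
  case (Suc n)
  have "1 \<le> nat q" using q_pos by simp
  then show ?case
    using Suc represents_promotion[OF _ _ P0 _ I, of "(promotion l (nat q) ^^ n) f" "int n"]
      promotion_num(1)[of "(promotion l (nat q) ^^ n) f" l "nat q"] by (simp add: add.commute)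
qed (use f r in simp)

lemma represents_turn:
  assumes f: "f \<in> labelings l (nat q)" and r: "represents l 0 f"
    and P0: "\<And>p. p \<in> P 0 \<Longrightarrow> cl p \<le> q" and I: "card I = l" and z: "first 0 = 0"
    and turn: "\<And>p. q < cl p \<longleftrightarrow> N \<le> p"
  defines "g \<equiv> (promotion l (nat q) ^^ nat q) f"
  shows "g \<in> labelings l (nat q)" "num l g vA k = num l f vA k" "num l g vB k = num l f vC k"
    "num l g vC k = num l f vB k"
proof -
  have q: "int (nat q) = q" using q_pos by simp
  have it: "g \<in> labelings l (nat q)" "represents l q g"
    using represents_iterate[OF f r P0 I, of "nat q"] q by (simp_all add: g_def)
  then show "g \<in> labelings l (nat q)" by simp
  interpret F: labeling l "nat q" f using f by unfold_locales
  interpret G: labeling l "nat q" g using it(1) by unfold_locales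
  consider "k < 0" | "0 \<le> k" "k \<le> q" | "q < k" by linarith
  then have "num l g vA k = num l f vA k \<and> num l g vB k = num l f vC k \<and> num l g vC k = num l f vB k"
  proof cases
    case 1
    then show ?thesis using F.num_0(1) G.num_0(1) by simp
  next
    case 2
    then show ?thesis
      using it(2)[unfolded represents_def, rule_format, of k] r[unfolded represents_def, rule_format, of k] z
        cnt_turn[OF turn, of k] by simp
  next
    case 3
    then have "int (nat q) \<le> k" using q by simp
    then show ?thesis using F.num_top(1)[of k] G.num_top(1)[of k] by simp
  qed
  then show "num l g vA k = num l f vA k" "num l g vB k = num l f vC k" "num l g vC k = num l f vB k"
    by simp_all
qed

end

section \<open>From labelings to matchings\<close>

text \<open>Uncrossing two arcs lowers the sum of the products of start index and end.\<close>

lemma noncrossing_matching: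
  fixes A E :: "nat \<Rightarrow> int"
  assumes mono: "\<And>i j. i \<in> {1..l} \<Longrightarrow> j \<in> {1..l} \<Longrightarrow> i \<le> j \<Longrightarrow> A i \<le> A j"
    and less: "\<And>i. i \<in> {1..l} \<Longrightarrow> A i < E i"
  obtains \<pi> where "\<pi> permutes {1..l}" "\<And>i. i \<in> {1..l} \<Longrightarrow> A i < E (\<pi> i)"
    "\<And>i j. i \<in> {1..l} \<Longrightarrow> j \<in> {1..l} \<Longrightarrow> i < j \<Longrightarrow> A j < E (\<pi> i) \<Longrightarrow> E (\<pi> j) \<le> E (\<pi> i)"
proof -
  let ?I = "{1..l}"
  let ?S = "{\<pi>. \<pi> permutes ?I \<and> (\<forall>i\<in>?I. A i < E (\<pi> i))}"
  define w where "w \<pi> = (\<Sum>i\<in>?I. int i * E (\<pi> i))" for \<pi>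
  have fin: "finite ?S" using finite_permutations[of ?I] by simp
  have "id \<in> ?S" using less by (simp add: permutes_id)
  then have ne: "?S \<noteq> {}" by blast
  define \<pi> where "\<pi> = arg_min_on w ?S"
  have \<pi>: "\<pi> \<in> ?S" unfolding \<pi>_def by (rule arg_min_if_finite(1)[OF fin ne])
  have min: "w \<pi> \<le> w \<rho>" if "\<rho> \<in> ?S" for \<rho>
    unfolding \<pi>_def using that by (rule arg_min_least[OF fin ne])
  have nc: "E (\<pi> j) \<le> E (\<pi> i)" if i: "i \<in> ?I" and j: "j \<in> ?I" and ij: "i < j" and a: "A j < E (\<pi> i)" for i j
  proof (rule ccontr)
    assume n: "\<not> E (\<pi> j) \<le> E (\<pi> i)"
    let ?\<rho> = "\<pi> \<circ> transpose i j"
    have \<rho>: "?\<rho> i = \<pi> j" "?\<rho> j = \<pi> i" "\<And>k. k \<noteq> i \<Longrightarrow> k \<noteq> j \<Longrightarrow> ?\<rho> k = \<pi> k"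
      by (simp_all add: transpose_def)
    have "?\<rho> permutes ?I"
      using permutes_compose[OF permutes_swap_id[OF i j]] \<pi> by blast
    moreover have "A k < E (?\<rho> k)" if k: "k \<in> ?I" for k
    proof -
      consider "k = i" | "k = j" | "k \<noteq> i" "k \<noteq> j" by blast
      then show ?thesis
      proof cases
        case 1
        then show ?thesis using \<rho>(1) mono[OF i j] ij a n by simp
      next
        case 2
        then show ?thesis using \<rho>(2) a by simp
      next
        case 3
        then show ?thesis using \<rho>(3) \<pi> k by simp
      qed
    qed
    ultimately have "w \<pi> \<le> w ?\<rho>" using min by blast
    moreover have "w \<sigma> = int i * E (\<sigma> i) + (int j * E (\<sigma> j) + (\<Sum>k\<in>?I - {i} - {j}. int k * E (\<sigma> k)))" for \<sigma>
      unfolding w_def using i j ij by (simp add: sum.remove[of _ i] sum.remove[of _ j])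
    moreover have "(\<Sum>k\<in>?I - {i} - {j}. int k * E (?\<rho> k)) = (\<Sum>k\<in>?I - {i} - {j}. int k * E (\<pi> k))"
      by (rule sum.cong) (use \<rho>(3) in auto)
    ultimately have "int i * E (\<pi> i) + int j * E (\<pi> j) \<le> int i * E (\<pi> j) + int j * E (\<pi> i)"
      using \<rho>(1,2) by simp
    then have "0 \<le> (int i - int j) * (E (\<pi> j) - E (\<pi> i))" by (simp add: algebra_simps)
    moreover have "(int i - int j) * (E (\<pi> j) - E (\<pi> i)) < 0"
      using ij n by (intro mult_neg_pos) simp_all
    ultimately show False by simp
  qed
  show thesis using that[of \<pi>] \<pi> nc by blast
qed

lemma card_permutes:
  assumes "\<pi> permutes S" shows "card {i \<in> S. Q (\<pi> i)} = card {i \<in> S. Q i}"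
proof -
  have "bij_betw \<pi> {i \<in> S. Q (\<pi> i)} {i \<in> S. Q i}"
    unfolding bij_betw_def
  proof
    show "inj_on \<pi> {i \<in> S. Q (\<pi> i)}" using permutes_inj[OF assms] by (rule inj_on_subset) simp
    show "\<pi> ` {i \<in> S. Q (\<pi> i)} = {i \<in> S. Q i}"
    proof (intro equalityI subsetI)
      fix j assume j: "j \<in> {i \<in> S. Q i}"
      then obtain i where "j = \<pi> i" "i \<in> S" using permutes_image[OF assms] by blast
      then show "j \<in> \<pi> ` {i \<in> S. Q (\<pi> i)}" using j by blast
    qed (use permutes_in_image[OF assms] in auto)
  qed
  then show ?thesis by (rule bij_betw_same_card)
qed

section \<open>The run belonging to a labeling\<close>

locale initial = labeling +
  fixes \<pi> \<rho> :: "nat \<Rightarrow> nat"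
  assumes \<pi>: "\<pi> permutes {1..l}" and \<rho>: "\<rho> permutes {1..l}"
    and A_less_\<pi>: "i \<in> {1..l} \<Longrightarrow> f (vA, i) < f (vB, \<pi> i)"
    and A_less_\<rho>: "i \<in> {1..l} \<Longrightarrow> f (vA, i) < f (vC, \<rho> i)"
    and nested_\<pi>: "\<lbrakk>i \<in> {1..l}; j \<in> {1..l}; i < j; f (vA, j) < f (vB, \<pi> i)\<rbrakk> \<Longrightarrow> f (vB, \<pi> j) \<le> f (vB, \<pi> i)"
    and nested_\<rho>: "\<lbrakk>i \<in> {1..l}; j \<in> {1..l}; i < j; f (vA, j) < f (vC, \<rho> i)\<rbrakk> \<Longrightarrow> f (vC, \<rho> j) \<le> f (vC, \<rho> i)"
    and l: "l \<ge> 1"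
begin

text \<open>The positions of label \<open>k\<close> are the integers \<open>p\<close> with \<open>cl p = k\<close>; there the ends of arcs, in
  decreasing order of their starts, precede the starts.\<close>

definition M where "M = 2 * int l"
definition pos :: "int \<Rightarrow> int \<Rightarrow> int" where "pos k r = (k - 1) * M + r"
definition cl :: "int \<Rightarrow> int" where "cl p = p div M + 1"
definition a where "a i = pos (f (vA, i)) (int l + int i - 1)"
text \<open>The two ends of token \<open>i\<close> get the same offset, so they coincide exactly
  when their labels agree: this is how ties arise.\<close>

definition b where "b i = pos (f (vB, \<pi> i)) (int l - int i)"
definition c where "c i = pos (f (vC, \<rho> i)) (int l - int i)"
definition N where "N = int q * M"

lemma M: "0 < M" using l by (simp add: M_def)

lemma cl_pos: "0 \<le> r \<Longrightarrow> r < M \<Longrightarrow> cl (pos k r) = k"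
  using M by (simp add: cl_def pos_def div_pos_pos_trivial)

lemma pos_mono: "k < k' \<Longrightarrow> r < M \<Longrightarrow> 0 \<le> r' \<Longrightarrow> pos k r < pos k' r'"
proof -
  assume h: "k < k'" "r < M" "0 \<le> r'"
  have "(k - 1) * M + M = k * M" by (simp add: algebra_simps)
  also have "\<dots> \<le> (k' - 1) * M" using h M by (intro mult_right_mono) simp_all
  finally show ?thesis using h by (simp add: pos_def)
qed

lemma pos_less_iff: "0 \<le> r \<Longrightarrow> r < M \<Longrightarrow> 0 \<le> r' \<Longrightarrow> r' < M \<Longrightarrow>
    pos k r < pos k' r' \<longleftrightarrow> k < k' \<or> k = k' \<and> r < r'"
  using pos_mono[of k k' r r'] pos_mono[of k' k r' r] by (cases k k' rule: linorder_cases) (auto simp: pos_def)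

lemma pos_eq_iff: "0 \<le> r \<Longrightarrow> r < M \<Longrightarrow> 0 \<le> r' \<Longrightarrow> r' < M \<Longrightarrow>
    pos k r = pos k' r' \<longleftrightarrow> k = k' \<and> r = r'"
  using pos_mono[of k k' r r'] pos_mono[of k' k r' r] by (cases k k' rule: linorder_cases) (auto simp: pos_def)

lemma pos_N: "pos k r + N = pos (k + int q) r"
  by (simp add: pos_def N_def algebra_simps)

lemma off: "i \<in> {1..l} \<Longrightarrow> 0 \<le> int l + int i - 1" "i \<in> {1..l} \<Longrightarrow> int l + int i - 1 < M"
  "i \<in> {1..l} \<Longrightarrow> 0 \<le> int l - int i" "i \<in> {1..l} \<Longrightarrow> int l - int i < M"
  by (auto simp: M_def)

lemmas off_iff = pos_less_iff[OF off(1,2) off(1,2)] pos_less_iff[OF off(3,4) off(3,4)]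
  pos_less_iff[OF off(1,2) off(3,4)] pos_less_iff[OF off(3,4) off(1,2)]
  pos_eq_iff[OF off(1,2) off(1,2)] pos_eq_iff[OF off(3,4) off(3,4)]
  pos_eq_iff[OF off(1,2) off(3,4)]

lemma \<pi>_range: "i \<in> {1..l} \<Longrightarrow> f (vB, \<pi> i) \<le> int q" and \<rho>_range: "i \<in> {1..l} \<Longrightarrow> f (vC, \<rho> i) \<le> int q"
  using range(4) permutes_in_image[OF \<pi>] permutes_in_image[OF \<rho>] by simp_all

lemma a_le: "i \<in> {1..l} \<Longrightarrow> j \<in> {1..l} \<Longrightarrow> a i < a j \<longleftrightarrow> i < j"
proof -
  assume i: "i \<in> {1..l}" and j: "j \<in> {1..l}"
  show ?thesis
    using mono[OF i j, of vA] mono[OF j i, of vA] unfolding a_def off_iff(1)[OF i i j j]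
    by (cases i j rule: linorder_cases) auto
qed

lemma arcs: "arc_system {1..l} N a b c"
proof
  fix i assume i: "i \<in> {1..l}"
  show "a i < b i" "a i < c i"
    using A_less_\<pi>[OF i] A_less_\<rho>[OF i] unfolding a_def b_def c_def off_iff(3)[OF i i i i] by simp_all
next
  show "finite {1..l}" by simp
  show "inj_on a {1..l}" "inj_on b {1..l}" "inj_on c {1..l}"
    by (auto simp: inj_on_def a_def b_def c_def off_iff)
next
  fix i j assume i: "i \<in> {1..l}" and j: "j \<in> {1..l}"
  show "a i \<noteq> b j" "a i \<noteq> c j"
    using i j unfolding a_def b_def c_def off_iff(7)[OF i i j j] by auto
  show "i = j" if "b i = c j"
    using that unfolding b_def c_def off_iff(6)[OF i i j j] by simp
  show "b j < b i" if h: "a i < a j" "a j < b i"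
  proof -
    have ij: "i < j" using h(1) a_le[OF i j] by simp
    have "f (vA, j) < f (vB, \<pi> i)"
      using h(2) i j unfolding a_def b_def off_iff(3)[OF j j i i] by auto
    then show ?thesis
      using nested_\<pi>[OF i j ij] ij unfolding b_def off_iff(2)[OF j j i i] by auto
  qed
  show "c j < c i" if h: "a i < a j" "a j < c i"
  proof -
    have ij: "i < j" using h(1) a_le[OF i j] by simp
    have "f (vA, j) < f (vC, \<rho> i)"
      using h(2) i j unfolding a_def c_def off_iff(3)[OF j j i i] by auto
    then show ?thesis
      using nested_\<rho>[OF i j ij] ij unfolding c_def off_iff(2)[OF j j i i] by auto
  qed
  show "b i < a j + N" "c i < a j + N"
    using \<pi>_range[OF i] \<rho>_range[OF i] range(1)[OF j]
    unfolding a_def b_def c_def pos_N off_iff(4)[OF i i j j] by simp_all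
qed

lemma cl_abc: "i \<in> {1..l} \<Longrightarrow> cl (a i) = f (vA, i)" "i \<in> {1..l} \<Longrightarrow> cl (b i) = f (vB, \<pi> i)"
  "i \<in> {1..l} \<Longrightarrow> cl (c i) = f (vC, \<rho> i)"
  using cl_pos off by (simp_all add: a_def b_def c_def)

lemma cl_turn: "int q < cl p \<longleftrightarrow> N \<le> p"
proof
  assume "int q < cl p"
  then have "int q \<le> p div M" by (simp add: cl_def)
  then have "int q * M \<le> p div M * M" using M by (intro mult_right_mono) simp_all
  also have "\<dots> \<le> p" using div_mult_mod_eq[of p M] pos_mod_sign[OF M, of p] by linarith
  finally show "N \<le> p" by (simp add: N_def)
next
  assume "N \<le> p"
  then have "N div M \<le> p div M" using M by (rule zdiv_mono1)
  moreover have "N div M = int q" using M by (simp add: N_def)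
  ultimately show "int q < cl p" by (simp add: cl_def)
qed

lemma cl_shift: "cl (p + N) = cl p + int q"
  using M by (simp add: cl_def N_def)

lemma clusters: "clustered {1..l} N a b c cl (int q)"
proof -
  interpret arc_system "{1..l}" N a b c by (rule arcs)
  show ?thesis
  proof
    show "p \<le> p' \<Longrightarrow> cl p \<le> cl p'" for p p'
      using zdiv_mono1[OF _ M, of p p'] by (simp add: cl_def)
    show "cl (p + N) = cl p + int q" for p by (rule cl_shift)
  next
    fix i assume i: "i \<in> {1..l}"
    show "cl (b i) < cl (a i) + int q" "cl (c i) < cl (a i) + int q"
      using \<pi>_range[OF i] \<rho>_range[OF i] range(1)[OF i] by (simp_all add: cl_abc[OF i])
  next
    fix i j assume i: "i \<in> {1..l}" and j: "j \<in> {1..l}"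
    show "b i < a j" if "cl (b i) = cl (a j)"
      using that i j unfolding cl_abc[OF i] cl_abc[OF j] unfolding a_def b_def off_iff(4)[OF i i j j] by auto
    show "c i < a j" if "cl (c i) = cl (a j)"
      using that i j unfolding cl_abc[OF i] cl_abc[OF j] unfolding a_def c_def off_iff(4)[OF i i j j] by auto
    show "i \<noteq> j \<and> (b i < c j) = (a j < a i)"
      if "b i \<noteq> c i" "b j \<noteq> c j" "cl (b i) = cl (c j)"
      using that unfolding cl_abc[OF i] cl_abc[OF j] a_le[OF j i]
      unfolding b_def c_def off_iff(2)[OF i i j j] by auto
    show "min (b i) (c i) < a j" if "cl (b j) = cl (a i) + int q \<or> cl (c j) = cl (a i) + int q"
      using that \<pi>_range[OF j] \<rho>_range[OF j] range(1)[OF i] unfolding cl_abc[OF i] cl_abc[OF j] by auto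
  qed
qed

lemma run: "clustered_run {1..l} N a b c cl (int q)"
proof -
  have "0 \<le> a i \<and> b i < N \<and> c i < N" if i: "i \<in> {1..l}" for i
  proof -
    have "0 \<le> (f (vA, i) - 1) * M" using range(1)[OF i] M by simp
    then have "0 \<le> a i" using off(1)[OF i] by (simp add: a_def pos_def)
    moreover have "\<not> N \<le> b i" "\<not> N \<le> c i"
      using cl_turn[of "b i"] cl_turn[of "c i"] \<pi>_range[OF i] \<rho>_range[OF i] cl_abc(2,3)[OF i] by simp_all
    ultimately show ?thesis by simp
  qed
  then have "arc_run {1..l} N a b c" using arcs l by (simp add: arc_run_def)
  then show ?thesis using clusters by (simp add: clustered_run_def clustered_run_axioms_def)
qed

lemma turn:
  defines "g \<equiv> (promotion l q ^^ q) f"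
  shows "g \<in> labelings l q" "num l g vA k = num l f vA k" "num l g vB k = num l f vC k"
    "num l g vC k = num l f vB k"
proof -
  interpret R: clustered_run "{1..l}" N a b c cl "int q" by (rule run)
  have P0: "1 \<le> cl p \<and> cl p \<le> int q" if p: "p \<in> R.P 0" for p
  proof -
    have "1 \<le> cl (a i) \<and> cl (a i) \<le> int q" "1 \<le> cl (b i) \<and> cl (b i) \<le> int q" "1 \<le> cl (c i) \<and> cl (c i) \<le> int q"
      if i: "i \<in> {1..l}" for i
      using \<pi>_range[OF i] \<rho>_range[OF i] range(1,2)[OF i] A_less_\<pi>[OF i] A_less_\<rho>[OF i]
      by (simp_all add: cl_abc[OF i])
    moreover obtain i where "i \<in> {1..l}" "p = a i \<or> p = b i \<or> p = c i"
      using p unfolding R.P_def R.PA_def R.PB_def R.PC_def R.zero by blast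
    ultimately show ?thesis by blast
  qed
  have z: "R.first 0 = 0"
  proof (rule ccontr)
    assume "R.first 0 \<noteq> 0"
    then have "cl (R.src 0) \<le> 0" by (intro R.first(2)) simp
    moreover have "R.src 0 \<in> R.P 0" unfolding R.P_def using R.src_PA by blast
    ultimately show False using P0[of "R.src 0"] by linarith
  qed
  have rep: "R.represents l 0 f"
  proof -
    have "int (num l f vA k) = R.cnt a k" "int (num l f vB k) = R.cnt b k" "int (num l f vC k) = R.cnt c k" for k
    proof -
      have "{i \<in> {1..l}. cl (a i) \<le> k} = {i \<in> {1..l}. f (vA, i) \<le> k}"
        "{i \<in> {1..l}. cl (b i) \<le> k} = {i \<in> {1..l}. f (vB, \<pi> i) \<le> k}"
        "{i \<in> {1..l}. cl (c i) \<le> k} = {i \<in> {1..l}. f (vC, \<rho> i) \<le> k}"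
        using cl_abc by auto
      then show "int (num l f vA k) = R.cnt a k" "int (num l f vB k) = R.cnt b k" "int (num l f vC k) = R.cnt c k"
        using card_permutes[OF \<pi>, of "\<lambda>i. f (vB, i) \<le> k"] card_permutes[OF \<rho>, of "\<lambda>i. f (vC, i) \<le> k"]
        unfolding num_def R.cnt_def by simp_all
    qed
    then show ?thesis unfolding R.represents_def z R.zero add_0 by blast
  qed
  have cI: "card {1..l} = l" by simp
  note T = R.represents_turn[of f l, unfolded nat_int, OF f rep _ cI z cl_turn]
  show "g \<in> labelings l q" "num l g vA k = num l f vA k" "num l g vB k = num l f vC k"
    "num l g vC k = num l f vB k"
    unfolding g_def using T P0 by blast+
qed

end

section \<open>The order of promotion\<close>

lemma promotion_turn:
  assumes f: "f \<in> labelings l q" and l: "l \<ge> 1"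
  defines "g \<equiv> (promotion l q ^^ q) f"
  shows "g \<in> labelings l q \<and> num l g vA k = num l f vA k \<and> num l g vB k = num l f vC k \<and>
    num l g vC k = num l f vB k"
proof -
  interpret labeling l q f using f by unfold_locales
  obtain \<pi> where \<pi>: "\<pi> permutes {1..l}" "\<And>i. i \<in> {1..l} \<Longrightarrow> f (vA, i) < f (vB, \<pi> i)"
    "\<And>i j. i \<in> {1..l} \<Longrightarrow> j \<in> {1..l} \<Longrightarrow> i < j \<Longrightarrow> f (vA, j) < f (vB, \<pi> i) \<Longrightarrow> f (vB, \<pi> j) \<le> f (vB, \<pi> i)"
    by (rule noncrossing_matching[of l "\<lambda>i. f (vA, i)" "\<lambda>i. f (vB, i)"]) (use mono AB in auto)
  obtain \<rho> where \<rho>: "\<rho> permutes {1..l}" "\<And>i. i \<in> {1..l} \<Longrightarrow> f (vA, i) < f (vC, \<rho> i)"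
    "\<And>i j. i \<in> {1..l} \<Longrightarrow> j \<in> {1..l} \<Longrightarrow> i < j \<Longrightarrow> f (vA, j) < f (vC, \<rho> i) \<Longrightarrow> f (vC, \<rho> j) \<le> f (vC, \<rho> i)"
    by (rule noncrossing_matching[of l "\<lambda>i. f (vA, i)" "\<lambda>i. f (vC, i)"]) (use mono AC in auto)
  interpret initial l q f \<pi> \<rho> using \<pi> \<rho> l by unfold_locales
  show ?thesis unfolding g_def using turn by simp
qed

lemma promotion_2q:
  assumes f: "f \<in> labelings l q" and l: "l \<ge> 1"
  shows "(promotion l q ^^ (2 * q)) f = f"
proof -
  let ?g = "(promotion l q ^^ q) f"
  have g: "?g \<in> labelings l q" using promotion_turn[OF f l] by blast
  have eq: "(promotion l q ^^ (2 * q)) f = (promotion l q ^^ q) ?g"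
    by (simp add: mult_2 funpow_add)
  show ?thesis
    unfolding eq
  proof (rule labelings_eqI[OF _ f])
    show "(promotion l q ^^ q) ?g \<in> labelings l q" using promotion_turn[OF g l] by blast
    fix p k
    show "num l ((promotion l q ^^ q) ?g) p k = num l f p k"
      using promotion_turn[OF g l, of k] promotion_turn[OF f l, of k] by (cases p) simp_all
  qed
qed

text \<open>Elements of \<open>BijGroup S\<close> are extensional and multiply by
  \<open>compose\<close>, so plain iterates have to be restricted to \<open>S\<close>.\<close>

lemma BijGroup_pow:
  assumes h: "bij_betw h S S"
  shows "restrict h S [^]\<^bsub>BijGroup S\<^esub> (n :: nat) = restrict (h ^^ n) S"
proof (induction n)
  case 0
  then show ?case by (simp add: nat_pow_def BijGroup_def)
next
  case (Suc n)
  have hn: "bij_betw (h ^^ n) S S" using h by (rule bij_betw_funpow)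
  have Bij: "restrict k S \<in> Bij S" if "bij_betw k S S" for k
    using that by (simp add: Bij_def cong: bij_betw_cong)
  have "compose S (restrict (h ^^ n) S) (restrict h S) = restrict (h ^^ Suc n) S"
  proof
    fix x
    show "compose S (restrict (h ^^ n) S) (restrict h S) x = restrict (h ^^ Suc n) S x"
      using bij_betwE[OF h] by (simp add: compose_def funpow_swap1)
  qed
  moreover have "restrict (h ^^ n) S \<otimes>\<^bsub>BijGroup S\<^esub> restrict h S = compose S (restrict (h ^^ n) S) (restrict h S)"
    using Bij[OF h] Bij[OF hn] unfolding BijGroup_def by (simp only: monoid.simps partial_object.simps restrict_apply if_True)
  moreover have "restrict h S [^]\<^bsub>BijGroup S\<^esub> Suc n =
      (restrict h S [^]\<^bsub>BijGroup S\<^esub> n) \<otimes>\<^bsub>BijGroup S\<^esub> restrict h S"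
    by (rule nat_pow_Suc)
  ultimately show ?case unfolding Suc by (simp only:)
qed

theorem theorem4:
  fixes l q :: nat
  assumes "l \<ge> 1" and "q \<ge> 3"
  shows "bij_betw (promotion l q) (labelings l q) (labelings l q) \<and>
         group.ord (BijGroup (labelings l q))
           (restrict (promotion l q) (labelings l q)) dvd 2 * q \<and>
         (\<forall>f\<in>labelings l q. (promotion l q ^^ (2 * q)) f = f)"
proof -
  let ?S = "labelings l q" and ?h = "promotion l q"
  have per: "(?h ^^ (2 * q)) f = f" if "f \<in> ?S" for f using promotion_2q[OF that assms(1)] .
  have mem: "?h f \<in> ?S" if "f \<in> ?S" for f using promotion_num(1)[OF that] assms(2) by simp
  have memn: "(?h ^^ n) f \<in> ?S" if "f \<in> ?S" for f n using that mem by (induction n) simp_all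
  \<comment> \<open>The iterate \<open>?h ^^ m\<close> will serve as the inverse of
    \<open>?h\<close>.\<close>
  obtain m where m: "2 * q = Suc m" using assms(2) by (cases "2 * q") simp_all
  have bij: "bij_betw ?h ?S ?S"
  proof (rule bij_betw_byWitness[where f' = "?h ^^ m"])
    show "\<forall>f\<in>?S. (?h ^^ m) (?h f) = f" using per m by (simp add: funpow_swap1)
    show "\<forall>f\<in>?S. ?h ((?h ^^ m) f) = f" using per m by simp
    show "?h ` ?S \<subseteq> ?S" "(?h ^^ m) ` ?S \<subseteq> ?S" using mem memn by blast+
  qed
  interpret G: group "BijGroup ?S" by (rule group_BijGroup)
  have carr: "restrict ?h ?S \<in> carrier (BijGroup ?S)"
    using bij by (simp add: BijGroup_def Bij_def cong: bij_betw_cong)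
  have "restrict (?h ^^ (2 * q)) ?S = (\<lambda>f\<in>?S. f)" using per by (auto intro!: restrict_ext)
  then have "restrict ?h ?S [^]\<^bsub>BijGroup ?S\<^esub> (2 * q) = \<one>\<^bsub>BijGroup ?S\<^esub>"
    unfolding BijGroup_pow[OF bij] by (simp add: BijGroup_def)
  then show ?thesis using bij per G.pow_eq_id[OF carr] by blast
qed

end
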